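(* Let $\lambda>W(e^{\pi-1})$ (so that $0<\omega<\frac\pi4$), let $N$ be a positive integer, let $z=\lambda a$ and $\theta=\arg a$ with $|\theta|<-\omega+\pi$. Then \[ |R_N(a,\lambda)|\le\left|\frac{a^N}{(z+a)^{2N+1}}\right|\frac{2(\lambda+1)^{2N+1}}{\sqrt{2\pi}}\int_0^{+\infty}t^{N-\frac12}e^{-t|\lambda+\log\lambda+1+\pi i|}\left|\Gamma^\ast(te^{i\omega})\right|dt\;\times\;\frac12\bigl(C_1(\theta)+C_2(\theta)\bigr), \] where \[ C_1(\theta)=\begin{cases}|\csc(\theta-\omega)| & \text{if }\omega-\pi<\theta<\omega-\frac\pi2\text{ or }\omega+\frac\pi2<\theta<-\omega+\pi,\\ 1 & \text{if }\omega-\frac\pi2\le\theta\le\omega+\frac\pi2,\end{cases} \] \[ C_2(\theta)=\begin{cases}|\csc(\theta+\omega)| & \text{if }\omega-\pi<\theta<-\omega-\frac\pi2\text{ or }-\omega+\frac\pi2<\theta<-\omega+\pi,\\ 1 & \text{if }-\omega-\frac\pi2\le\theta\le-\omega+\frac\pi2.\end{cases} \] Moreover, if $N\ge2$, then \[ \begin{aligned} &\left|\frac{a^N}{(z+a)^{2N+1}}\right|\frac{2(\lambda+1)^{2N+1}}{\sqrt{2\pi}}\int_0^{+\infty}t^{N-\frac12}e^{-t|\lambda+\log\lambda+1+\pi i|}\left|\Gamma^\ast(te^{i\omega})\right|dt\\ &\le\left|\frac{a^N}{(z+a)^{2N+1}}\right|\frac{\Gamma(N+\frac12)(\lambda+1)^{2N+1}}{\left(\frac12\pi|\lambda+\log\lambda+1+\pi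 i|\right)^{\frac12}|\lambda+\log\lambda+1+\pi i|^N}\left(1+\frac{|\lambda+\log\lambda+1+\pi i|}{12(N-\frac12)}+\frac{|\lambda+\log\lambda+1+\pi i|^2}{288(N-\frac12)(N-\frac32)}\right). \end{aligned} \]
   Context: For $\lambda>0$, $\omega=\omega(\lambda)=\arg(\lambda+\log\lambda+1+\pi i)\in(0,\pi)$; $a$ is a nonzero complex number. $W$ is the principal branch of the Lambert $W$-function. With $z=\lambda a$, the remainder $R_N(a,\lambda)$ is defined by \[ \Gamma(-a,z)=z^{-a}e^{-z}\left(\sum_{n=0}^{N-1}\frac{a^n b_n(-\lambda)}{(z+a)^{2n+1}}+R_N(a,\lambda)\right) \] (principal values; $\Gamma(\cdot,\cdot)$ is the upper incomplete gamma function), where \[ b_n(-\lambda)=(\lambda+1)^n\left[\frac{d^n}{dt^n}\left(\frac{(\lambda+1)t}{\lambda e^t+t-\lambda}\right)^{n+1}\right]_{t=0} \] and the function in the bracket takes the value $1$ at its removable singularity $t=0$. The scaled gamma function is $\Gamma^\ast(z)=\Gamma(z)/(\sqrt{2\pi}\,z^{z-\frac12}e^{-z})$ for $|\arg z|<\pi$. *)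

theory Defs
  imports "HOL-Complex_Analysis.Complex_Analysis"
begin

text \<open>Principal branch of the Lambert function on the real interval \<open>[-1/e, \<infinity>)\<close>.\<close>

definition lambert_W :: "real \<Rightarrow> real" where
  "lambert_W x = (THE w. - 1 \<le> w \<and> w * exp w = x)"

text \<open>
  Principal value of \<open>\<integral>\<^sub>z\<^sup>\<infinity> w\<^bsup>s - 1\<^esup> e\<^bsup>-w\<^esup> dw\<close>, for \<open>z\<close> off the cut \<open>(-\<infinity>, 0]\<close>. The path is the
  horizontal ray \<open>w = z + u\<close>, \<open>u \<ge> 0\<close>, which does not meet the cut.
\<close>

definition upper_Gamma :: "complex \<Rightarrow> complex \<Rightarrow> complex" where
  "upper_Gamma s z =
     (LINT u:{0<..}|lborel. (z + of_real u) powr (s - 1) * exp (- (z + of_real u)))"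

definition scaled_Gamma :: "complex \<Rightarrow> complex" where
  "scaled_Gamma z = Gamma z / (of_real (sqrt (2 * pi)) * z powr (z - 1 / 2) * exp (- z))"

definition saddle :: "real \<Rightarrow> complex" where
  "saddle l = of_real l + of_real (ln l) + 1 + of_real pi * \<i>"

definition omega :: "real \<Rightarrow> real" where
  "omega l = Arg (saddle l)"

text \<open>\<open>b_neg n l\<close> is \<open>b\<^sub>n(-l)\<close>, for \<open>l > 0\<close>.\<close>

definition b_neg :: "nat \<Rightarrow> real \<Rightarrow> real" where
  "b_neg n l = (l + 1) ^ n *
     (deriv ^^ n)
       (\<lambda>t. (if t = 0 then 1 else (l + 1) * t / (l * exp t + t - l)) ^ (n + 1)) 0"

text \<open>The defining equation of \<open>R\<^sub>N(a, l)\<close>, solved for the remainder.\<close>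

definition remainder :: "nat \<Rightarrow> complex \<Rightarrow> real \<Rightarrow> complex" where
  "remainder N a l = (let z = of_real l * a in
     upper_Gamma (- a) z / (z powr (- a) * exp (- z))
       - (\<Sum>n<N. a ^ n * of_real (b_neg n l) / (z + a) ^ (2 * n + 1)))"

text \<open>
  The factors \<open>C\<^sub>1\<close> and \<open>C\<^sub>2\<close> as functions of \<open>w = omega l\<close> and \<open>\<theta>\<close>. For \<open>0 < w < pi / 4\<close> and
  \<open>\<bar>\<theta>\<bar> < pi - w\<close> the last branch is exactly \<open>w - pi / 2 \<le> \<theta> \<le> w + pi / 2\<close>, respectively
  \<open>- w - pi / 2 \<le> \<theta> \<le> - w + pi / 2\<close>.
\<close>

definition C1 :: "real \<Rightarrow> real \<Rightarrow> real" where
  "C1 w \<theta> =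
     (if w - pi < \<theta> \<and> \<theta> < w - pi / 2 \<or> w + pi / 2 < \<theta> \<and> \<theta> < - w + pi
      then \<bar>1 / sin (\<theta> - w)\<bar> else 1)"

definition C2 :: "real \<Rightarrow> real \<Rightarrow> real" where
  "C2 w \<theta> =
     (if w - pi < \<theta> \<and> \<theta> < - w - pi / 2 \<or> - w + pi / 2 < \<theta> \<and> \<theta> < - w + pi
      then \<bar>1 / sin (\<theta> + w)\<bar> else 1)"

end

(* Put f(t) = l e^t + t - l. For a > 0 the substitution s/a + ln(1 + s/(l a)) = f(t) turns
   Gamma(-a, l a) into a Laplace integral whose density is a residue of 1/(f - u)^2. Since f maps
   the lines Im t = +-pi to curves off the real axis and has a single zero of f - u in the strip
   between them, that residue is an integral over the two lines; there a double exponential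
   integral evaluates to Gamma(x) (l x)^(-x). The outcome is that the remainder R_N is, up to the
   factor (-1)^N / (2 pi i a^N), the difference J(a) - cnj (J (cnj a)), where J is the Stieltjes
   integral of t^N Gamma(t w) (l t w)^(-t w) e^(...) / (a + t w) along the ray of direction
   w = e^(i omega). Both sides are holomorphic in the sector |arg a| < pi - omega, so the identity
   extends from a > 0 to that sector, and |a + t w| >= |a| / C yields the first inequality.
   The second one follows from |Gamma*(z)| <= 1 + 1/(12|z|) + 1/(288|z|^2) for |arg z| <= pi/4,
   which is obtained from Gudermann's series for ln Gamma*. *)
theory Submission
  imports Defs
begin

text \<open>Order \<open>n = 1\<close> is the first with absolute convergence: on the lines
  \<open>Im t = pi\<close> and \<open>Im t = - pi\<close> the function \<open>1 / (f - u)\<close>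
  decays only like \<open>1 / |t|\<close> to the left. Hence one integration by parts splits off the
  term \<open>n = 0\<close> and leaves a density belonging to the square; all later terms come from
  \<open>x / (a + x) + a / (a + x) = 1\<close> inside the Stieltjes integral. On the upper line
  \<open>u - Re f >= |y + ln l| + (l + ln l)\<close>, which is where positivity of
  \<open>l + ln l\<close> enters. The number \<open>l + ln l + 1 + i pi\<close> is minus the
  conjugate of the critical value of \<open>f\<close> at \<open>- ln l + i pi\<close>. Along the
  direction of its argument \<open>omega\<close> the exponential in the kernel has a real exponent.
  The hypothesis on \<open>l\<close> makes its real part exceed its imaginary part, so the ray stays
  in \<open>|arg| < pi / 4\<close>. The obstacle to the bound for Gamma* there is that the integrand
  of the defect of Gudermann's series changes sign at \<open>|arg| = pi / 8\<close>. Therefore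
  separate regions are treated: near the origin by Euler's integral, in a narrow cone by a
  quantitative lower bound for the defect, up to \<open>pi / 8\<close> by its sign, and beyond by
  bounding its negative part.\<close>

section \<open>Holomorphic parameter integrals\<close>

text \<open>The majorant \<open>g\<close> concerns \<open>f\<close> and not its derivative. Cauchy's
  inequality on discs of radius \<open>r/2\<close> about points of \<open>ball a (r/2)\<close>
  bounds the derivative in \<open>z\<close> by \<open>2 * g s / r\<close>; hence the difference
  quotients are dominated too, and dominated convergence along sequences applies.\<close>

lemma DERIV_lebesgue_integral_holomorphic:
  fixes f :: "complex \<Rightarrow> 'b \<Rightarrow> complex"
  assumes r: "r > 0" "cball a r \<subseteq> U"
    and holo: "\<And>s. s \<in> space M \<Longrightarrow> (\<lambda>z. f z s) holomorphic_on U"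
    and meas: "\<And>z. z \<in> U \<Longrightarrow> f z \<in> borel_measurable M"
    and g: "integrable M g" "\<And>z s. z \<in> cball a r \<Longrightarrow> s \<in> space M \<Longrightarrow> cmod (f z s) \<le> g s"
  shows "(\<lambda>z. \<integral>s. f z s \<partial>M) field_differentiable (at a)"
proof -
  have aU: "a \<in> U" using r by auto
  have holo_ball: "(\<lambda>z. f z s) holomorphic_on ball a r" if "s \<in> space M" for s
    by (rule holomorphic_on_subset[OF holo[OF that]]) (use r ball_subset_cball in blast)
  have fint: "integrable M (f z)" if "z \<in> cball a r" for z
    by (rule Bochner_Integration.integrable_bound[OF g(1) meas]) (use that r g(2) in \<open>auto intro!: AE_I2 order_trans[OF g(2) abs_ge_self]\<close>)
  have lip: "cmod (f z s - f a s) \<le> 2 * g s / r * cmod (z - a)"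
    if "z \<in> ball a (r/2)" "s \<in> space M" for z s
  proof (rule field_differentiable_bound[where S = "ball a (r/2)" and f' = "\<lambda>w. deriv (\<lambda>z. f z s) w"])
    fix w assume w: "w \<in> ball a (r/2)"
    have sub: "cball w (r/2) \<subseteq> cball a r"
    proof
      fix x assume "x \<in> cball w (r/2)"
      then show "x \<in> cball a r"
        using w dist_triangle[of a x w] by (auto simp: field_simps)
    qed
    have "w \<in> ball a r" using w r by auto
    then show "((\<lambda>z. f z s) has_field_derivative deriv (\<lambda>z. f z s) w) (at w within ball a (r/2))"
      using holomorphic_derivI[OF holo_ball[OF that(2)] open_ball] by (blast intro: has_field_derivative_at_within)
    have h2: "(\<lambda>z. f z s) holomorphic_on cball w (r/2)"
      by (rule holomorphic_on_subset[OF holo[OF that(2)]]) (use sub r in blast)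
    have "cmod ((deriv ^^ 1) (\<lambda>z. f z s) w) \<le> fact 1 * g s / (r/2)^1"
    proof (rule Cauchy_inequality)
      show "(\<lambda>z. f z s) holomorphic_on ball w (r/2)"
        using h2 by (rule holomorphic_on_subset) auto
      show "continuous_on (cball w (r/2)) (\<lambda>z. f z s)"
        using h2 by (rule holomorphic_on_imp_continuous_on)
      fix x assume "cmod (w - x) = r/2"
      then have "x \<in> cball w (r/2)" by (simp add: dist_norm)
      then show "cmod (f x s) \<le> g s" using sub g(2) that by blast
    qed (use r in auto)
    then show "cmod (deriv (\<lambda>z. f z s) w) \<le> 2 * g s / r" by (simp add: mult.commute)
  qed (use that r in auto)
  define D where "D = (\<lambda>s. deriv (\<lambda>z. f z s) a)"
  have lim: "((\<lambda>z. (f z s - f a s) / (z - a)) \<longlongrightarrow> D s) (at a)" if "s \<in> space M" for s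
  proof -
    have "((\<lambda>z. f z s) has_field_derivative D s) (at a)"
      unfolding D_def by (rule holomorphic_derivI[OF holo_ball[OF that] open_ball]) (use r in auto)
    then show ?thesis by (simp add: has_field_derivative_iff)
  qed
  have "((\<lambda>z. ((\<integral>s. f z s \<partial>M) - (\<integral>s. f a s \<partial>M)) / (z - a)) \<longlongrightarrow> (\<integral>s. D s \<partial>M)) (at a within ball a (r/2))"
    unfolding tendsto_at_iff_sequentially
  proof (intro allI impI)
    fix X :: "nat \<Rightarrow> complex"
    assume X: "\<forall>i. X i \<in> ball a (r/2) - {a}" "X \<longlonglongrightarrow> a"
    have XU: "X i \<in> U" "X i \<in> cball a r" for i
      using X(1) r by (auto simp: subset_iff dest!: spec[of _ i]) 
    have eq: "((\<integral>s. f (X i) s \<partial>M) - (\<integral>s. f a s \<partial>M)) / (X i - a) = (\<integral>s. (f (X i) s - f a s) / (X i - a) \<partial>M)" for i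
      using fint[OF XU(2)[of i]] fint[of a] r by simp
    have limX: "(\<lambda>i. (f (X i) s - f a s) / (X i - a)) \<longlonglongrightarrow> D s" if "s \<in> space M" for s
    proof -
      have "\<forall>i. X i \<in> UNIV - {a}" using X by auto
      with lim[OF that] X(2) show ?thesis
        unfolding tendsto_at_iff_sequentially by (auto simp: o_def)
    qed
    have Dm: "D \<in> borel_measurable M"
      by (rule borel_measurable_LIMSEQ_metric[where f = "\<lambda>i s. (f (X i) s - f a s) / (X i - a)"])
         (use meas XU aU limX in auto)
    have "(\<lambda>i. \<integral>s. (f (X i) s - f a s) / (X i - a) \<partial>M) \<longlonglongrightarrow> (\<integral>s. D s \<partial>M)"
    proof (rule integral_dominated_convergence[where w = "\<lambda>s. 2 * g s / r"])
      show "AE x in M. norm ((f (X i) x - f a x) / (X i - a)) \<le> 2 * g x / r" for i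
      proof (rule AE_I2)
        fix s assume s: "s \<in> space M"
        have "X i \<in> ball a (r/2)" "X i \<noteq> a" using X by auto
        then show "norm ((f (X i) s - f a s) / (X i - a)) \<le> 2 * g s / r"
          using lip[of "X i" s] s r by (simp add: norm_divide field_simps)
      qed
    qed (use meas XU aU Dm limX g in auto)
    then show "((\<lambda>z. ((\<integral>s. f z s \<partial>M) - (\<integral>s. f a s \<partial>M)) / (z - a)) \<circ> X) \<longlonglongrightarrow> (\<integral>s. D s \<partial>M)"
      by (simp add: o_def eq)
  qed
  then have "((\<lambda>z. \<integral>s. f z s \<partial>M) has_field_derivative (\<integral>s. D s \<partial>M)) (at a within ball a (r/2))"
    by (simp add: has_field_derivative_iff)
  then have "((\<lambda>z. \<integral>s. f z s \<partial>M) has_field_derivative (\<integral>s. D s \<partial>M)) (at a)"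
    using r by (subst (asm) at_within_open) auto
  then show ?thesis by (auto simp: field_differentiable_def)
qed

lemma holomorphic_on_lebesgue_integral:
  fixes f :: "complex \<Rightarrow> 'b \<Rightarrow> complex"
  assumes holo: "\<And>s. s \<in> space M \<Longrightarrow> (\<lambda>z. f z s) holomorphic_on U"
    and meas: "\<And>z. z \<in> U \<Longrightarrow> f z \<in> borel_measurable M"
    and dom: "\<And>a. a \<in> U \<Longrightarrow> \<exists>r>0. \<exists>g. cball a r \<subseteq> U \<and> integrable M g \<and>
                (\<forall>z\<in>cball a r. \<forall>s\<in>space M. cmod (f z s) \<le> g s)"
  shows "(\<lambda>z. \<integral>s. f z s \<partial>M) holomorphic_on U"
proof (unfold holomorphic_on_def, intro ballI)
  fix a assume "a \<in> U"
  from dom[OF this] obtain r g where rg: "r > 0" "cball a r \<subseteq> U" "integrable M g"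
    "\<And>z s. z \<in> cball a r \<Longrightarrow> s \<in> space M \<Longrightarrow> cmod (f z s) \<le> g s" by blast
  have "(\<lambda>z. \<integral>s. f z s \<partial>M) field_differentiable (at a)"
    by (rule DERIV_lebesgue_integral_holomorphic[OF rg(1,2) holo meas rg(3,4)])
  then show "(\<lambda>z. \<integral>s. f z s \<partial>M) field_differentiable (at a within U)"
    by (rule field_differentiable_at_within)
qed

section \<open>Bounds for the scaled gamma function\<close>

text \<open>The summand of Gudermann's series: \<open>ln \<Gamma>\<^sup>*(z) = \<Sum>k. binet_step (z + k)\<close>.\<close>

definition binet_step :: "complex \<Rightarrow> complex" where
  "binet_step z = (z + 1/2) * (Ln (z + 1) - Ln z) - 1"

text \<open>The functional equation \<open>Gamma (z + 1) = z * Gamma z\<close> with every power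
  written as an exponential; the exponents that remain add up to
  \<open>binet_step z\<close>.\<close>

lemma scaled_Gamma_shift:
  assumes "Re z > 0"
  shows "scaled_Gamma z = scaled_Gamma (z + 1) * exp (binet_step z)"
proof -
  have nz: "z \<noteq> 0" "z + 1 \<noteq> 0" using assms by (auto simp: complex_eq_iff)
  have "z \<notin> \<int>\<^sub>\<le>\<^sub>0" using assms by (auto elim!: nonpos_Ints_cases)
  then have G: "Gamma (z + 1) = exp (Ln z) * Gamma z"
    using nz by (simp add: Gamma_plus1)
  have "exp (Ln z) / (exp ((z + 1 - 1/2) * Ln (z + 1)) * exp (- (z + 1))) * exp (binet_step z)
      = exp (Ln z - (z + 1 - 1/2) * Ln (z + 1) - (- (z + 1)) + binet_step z)"
    unfolding exp_add exp_diff by (simp only: divide_divide_eq_left)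
  also have "Ln z - (z + 1 - 1/2) * Ln (z + 1) - (- (z + 1)) + binet_step z = 0 - (z - 1/2) * Ln z - (- z)"
    by (simp add: binet_step_def algebra_simps diff_divide_distrib)
  also have "exp (0 - (z - 1/2) * Ln z - (- z)) = 1 / (exp ((z - 1/2) * Ln z) * exp (- z))"
    unfolding exp_diff by simp
  finally have E: "exp (Ln z) / (exp ((z + 1 - 1/2) * Ln (z + 1)) * exp (- (z + 1))) * exp (binet_step z)
      = 1 / (exp ((z - 1/2) * Ln z) * exp (- z))" .
  have "scaled_Gamma (z + 1) * exp (binet_step z) = Gamma z / of_real (sqrt (2 * pi)) *
      (exp (Ln z) / (exp ((z + 1 - 1/2) * Ln (z + 1)) * exp (- (z + 1))) * exp (binet_step z))"
    using nz by (simp add: scaled_Gamma_def powr_def G mult_ac)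
  also have "\<dots> = scaled_Gamma z"
    unfolding E using nz by (simp add: scaled_Gamma_def powr_def)
  finally show ?thesis by simp
qed

text \<open>Three integrations by parts of \<open>P (w - z) / (4 w^4)\<close> with
  \<open>P r = (r (1 - r))^2\<close>. The last integrand is \<open>(w - z - 1/2) / w\<close>, which
  yields the logarithm with the coefficient \<open>z + 1/2\<close> of
  \<open>binet_step\<close>.\<close>

lemma binet_antiderivative:
  fixes z w :: complex
  assumes "w \<noteq> 0" "w \<notin> \<real>\<^sub>\<le>\<^sub>0"
  shows "((\<lambda>w. - (1/12) * ((w - z) * (1 - (w - z)))^2 * inverse w^3
     - (1/12) * ((w - z) * (1 - (w - z)) * (1 - 2 * (w - z))) * inverse w^2
     - (1/12) * (1 - 6 * (w - z) + 6 * (w - z)^2) * inverse w + (w - z) - (z + 1/2) * Ln w)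
     has_field_derivative ((w - z) * (1 - (w - z)))^2 / 4 / w ^ 4) (at w)"
proof -
  define R where "R = w - z"
  have z: "z = w - R" by (simp add: R_def)
  show ?thesis
    apply (rule derivative_eq_intros refl assms)+
    unfolding R_def[symmetric] unfolding z using assms(1)
    apply (simp add: field_simps)
    apply (simp add: power2_eq_square power3_eq_cube eval_nat_numeral algebra_simps)
    done
qed

lemma binet_step_integral:
  assumes "Re z > 0"
  shows "((\<lambda>r. complex_of_real ((r * (1 - r))\<^sup>2 / 4) / (z + of_real r) ^ 4) has_integral
           (1 / (12 * z * (z + 1)) - binet_step z)) {0..1}"
proof -
  define A where "A = (\<lambda>w. - (1/12) * ((w - z) * (1 - (w - z)))^2 * inverse w^3
     - (1/12) * ((w - z) * (1 - (w - z)) * (1 - 2 * (w - z))) * inverse w^2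
     - (1/12) * (1 - 6 * (w - z) + 6 * (w - z)^2) * inverse w + (w - z) - (z + 1/2) * Ln w)"
  have nz: "z \<noteq> 0" "1 + z \<noteq> 0" using assms by (auto simp: complex_eq_iff)
  have "((\<lambda>r. complex_of_real ((r * (1 - r))\<^sup>2 / 4) / (z + of_real r) ^ 4) has_integral
           (A (z + of_real 1) - A (z + of_real 0))) {0..1}"
  proof (rule fundamental_theorem_of_calculus)
    fix r :: real assume r: "r \<in> {0..1}"
    have w: "z + of_real r \<noteq> 0" "z + of_real r \<notin> \<real>\<^sub>\<le>\<^sub>0"
      using assms r by (auto simp: complex_eq_iff complex_nonpos_Reals_iff)
    have "(A has_field_derivative (of_real ((r * (1 - r))\<^sup>2 / 4) / (z + of_real r) ^ 4)) (at (z + of_real r))"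
      using binet_antiderivative[OF w, of z] unfolding A_def by simp
    then have "(A has_field_derivative (of_real ((r * (1 - r))\<^sup>2 / 4) / (z + of_real r) ^ 4))
        (at (z + of_real r) within (\<lambda>r. z + of_real r) ` {0..1})"
      by (rule has_field_derivative_at_within)
    moreover have "((\<lambda>r. z + of_real r) has_vector_derivative 1) (at r within {0..1})"
      by (auto intro!: derivative_eq_intros)
    ultimately show "((\<lambda>r. A (z + of_real r)) has_vector_derivative
          (of_real ((r * (1 - r))\<^sup>2 / 4) / (z + of_real r) ^ 4)) (at r within {0..1})"
      using field_vector_diff_chain_within[of "\<lambda>r. z + of_real r" 1 r "{0..1}" A] by (simp only: o_def mult_1)
  qed simp
  \<comment> \<open>The weight \<open>(r (1 - r))^2\<close> vanishes to second order at both ends,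
    so only the term with its second derivative, \<open>w - z\<close> and the logarithm
    contribute.\<close>
  also have "A (z + of_real 1) = - (1/12) * inverse (z + 1) + 1 - (z + 1/2) * Ln (z + 1)"
    by (simp add: A_def)
  also have "A (z + of_real 0) = - (1/12) * inverse z - (z + 1/2) * Ln z"
    by (simp add: A_def)
  also have "(- (1/12) * inverse (z + 1) + 1 - (z + 1/2) * Ln (z + 1)) - (- (1/12) * inverse z - (z + 1/2) * Ln z)
      = (1/12) * (inverse z - inverse (z + 1)) - binet_step z"
    by (simp add: binet_step_def algebra_simps diff_divide_distrib)
  also have "(1/12) * (inverse z - inverse (z + 1)) = 1 / (12 * z * (z + 1))"
    using nz by (simp add: inverse_eq_divide diff_frac_eq add.commute mult.assoc)
  finally show ?thesis .
qed

text \<open>Comparing with the telescoping sum of \<open>1/(12 z (z + 1)) = (1/z - 1/(z + 1))/12\<close> isolates the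
  leading term \<open>1/(12 z)\<close> of \<open>ln \<Gamma>\<^sup>*(z)\<close>; only lower bounds for the real part of the defect are needed.\<close>

definition binet_defect :: "complex \<Rightarrow> complex" where
  "binet_defect z = 1 / (12 * z * (z + 1)) - binet_step z"

lemma Re_binet_defect_integral:
  assumes "Re z > 0"
  shows "((\<lambda>r. (r * (1 - r))\<^sup>2 / 4 * Re (1 / (z + of_real r) ^ 4)) has_integral Re (binet_defect z)) {0..1}"
proof -
  have I: "((\<lambda>r. Re (complex_of_real ((r * (1 - r))\<^sup>2 / 4) / (z + of_real r) ^ 4)) has_integral
           Re (binet_defect z)) {0..1}"
    using has_integral_linear[OF binet_step_integral[OF assms] bounded_linear_Re]
    by (simp add: o_def binet_defect_def)
  have eq: "Re (complex_of_real c / w) = c * Re (1 / w)" for c w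
    by (simp add: Re_divide field_simps)
  show ?thesis using I unfolding eq .
qed

text \<open>A crude bound whose purpose is the convergence of the series of
  \<open>binet_step (1 + k)\<close>; the sharp lower bounds for the real part are derived separately
  below.\<close>

lemma cmod_binet_defect_le:
  assumes "Re z > 0"
  shows "cmod (binet_defect z) \<le> 1 / (4 * cmod z ^ 4)"
proof -
  let ?f = "\<lambda>r. complex_of_real ((r * (1 - r))\<^sup>2 / 4) / (z + of_real r) ^ 4"
  have "cmod (binet_defect z) \<le> 1 / (4 * cmod z ^ 4) * Henstock_Kurzweil_Integration.content {0..1::real}"
  proof (rule has_integral_bound_real[where S = "{}"])
    show "(?f has_integral binet_defect z) {0..1}"
      using binet_step_integral[OF assms] by (simp add: binet_defect_def)
    fix r :: real assume "r \<in> {0..1} - {}"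
    then have r: "r \<in> {0..1}" by simp
    have z: "cmod z > 0" using assms by auto
    have "cmod z \<le> cmod (z + of_real r)"
      using assms r by (auto simp: cmod_def intro!: power_mono)
    then have "cmod z ^ 4 \<le> cmod (z + of_real r) ^ 4" by (intro power_mono) auto
    moreover have "(r * (1 - r))\<^sup>2 \<le> 1"
      using r by (intro power_le_one mult_le_one) auto
    ultimately show "cmod (?f r) \<le> 1 / (4 * cmod z ^ 4)"
      unfolding norm_divide norm_power norm_of_real using z by (simp add: frac_le)
  qed (use assms in auto)
  then show ?thesis by simp
qed

lemma binet_step_telescope:
  assumes "Re z > 0"
  shows "(\<Sum>k<n. binet_step (z + of_nat k)) =
           1 / (12 * z) - 1 / (12 * (z + of_nat n)) - (\<Sum>k<n. binet_defect (z + of_nat k))"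
proof (induction n)
  case (Suc n)
  have "z + of_nat n \<noteq> 0" "z + of_nat n + 1 \<noteq> 0" using assms by (auto simp: complex_eq_iff)
  have pf: "1 / (12 * w * (w + 1)) = 1 / (12 * w) - 1 / (12 * (w + 1))" if "w \<noteq> 0" "w + 1 \<noteq> 0" for w :: complex
  proof -
    have "12 * w + 12 = 12 * (w + 1)" by simp
    then have "12 * w + 12 \<noteq> 0" using that(2) by (metis mult_eq_0_iff zero_neq_numeral)
    then show ?thesis using that by (simp add: divide_simps)
  qed
  have "1 / (12 * (z + of_nat n) * (z + of_nat n + 1)) = 1 / (12 * (z + of_nat n)) - 1 / (12 * (z + of_nat (Suc n)))"
    using pf[of "z + of_nat n"] \<open>z + of_nat n \<noteq> 0\<close> \<open>z + of_nat n + 1 \<noteq> 0\<close> by (simp add: add_ac)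
  then have "binet_step (z + of_nat n) =
      1 / (12 * (z + of_nat n)) - 1 / (12 * (z + of_nat (Suc n))) - binet_defect (z + of_nat n)"
    unfolding binet_defect_def by simp
  then show ?case unfolding sum.lessThan_Suc Suc.IH by simp
qed simp

lemma scaled_Gamma_shift_nat:
  assumes "Re z > 0"
  shows "scaled_Gamma z = scaled_Gamma (z + of_nat n) * exp (\<Sum>k<n. binet_step (z + of_nat k))"
proof (induction n)
  case (Suc n)
  have "scaled_Gamma (z + of_nat n) = scaled_Gamma (z + of_nat n + 1) * exp (binet_step (z + of_nat n))"
    by (rule scaled_Gamma_shift) (use assms in auto)
  then show ?case using Suc by (simp add: exp_add add_ac mult_ac)
qed simp

section \<open>Stirling's formula as a limit of the scaled gamma function\<close>

lemma tendsto_of_nat_Ln_one_plus: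
  fixes z :: complex
  assumes "z \<noteq> 0"
  shows "(\<lambda>n. of_nat n * Ln (1 + z / of_nat n)) \<longlonglongrightarrow> z"
proof -
  have "(Ln has_field_derivative inverse 1) (at 1)" by (rule has_field_derivative_Ln) auto
  then have D: "((\<lambda>h. (Ln (1 + h) - Ln 1) / h) \<longlongrightarrow> 1) (at 0)" by (simp add: DERIV_def)
  have "filterlim (\<lambda>n. z / of_nat n) (at 0) sequentially"
    unfolding filterlim_at
  proof
    show "\<forall>\<^sub>F n in sequentially. z / of_nat n \<in> UNIV \<and> z / of_nat n \<noteq> 0"
      using eventually_gt_at_top[of 0] by eventually_elim (use assms in auto)
    show "(\<lambda>n. z / of_nat n) \<longlonglongrightarrow> 0" by (rule lim_const_over_n)
  qed
  from filterlim_compose[OF D this]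
  have "(\<lambda>n. z * (Ln (1 + z / of_nat n) / (z / of_nat n))) \<longlonglongrightarrow> z * 1"
    by (intro tendsto_mult tendsto_const) simp
  then show ?thesis using assms by (simp add: mult.commute)
qed

lemma Ln_plus_of_nat:
  assumes "Re z > 0" "n > 0"
  shows "Ln (z + of_nat n) = Ln (of_nat n) + Ln (1 + z / of_nat n)"
proof -
  have "Re (1 + z / of_nat n) > 0"
    using assms by (simp add: Re_divide_of_nat add_pos_pos)
  then have nz: "1 + z / of_nat n \<noteq> 0" by (metis less_irrefl zero_complex.sel(1))
  have "z + of_nat n = of_real (real n) * (1 + z / of_nat n)" using assms by (simp add: field_simps)
  then show ?thesis using Ln_times_of_real[of "real n" "1 + z / of_nat n"] Ln_of_real[of "real n"] assms nz
    by simp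
qed

lemma tendsto_shifted_Ln_difference:
  assumes "Re z > 0"
  shows "(\<lambda>n. (w + of_nat n) * (Ln (z + of_nat n) - Ln (of_nat n))) \<longlonglongrightarrow> z"
proof -
  have nz: "z \<noteq> 0" using assms by auto
  have "(\<lambda>n. 1 + z / of_nat n) \<longlonglongrightarrow> 1 + 0"
    by (intro tendsto_intros lim_const_over_n)
  then have LL: "(\<lambda>n. Ln (1 + z / of_nat n)) \<longlonglongrightarrow> Ln (1 + 0)"
    by (rule tendsto_Ln) simp
  have lim: "(\<lambda>n. w * Ln (1 + z / of_nat n) + of_nat n * Ln (1 + z / of_nat n)) \<longlonglongrightarrow> w * Ln (1 + 0) + z"
    by (intro tendsto_add tendsto_mult tendsto_const LL tendsto_of_nat_Ln_one_plus nz)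
  have ev: "\<forall>\<^sub>F n in sequentially. w * Ln (1 + z / of_nat n) + of_nat n * Ln (1 + z / of_nat n)
      = (w + of_nat n) * (Ln (z + of_nat n) - Ln (of_nat n))"
    using eventually_gt_at_top[of 0] by eventually_elim (simp add: Ln_plus_of_nat assms algebra_simps)
  show ?thesis using Lim_transform_eventually[OF lim ev] by simp
qed

text \<open>Gauss's limit for \<open>Gamma\<close>, in the form \<open>Gamma_series'\<close>: since
  \<open>pochhammer z n = Gamma (z + n) / Gamma z\<close>, the ratio is
  \<open>Gamma z / Gamma_series' z n\<close> times an exponential whose exponent tends to
  \<open>z - z\<close> by \<open>tendsto_shifted_Ln_difference\<close>.\<close>

lemma scaled_Gamma_ratio_limit:
  assumes "Re z > 0"
  shows "(\<lambda>n. scaled_Gamma (z + of_nat n) / scaled_Gamma (of_nat n)) \<longlonglongrightarrow> 1"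
proof -
  have znp: "z \<notin> \<int>\<^sub>\<le>\<^sub>0" using assms by (auto elim!: nonpos_Ints_cases)
  then have G: "Gamma z \<noteq> 0" by (simp add: Gamma_eq_zero_iff)
  have lim: "(\<lambda>n. Gamma z / Gamma_series' z n * exp (z - (z - 1/2 + of_nat n) * (Ln (z + of_nat n) - Ln (of_nat n))))
      \<longlonglongrightarrow> Gamma z / Gamma z * exp (z - z)"
    by (intro tendsto_intros Gamma_series'_LIMSEQ tendsto_shifted_Ln_difference assms G)
  have ev: "\<forall>\<^sub>F n in sequentially. Gamma z / Gamma_series' z n * exp (z - (z - 1/2 + of_nat n) * (Ln (z + of_nat n) - Ln (of_nat n)))
      = scaled_Gamma (z + of_nat n) / scaled_Gamma (of_nat n)"
    using eventually_gt_at_top[of 0]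
  proof eventually_elim
    fix n :: nat assume n: "n > 0"
    have nz: "z + of_nat n \<noteq> 0" "of_nat n \<noteq> (0::complex)" using assms n by (auto simp: complex_eq_iff)
    have Gn: "Gamma (of_nat n :: complex) = fact (n - 1)"
      using Gamma_fact[of "n - 1", where ?'a = complex] n by (simp add: of_nat_diff)
    have poch: "pochhammer z n = Gamma (z + of_nat n) / Gamma z"
      by (rule pochhammer_Gamma[OF znp])
    have ln: "complex_of_real (ln (real n)) = Ln (of_nat n)"
      using Ln_of_real[of "real n"] n by simp
    have nz2: "Gamma (z + of_nat n) \<noteq> 0"
      using assms by (subst Gamma_eq_zero_iff) (auto elim!: nonpos_Ints_cases simp: complex_eq_iff)
    have E: "exp (z - (z - 1/2 + of_nat n) * (A - L)) * (exp ((z + of_nat n - 1/2) * A) * exp (- (z + of_nat n)))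
       = exp (z * L) * (exp ((of_nat n - 1/2) * L) * exp (- of_nat n))" for A L
      unfolding exp_add[symmetric] by (rule arg_cong[where f = exp]) (simp add: field_simps)
    have e1: "Gamma z / Gamma_series' z n = Gamma (z + of_nat n) / (fact (n - 1) * exp (z * Ln (of_nat n)))"
      using G by (simp add: Gamma_series'_def poch ln)
    have e2: "scaled_Gamma (z + of_nat n) / scaled_Gamma (of_nat n)
       = Gamma (z + of_nat n) / fact (n - 1) *
         ((exp ((of_nat n - 1/2) * Ln (of_nat n)) * exp (- of_nat n)) /
          (exp ((z + of_nat n - 1/2) * Ln (z + of_nat n)) * exp (- (z + of_nat n))))"
      using nz by (simp add: scaled_Gamma_def powr_def Gn)
    have alg: "g / (f * W) * X = g / f * (V / Y)" if "X * Y = W * V" "Y \<noteq> 0" "W \<noteq> 0" for g f W X V Y :: complex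
      using that by (cases "f = 0") (simp_all add: field_simps)
    show "Gamma z / Gamma_series' z n * exp (z - (z - 1/2 + of_nat n) * (Ln (z + of_nat n) - Ln (of_nat n)))
      = scaled_Gamma (z + of_nat n) / scaled_Gamma (of_nat n)"
      unfolding e1 e2 by (rule alg[OF E]) simp_all
  qed
  show ?thesis using Lim_transform_eventually[OF lim ev] G by simp
qed

text \<open>Stirling's formula with an unknown constant: the steps \<open>binet_step (1 + k)\<close>
  are \<open>O(1 / k^2)\<close>, so the product obtained by shifting from the base point
  \<open>1\<close> converges, and an exponential of a finite sum keeps the limit nonzero.\<close>

lemma scaled_Gamma_of_nat_convergent:
  obtains C where "C \<noteq> 0" "(\<lambda>n. scaled_Gamma (of_nat n)) \<longlonglongrightarrow> C"
proof -
  have bnd: "cmod (binet_step (1 + of_nat k)) \<le> 1 / real (Suc k) ^ 2" for k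
  proof -
    let ?z = "1 + of_nat k :: complex"
    have cm: "cmod ?z = 1 + real k" "cmod (?z + 1) = 2 + real k"
      using norm_of_nat[of "Suc k", where ?'a = complex] norm_of_nat[of "Suc (Suc k)", where ?'a = complex]
      by (simp_all add: add_ac)
    have "binet_step ?z = 1 / (12 * ?z * (?z + 1)) - binet_defect ?z" by (simp add: binet_defect_def)
    then have "cmod (binet_step ?z) \<le> cmod (1 / (12 * ?z * (?z + 1))) + cmod (binet_defect ?z)"
      by (metis norm_triangle_ineq4)
    also have "cmod (1 / (12 * ?z * (?z + 1))) = 1 / (12 * (1 + real k) * (2 + real k))"
      unfolding norm_divide norm_mult cm by simp
    also have "cmod (binet_defect ?z) \<le> 1 / (4 * (1 + real k) ^ 4)"
      using cmod_binet_defect_le[of ?z] unfolding cm by simp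
    also have "1 / (12 * (1 + real k) * (2 + real k)) + 1 / (4 * (1 + real k) ^ 4)
     \<le> 1 / (2 * (1 + real k)^2) + 1 / (2 * (1 + real k)^2)"
    proof (intro add_mono frac_le)
      show "2 * (1 + real k)^2 \<le> 12 * (1 + real k) * (2 + real k)" by (simp add: power2_eq_square algebra_simps)
      have "(1 + real k)^2 \<le> (1 + real k)^4" by (intro power_increasing) auto
      then show "2 * (1 + real k)^2 \<le> 4 * (1 + real k)^4" by (smt (verit) zero_le_power2)
    qed auto
    finally show ?thesis by (simp add: field_simps)
  qed
  have "summable (\<lambda>k. 1 / real (Suc k) ^ 2)"
    using inverse_power_summable[of 2, where ?'a = real] summable_Suc_iff[of "\<lambda>k. 1 / real k ^ 2"]
    by (simp add: field_simps)
  then have "summable (\<lambda>k. binet_step (1 + of_nat k))"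
    by (rule summable_comparison_test[rotated]) (use bnd in blast)
  then have "(\<lambda>n. \<Sum>k<n. binet_step (1 + of_nat k)) \<longlonglongrightarrow> (\<Sum>k. binet_step (1 + of_nat k))" (is "_ \<longlonglongrightarrow> ?S")
    by (rule summable_LIMSEQ)
  then have "(\<lambda>n. scaled_Gamma 1 / exp (\<Sum>k<n. binet_step (1 + of_nat k))) \<longlonglongrightarrow> scaled_Gamma 1 / exp ?S"
    by (intro tendsto_intros) auto
  moreover have "scaled_Gamma 1 / exp (\<Sum>k<n. binet_step (1 + of_nat k)) = scaled_Gamma (of_nat (Suc n))" for n
    using scaled_Gamma_shift_nat[of 1 n] by (simp add: field_simps)
  ultimately have "(\<lambda>n. scaled_Gamma (of_nat (Suc n))) \<longlonglongrightarrow> scaled_Gamma 1 / exp ?S" by simp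
  then have "(\<lambda>n. scaled_Gamma (of_nat n)) \<longlonglongrightarrow> scaled_Gamma 1 / exp ?S"
    by (rule LIMSEQ_imp_Suc)
  moreover have "scaled_Gamma 1 / exp ?S \<noteq> 0" by (simp add: scaled_Gamma_def)
  ultimately show ?thesis using that by blast
qed

text \<open>Legendre's duplication formula after dividing out the Stirling factors. It is the extra
  relation that determines the constant left open in
  \<open>scaled_Gamma_of_nat_convergent\<close>.\<close>

lemma scaled_Gamma_duplication:
  assumes "n > 0"
  shows "scaled_Gamma (of_nat n) * scaled_Gamma (1/2 + of_nat n) =
           scaled_Gamma (of_nat (2 * n)) * exp (1/2 - of_nat n * (Ln (1/2 + of_nat n) - Ln (of_nat n)))"
proof -
  define L where "L = Ln (of_nat n)"
  define A where "A = Ln (1/2 + of_nat n)"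
  define G where "G = (\<lambda>w::complex. of_real (sqrt (2 * pi)) * (exp ((w - 1/2) * Ln w) * exp (- w)))"
  have scaled: "Gamma w = scaled_Gamma w * G w" if "w \<noteq> 0" for w
    using that by (simp add: G_def scaled_Gamma_def powr_def)
  have nz: "of_nat n \<noteq> (0::complex)" "1/2 + of_nat n \<noteq> (0::complex)" "of_nat (2*n) \<noteq> (0::complex)"
    using assms by (auto simp: complex_eq_iff)
  have dup: "Gamma (of_nat n) * Gamma (of_nat n + 1/2) =
     exp ((1 - 2 * of_nat n) * of_real (ln 2)) * of_real (sqrt pi) * Gamma (2 * of_nat n :: complex)"
    by (rule Gamma_legendre_duplication) (use assms in \<open>auto elim!: nonpos_Ints_cases simp: complex_eq_iff\<close>)
  have L2: "Ln (of_nat (2*n)) = of_real (ln 2) + L"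
    using Ln_times_of_real[of 2 "of_nat n"] Ln_of_real[of 2] assms by (simp add: L_def)
  have s2: "complex_of_real (sqrt (2 * pi)) = of_real (sqrt pi) * exp (of_real (ln 2) / 2)"
  proof -
    have "sqrt 2 = exp (ln 2 / 2)" by (metis exp_ln ln_sqrt powr_half_sqrt real_sqrt_gt_0_iff zero_less_numeral zero_le_numeral)
    then have "complex_of_real (sqrt 2) = exp (of_real (ln 2) / 2)"
      by (metis exp_of_real of_real_divide of_real_numeral)
    then show ?thesis by (simp add: real_sqrt_mult mult.commute)
  qed
  have expo: "exp ((1 - 2 * N) * l) * (exp ((2 * N - 1/2) * (l + L')) * exp (- (2 * N))) =
     exp (l / 2) * exp (1/2 - N * (A' - L')) * ((exp ((N - 1/2) * L') * exp (- N)) * (exp ((1/2 + N - 1/2) * A') * exp (- (1/2 + N))))"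
    for N l L' A' :: complex
    unfolding exp_add[symmetric] by (rule arg_cong[where f = exp]) (simp add: field_simps)
  have "exp ((1 - 2 * of_nat n) * of_real (ln 2)) * of_real (sqrt pi) * G (of_nat (2*n)) =
      exp (1/2 - of_nat n * (A - L)) * (G (of_nat n) * G (1/2 + of_nat n))"
    using expo[of "of_nat n" "of_real (ln 2)" L A] unfolding G_def L2 s2 A_def[symmetric] L_def[symmetric]
    by (simp add: mult_ac)
  moreover have "scaled_Gamma (of_nat n) * scaled_Gamma (1/2 + of_nat n) * (G (of_nat n) * G (1/2 + of_nat n)) =
     scaled_Gamma (of_nat (2*n)) * (exp ((1 - 2 * of_nat n) * of_real (ln 2)) * of_real (sqrt pi) * G (of_nat (2*n)))"
    using dup scaled[OF nz(1)] scaled[OF nz(2)] scaled[OF nz(3)] by (simp add: mult_ac add_ac)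
  ultimately have "scaled_Gamma (of_nat n) * scaled_Gamma (1/2 + of_nat n) * (G (of_nat n) * G (1/2 + of_nat n)) =
     scaled_Gamma (of_nat (2*n)) * exp (1/2 - of_nat n * (A - L)) * (G (of_nat n) * G (1/2 + of_nat n))"
    by (simp add: mult_ac)
  moreover have "G (of_nat n) * G (1/2 + of_nat n) \<noteq> 0" by (simp add: G_def)
  ultimately show ?thesis by (simp add: A_def L_def)
qed

text \<open>The values at \<open>n\<close>, \<open>n + 1/2\<close> and \<open>2 * n\<close> share
  one limit \<open>C\<close>, and the exponential in the duplication formula tends to
  \<open>1\<close>; so \<open>C * C = C\<close>, where \<open>C\<close> is nonzero.\<close>

lemma scaled_Gamma_of_nat_limit: "(\<lambda>n. scaled_Gamma (of_nat n)) \<longlonglongrightarrow> 1"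
proof -
  obtain C where C: "C \<noteq> 0" "(\<lambda>n. scaled_Gamma (of_nat n)) \<longlonglongrightarrow> C"
    by (rule scaled_Gamma_of_nat_convergent)
  have half: "(\<lambda>n. scaled_Gamma (1/2 + of_nat n) / scaled_Gamma (of_nat n) * scaled_Gamma (of_nat n)) \<longlonglongrightarrow> 1 * C"
    by (intro tendsto_mult C scaled_Gamma_ratio_limit) simp
  have ev: "\<forall>\<^sub>F n in sequentially. scaled_Gamma (of_nat n) \<noteq> 0"
    using tendsto_imp_eventually_ne[OF C(2,1)] .
  have half': "(\<lambda>n. scaled_Gamma (1/2 + of_nat n)) \<longlonglongrightarrow> C"
    using Lim_transform_eventually[OF half, of "\<lambda>n. scaled_Gamma (1/2 + of_nat n)"] ev
    by (simp add: eventually_mono)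
  have "strict_mono (\<lambda>n::nat. 2 * n)" by (simp add: strict_mono_def)
  then have dbl: "(\<lambda>n. scaled_Gamma (of_nat (2 * n))) \<longlonglongrightarrow> C"
    using LIMSEQ_subseq_LIMSEQ[OF C(2)] by (simp add: o_def del: of_nat_mult)
  have "(\<lambda>n. (0 + of_nat n) * (Ln (1/2 + of_nat n) - Ln (of_nat n))) \<longlonglongrightarrow> 1/2"
    by (rule tendsto_shifted_Ln_difference) simp
  then have "(\<lambda>n. of_nat n * (Ln (1/2 + of_nat n) - Ln (of_nat n))) \<longlonglongrightarrow> 1/2" by simp
  then have lim: "(\<lambda>n. scaled_Gamma (of_nat (2 * n)) * exp (1/2 - of_nat n * (Ln (1/2 + of_nat n) - Ln (of_nat n)))) \<longlonglongrightarrow> C * exp (1/2 - 1/2)"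
    by (intro tendsto_intros dbl)
  have ev2: "\<forall>\<^sub>F n in sequentially. scaled_Gamma (of_nat (2 * n)) * exp (1/2 - of_nat n * (Ln (1/2 + of_nat n) - Ln (of_nat n)))
     = scaled_Gamma (of_nat n) * scaled_Gamma (1/2 + of_nat n)"
    using eventually_gt_at_top[of 0] by eventually_elim (simp only: scaled_Gamma_duplication)
  have "(\<lambda>n. scaled_Gamma (of_nat n) * scaled_Gamma (1/2 + of_nat n)) \<longlonglongrightarrow> C"
    using Lim_transform_eventually[OF lim ev2] by simp
  moreover have "(\<lambda>n. scaled_Gamma (of_nat n) * scaled_Gamma (1/2 + of_nat n)) \<longlonglongrightarrow> C * C"
    by (intro tendsto_mult C half')
  ultimately have "C * C = C" using LIMSEQ_unique by blast
  then show ?thesis using C by simp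
qed

lemma scaled_Gamma_plus_of_nat_limit:
  assumes "Re z > 0"
  shows "(\<lambda>n. scaled_Gamma (z + of_nat n)) \<longlonglongrightarrow> 1"
proof -
  have lim: "(\<lambda>n. scaled_Gamma (z + of_nat n) / scaled_Gamma (of_nat n) * scaled_Gamma (of_nat n)) \<longlonglongrightarrow> 1 * 1"
    by (intro tendsto_mult scaled_Gamma_of_nat_limit scaled_Gamma_ratio_limit assms)
  have "\<forall>\<^sub>F n in sequentially. scaled_Gamma (of_nat n) \<noteq> 0"
    using tendsto_imp_eventually_ne[OF scaled_Gamma_of_nat_limit] by simp
  then show ?thesis
    using Lim_transform_eventually[OF lim, of "\<lambda>n. scaled_Gamma (z + of_nat n)"] by (simp add: eventually_mono)
qed

text \<open>Shift by \<open>n\<close>, telescope, and let \<open>n\<close> grow: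
  \<open>scaled_Gamma (z + n)\<close> tends to \<open>1\<close> and \<open>1 / (12 (z + n))\<close>
  to \<open>0\<close>. An eventual lower bound for the partial sums stands in for the value of the
  defect series.\<close>

lemma cmod_scaled_Gamma_le_exp:
  assumes "Re z > 0"
    and d: "\<forall>\<^sub>F n in sequentially. d \<le> (\<Sum>k<n. Re (binet_defect (z + of_nat k)))"
  shows "cmod (scaled_Gamma z) \<le> exp (Re (1 / (12 * z)) - d)"
proof -
  have e: "cmod (scaled_Gamma z) =
      cmod (scaled_Gamma (z + of_nat n)) * exp (Re (1 / (12 * z)) - Re (1 / (12 * (z + of_nat n))) - (\<Sum>k<n. Re (binet_defect (z + of_nat k))))" for n
    unfolding scaled_Gamma_shift_nat[OF assms(1), of n] binet_step_telescope[OF assms(1)] norm_mult norm_exp_eq_Re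
    by (simp only: minus_complex.sel Re_sum)
  have inf: "filterlim (\<lambda>n. 12 * (z + of_nat n)) at_infinity sequentially"
    by (intro tendsto_mult_filterlim_at_infinity[OF tendsto_const] tendsto_add_filterlim_at_infinity[OF tendsto_const]
          tendsto_of_nat) auto
  have "(\<lambda>n. 1 / (12 * (z + of_nat n))) \<longlonglongrightarrow> 0"
    using tendsto_divide_0[OF tendsto_const inf] .
  then have "(\<lambda>n. cmod (scaled_Gamma (z + of_nat n)) * exp (Re (1 / (12 * z)) - Re (1 / (12 * (z + of_nat n))) - d))
      \<longlonglongrightarrow> cmod 1 * exp (Re (1 / (12 * z)) - Re 0 - d)"
    by (intro tendsto_intros scaled_Gamma_plus_of_nat_limit assms)
  moreover have "\<forall>\<^sub>F n in sequentially. cmod (scaled_Gamma z) \<le>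
      cmod (scaled_Gamma (z + of_nat n)) * exp (Re (1 / (12 * z)) - Re (1 / (12 * (z + of_nat n))) - d)"
    using d
  proof eventually_elim
    case (elim n)
    then show ?case by (subst e[of n]) (intro mult_left_mono; simp)
  qed
  ultimately show ?thesis
    by (intro tendsto_lowerbound[where F = sequentially]) auto
qed

section \<open>Lower bounds for the defect of Gudermann's series\<close>

lemma Re_inverse_power4:
  "Re (1 / w ^ 4) = (Re w ^ 4 - 6 * (Re w)\<^sup>2 * (Im w)\<^sup>2 + Im w ^ 4) / ((Re w)\<^sup>2 + (Im w)\<^sup>2) ^ 4"
proof -
  have p: "w ^ 4 = Complex (Re w ^ 4 - 6 * (Re w)\<^sup>2 * (Im w)\<^sup>2 + Im w ^ 4) (4 * Re w ^ 3 * Im w - 4 * Re w * Im w ^ 3)"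
    by (simp add: complex_eq_iff eval_nat_numeral algebra_simps)
  have n: "(Re (w ^ 4))\<^sup>2 + (Im (w ^ 4))\<^sup>2 = ((Re w)\<^sup>2 + (Im w)\<^sup>2) ^ 4"
    unfolding p by (simp add: eval_nat_numeral algebra_simps)
  have "Re (1 / w ^ 4) = Re (w ^ 4) / ((Re (w ^ 4))\<^sup>2 + (Im (w ^ 4))\<^sup>2)" by (simp add: Re_divide)
  then show ?thesis unfolding n unfolding p by simp
qed

text \<open>With \<open>X = (Re w)^2\<close> and \<open>Y = (Im w)^2\<close> the numerator
  \<open>X^2 - 6 X Y + Y^2\<close> has the factors \<open>X - (3 + 2 sqrt 2) Y\<close> and
  \<open>X - (3 - 2 sqrt 2) Y\<close>, and \<open>3 + 2 sqrt 2 = (1 + sqrt 2)^2\<close>.\<close>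

lemma Re_inverse_power4_nonneg:
  assumes "Re w \<ge> (1 + sqrt 2) * \<bar>Im w\<bar>"
  shows "Re (1 / w ^ 4) \<ge> 0"
proof -
  define X Y where "X = (Re w)\<^sup>2" and "Y = (Im w)\<^sup>2"
  have "((1 + sqrt 2) * \<bar>Im w\<bar>)\<^sup>2 \<le> (Re w)\<^sup>2"
    using assms by (intro power_mono) auto
  moreover have "((1 + sqrt 2) * \<bar>Im w\<bar>)\<^sup>2 = (3 + 2 * sqrt 2) * Y"
    by (simp add: Y_def power_mult_distrib power2_sum)
  ultimately have 1: "(3 + 2 * sqrt 2) * Y \<le> X" by (simp add: X_def)
  have Y0: "Y \<ge> 0" by (simp add: Y_def)
  have "X - (3 - 2 * sqrt 2) * Y \<ge> 0"
    using 1 mult_right_mono[of "3 - 2 * sqrt 2" "3 + 2 * sqrt 2" Y] Y0 by simp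
  then have "0 \<le> (X - (3 + 2 * sqrt 2) * Y) * (X - (3 - 2 * sqrt 2) * Y)"
    using 1 by (intro mult_nonneg_nonneg) auto
  also have "\<dots> = X\<^sup>2 - 6 * X * Y + Y\<^sup>2"
    using real_sqrt_pow2[of 2] by (simp add: power2_eq_square algebra_simps)
  finally have "0 \<le> Re w ^ 4 - 6 * (Re w)\<^sup>2 * (Im w)\<^sup>2 + Im w ^ 4"
    by (simp add: X_def Y_def)
  then show ?thesis unfolding Re_inverse_power4 by simp
qed

text \<open>The constant \<open>1 + sqrt 2\<close> is \<open>cot (pi / 8)\<close>, that is, \<open>Re (1 / w^4)\<close> changes sign at
  \<open>\<bar>Arg w\<bar> = pi / 8\<close>.\<close>

lemma Re_inverse_power4_nonpos:
  assumes "\<bar>Im w\<bar> \<le> Re w" "Re w \<le> (1 + sqrt 2) * \<bar>Im w\<bar>"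
  shows "Re (1 / w ^ 4) \<le> 0"
proof -
  define X Y where "X = (Re w)\<^sup>2" and "Y = (Im w)\<^sup>2"
  have "(Re w)\<^sup>2 \<le> ((1 + sqrt 2) * \<bar>Im w\<bar>)\<^sup>2"
    using assms by (intro power_mono) auto
  moreover have "((1 + sqrt 2) * \<bar>Im w\<bar>)\<^sup>2 = (3 + 2 * sqrt 2) * Y"
    by (simp add: Y_def power_mult_distrib power2_sum)
  ultimately have 1: "X \<le> (3 + 2 * sqrt 2) * Y" by (simp add: X_def)
  have "(\<bar>Im w\<bar>)\<^sup>2 \<le> (Re w)\<^sup>2" using assms by (intro power_mono) auto
  then have 2: "Y \<le> X" by (simp add: X_def Y_def)
  have Y0: "Y \<ge> 0" by (simp add: Y_def)
  have s: "sqrt 2 \<ge> 1" by simp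
  have "(3 - 2 * sqrt 2) * Y \<le> 1 * Y" using s Y0 by (intro mult_right_mono) auto
  then have "0 \<ge> (X - (3 + 2 * sqrt 2) * Y) * (X - (3 - 2 * sqrt 2) * Y)"
    using 1 2 by (intro mult_nonpos_nonneg) auto
  also have "(X - (3 + 2 * sqrt 2) * Y) * (X - (3 - 2 * sqrt 2) * Y) = X\<^sup>2 - 6 * X * Y + Y\<^sup>2"
    using real_sqrt_pow2[of 2] by (simp add: power2_eq_square algebra_simps)
  finally have "Re w ^ 4 - 6 * (Re w)\<^sup>2 * (Im w)\<^sup>2 + Im w ^ 4 \<le> 0"
    by (simp add: X_def Y_def)
  then show ?thesis unfolding Re_inverse_power4 by (simp add: divide_nonpos_nonneg)
qed

text \<open>The constant comes from
  \<open>2 (X^2 - 6 X Y + Y^2) - (X + Y)^2 = X^2 - 14 X Y + Y^2\<close>, which is nonnegative once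
  \<open>14 Y <= X\<close>. This fixes the narrow cone used from here on.\<close>

lemma Re_inverse_power4_ge:
  assumes "14 * (Im w)\<^sup>2 \<le> (Re w)\<^sup>2" "Re w > 0"
  shows "Re (1 / w ^ 4) \<ge> 1 / (2 * cmod w ^ 4)"
proof -
  define X Y where "X = (Re w)\<^sup>2" and "Y = (Im w)\<^sup>2"
  have XY: "14 * Y \<le> X" "Y \<ge> 0" "X > 0" using assms by (auto simp: X_def Y_def)
  have "0 \<le> X * (X - 14 * Y) + Y\<^sup>2" using XY by (intro add_nonneg_nonneg mult_nonneg_nonneg) auto
  then have h: "(X + Y)\<^sup>2 \<le> 2 * (X\<^sup>2 - 6 * X * Y + Y\<^sup>2)" by (simp add: power2_eq_square algebra_simps)
  have c: "cmod w ^ 4 = (X + Y)\<^sup>2"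
    by (metis X_def Y_def cmod_power2 mult_2 numeral_Bit0 power_add power_mult power2_eq_square)
  have "1 / (2 * S\<^sup>2) = S\<^sup>2 / (2 * S^4)" if "S > 0" for S :: real
    using that by (simp add: field_simps eval_nat_numeral)
  then have "1 / (2 * (X + Y)\<^sup>2) = (X + Y)\<^sup>2 / (2 * (X + Y)^4)" using XY by simp
  also have "\<dots> \<le> (2 * (X\<^sup>2 - 6 * X * Y + Y\<^sup>2)) / (2 * (X + Y)^4)"
    using h XY by (intro divide_right_mono) auto
  also have "\<dots> = (X\<^sup>2 - 6 * X * Y + Y\<^sup>2) / (X + Y)^4"
    by (rule mult_divide_mult_cancel_left) simp
  also have "\<dots> = Re (1 / w ^ 4)" unfolding Re_inverse_power4 by (simp add: X_def Y_def)
  finally show ?thesis unfolding c .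
qed

text \<open>The integral of \<open>(r (1 - r))^2\<close> is \<open>1/30\<close>, and the linear term
  is odd about the midpoint \<open>1/2\<close>, so it contributes nothing.\<close>

lemma has_integral_binet_weight:
  "((\<lambda>r::real. (r * (1 - r))\<^sup>2 / 8 * (p - 4 * q * (r - 1/2))) has_integral p / 240) {0..1}"
proof -
  define F where "F = (\<lambda>r::real. p * (1/24 * r^3 - 1/16 * r^4 + 1/40 * r^5) + q * (1/12 * (r - r^2)^3))"
  have "((\<lambda>r::real. (r * (1 - r))\<^sup>2 / 8 * (p - 4 * q * (r - 1/2))) has_integral (F 1 - F 0)) {0..1}"
  proof (rule fundamental_theorem_of_calculus)
    fix x :: real
    show "(F has_vector_derivative ((x * (1 - x))\<^sup>2 / 8 * (p - 4 * q * (x - 1/2)))) (at x within {0..1})"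
      unfolding has_real_derivative_iff_has_vector_derivative[symmetric] F_def
      by (rule derivative_eq_intros refl)+ (simp add: field_simps eval_nat_numeral)
  qed simp
  then show ?thesis by (simp add: F_def)
qed

text \<open>Convexity: the left side is the tangent of \<open>y^(-4)\<close> at \<open>m\<close>.
  After clearing denominators the difference has the factor \<open>(m - y)^2\<close>.\<close>

lemma inverse_power4_tangent:
  fixes y m :: real
  assumes "y > 0" "m > 0"
  shows "1 / m^4 - 4 * (1 / m^5) * (y - m) \<le> 1 / y^4"
proof -
  have "5 * m ^ 4 * y \<le> m^5 + 4 * m^5 + (m ^ 4 * y * 5 - 5 * m ^ 5)" by simp
  have "(5 * m - 4 * y) * y^4 \<le> m^5"
  proof -
    have "m^5 - (5 * m - 4 * y) * y^4 = (m - y)\<^sup>2 * (m^3 + 2 * m^2 * y + 3 * m * y^2 + 4 * y^3)"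
      by (simp add: eval_nat_numeral algebra_simps)
    also have "\<dots> \<ge> 0" using assms by (intro mult_nonneg_nonneg add_nonneg_nonneg) auto
    finally show ?thesis by simp
  qed
  then show ?thesis using assms by (simp add: field_simps eval_nat_numeral)
qed

text \<open>A form of Jensen's inequality. In the cone \<open>Re (1 / w^4) >= 1 / (2 |w|^4)\<close>
  with \<open>|w| <= |z| + k + r\<close>; replacing the fourth power by its tangent at
  \<open>r = 1/2\<close> lets \<open>has_integral_binet_weight\<close> evaluate the integral. The
  cone is preserved by adding nonnegative reals.\<close>

lemma Re_binet_defect_ge:
  assumes z: "Re z > 0" "14 * (Im z)\<^sup>2 \<le> (Re z)\<^sup>2"
  shows "Re (binet_defect (z + of_nat k)) \<ge> 1 / (240 * (cmod z + real k + 1/2) ^ 4)"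
proof -
  define m where "m = cmod z + real k + 1/2"
  have z0: "cmod z > 0" using z by auto
  have m: "m > 0" using z by (simp add: m_def add_nonneg_pos)
  have "1 / m^4 / 240 \<le> Re (binet_defect (z + of_nat k))"
  proof (rule has_integral_le[OF has_integral_binet_weight[of "1 / m^4" "1 / m^5"] Re_binet_defect_integral])
    fix r :: real assume r: "r \<in> {0..1}"
    let ?w = "z + of_nat k + of_real r"
    have pw: "(Re z)\<^sup>2 \<le> (Re ?w)\<^sup>2" using z r by (intro power_mono) auto
    have im: "Im ?w = Im z" by simp
    have "14 * (Im ?w)\<^sup>2 \<le> (Re ?w)\<^sup>2" unfolding im using z(2) pw by (rule order_trans)
    then have "1 / (2 * cmod ?w ^ 4) \<le> Re (1 / ?w ^ 4)"
      using z r by (intro Re_inverse_power4_ge) auto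
    moreover have "cmod ?w \<le> cmod z + real k + r"
      using r norm_triangle_ineq[of "z + of_nat k" "of_real r"] norm_triangle_ineq[of z "of_nat k"] by simp
    then have "cmod ?w ^ 4 \<le> (cmod z + real k + r) ^ 4" by (intro power_mono) auto
    moreover have "cmod ?w > 0" using z r by (auto simp: complex_eq_iff)
    ultimately have "1 / (2 * (cmod z + real k + r) ^ 4) \<le> Re (1 / ?w ^ 4)"
      by (smt (verit) frac_le zero_less_power)
    moreover have "1 / m^4 - 4 * (1 / m^5) * ((cmod z + real k + r) - m) \<le> 1 / (cmod z + real k + r)^4"
      using z0 r m by (intro inverse_power4_tangent) (auto intro!: add_pos_nonneg)
    ultimately have "(1 / m^4 - 4 * (1 / m^5) * (r - 1/2)) / 2 \<le> Re (1 / ?w ^ 4)"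
      by (simp add: m_def)
    then have "(r * (1 - r))\<^sup>2 / 4 * ((1 / m^4 - 4 * (1 / m^5) * (r - 1/2)) / 2) \<le> (r * (1 - r))\<^sup>2 / 4 * Re (1 / ?w ^ 4)"
      by (intro mult_left_mono) auto
    then show "(r * (1 - r))\<^sup>2 / 8 * (1 / m^4 - 4 * (1 / m^5) * (r - 1/2)) \<le> (r * (1 - r))\<^sup>2 / 4 * Re (1 / ?w ^ 4)"
      by simp
  qed (use z in auto)
  then show ?thesis by (simp add: m_def)
qed

lemma Re_binet_defect_nonneg:
  assumes "Re z > 0" "Re z \<ge> (1 + sqrt 2) * \<bar>Im z\<bar>"
  shows "Re (binet_defect z) \<ge> 0"
proof -
  have "0 \<le> (r * (1 - r))\<^sup>2 / 4 * Re (1 / (z + of_real r) ^ 4)" if "r \<in> {0..1}" for r :: real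
    using that assms by (intro mult_nonneg_nonneg Re_inverse_power4_nonneg) auto
  then show ?thesis using has_integral_nonneg[OF Re_binet_defect_integral[OF assms(1)]] by blast
qed

text \<open>Comparison with the integral of \<open>x^(-4)\<close> in discrete form; each step is
  \<open>1 / y^3 - 1 / (y + 1)^3 <= 3 / y^4\<close>.\<close>

lemma inverse_power4_sum_ge:
  fixes c :: real
  assumes "c > 0"
  shows "(1 / c^3 - 1 / (c + real n)^3) / 3 \<le> (\<Sum>k<n. 1 / (c + real k)^4)"
proof (induction n)
  case (Suc n)
  define y where "y = c + real n"
  have y: "y > 0" using assms by (simp add: y_def add_pos_nonneg)
  have "1 / y^3 - 1 / (y + 1)^3 \<le> 3 / y^4"
  proof -
    have e: "1 / y^3 - 1 / (y + 1)^3 = ((y+1)^3 - y^3) / (y^3 * (y+1)^3)" using y by (simp add: field_simps)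
    have "((y+1)^3 - y^3) * y \<le> 3 * (y + 1)^3"
      using y by (simp add: eval_nat_numeral algebra_simps)
    then have "((y+1)^3 - y^3) * y^4 \<le> 3 * (y^3 * (y + 1)^3)"
      using mult_left_mono[of "((y+1)^3 - y^3) * y" "3 * (y + 1)^3" "y^3"] y by (simp add: eval_nat_numeral mult_ac)
    then show ?thesis unfolding e using y by (simp add: divide_le_eq pos_le_divide_eq)
  qed
  then show ?case using Suc by (simp add: y_def add_ac)
qed simp

text \<open>The target is \<open>x^3 / 6\<close> with \<open>x = 1 / (12 |z|)\<close>: this is the
  amount by which \<open>exp_tail_le_quadratic\<close> requires the exponent \<open>x\<close> to be
  lowered.\<close>

lemma binet_defect_sum_ge:
  assumes z: "Re z > 0" "14 * (Im z)\<^sup>2 \<le> (Re z)\<^sup>2" and t: "cmod z \<ge> 185/1000"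
  shows "\<forall>\<^sub>F n in sequentially. (1 / (12 * cmod z))^3 / 6 \<le> (\<Sum>k<n. Re (binet_defect (z + of_nat k)))"
proof -
  define t where "t = cmod z"
  have t0: "t \<ge> 185/1000" "t > 0" using t by (auto simp: t_def)
  have le: "(\<Sum>k<n. 1 / (t + 1/2 + real k) ^ 4) / 240 \<le> (\<Sum>k<n. Re (binet_defect (z + of_nat k)))" for n
  proof -
    have "(\<Sum>k<n. 1 / (t + 1/2 + real k) ^ 4) / 240 = (\<Sum>k<n. 1 / (240 * (cmod z + real k + 1/2) ^ 4))"
      by (simp add: sum_divide_distrib t_def add_ac mult_ac)
    then show ?thesis using Re_binet_defect_ge[OF z] by (simp add: sum_mono)
  qed
  have goal: "(1 / (12 * t))^3 / 6 \<le> (\<Sum>k<n. 1 / (t + 1/2 + real k) ^ 4) / 240" if n: "real n \<ge> t + 1/2" for n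
  \<comment> \<open>For \<open>t <= 1\<close> the single term \<open>k = 0\<close> suffices; the
    constant in the resulting inequality is \<open>6 * 12^3 / 240 = 216/5\<close>. For larger
    \<open>t\<close> the telescoped sum is used, where \<open>t + 1/2 <= 3/2 * t\<close>.\<close>
  proof (cases "t \<le> 1")
    case True
    have "n > 0" using n t0 by (cases n) auto
    have "1 / (t + 1/2)^4 = (\<Sum>k\<in>{0::nat}. 1 / (t + 1/2 + real k) ^ 4)" by simp
    also have "\<dots> \<le> (\<Sum>k<n. 1 / (t + 1/2 + real k) ^ 4)"
      using \<open>n > 0\<close> t0 by (intro sum_mono2) auto
    finally have "1 / (t + 1/2)^4 / 240 \<le> (\<Sum>k<n. 1 / (t + 1/2 + real k) ^ 4) / 240" by simp
    moreover have "(1 / (12 * t))^3 / 6 \<le> 1 / (t + 1/2)^4 / 240"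
    proof -
      have a: "185 \<le> 1000 * t" using t0 by simp
      have t3: "t * t^3 \<le> 1 * t^3" using True t0 by (intro mult_right_mono) auto
      have p2: "185 * t^2 \<le> 1000 * t * t^2" using a t0 by (intro mult_right_mono) auto
      have p1: "185 * t \<le> 1000 * t * t" using a t0 by (intro mult_right_mono) auto
      have "(t + 1/2)^4 \<le> 216/5 * t^3"
      proof -
        have "(t + 1/2)^4 = t * t^3 + 2 * t^3 + 3/2 * t^2 + t / 2 + 1/16" by (simp add: eval_nat_numeral field_simps)
        moreover have "1000 * t * t^2 = 1000 * t^3" "1000 * t * t = 1000 * t^2" by (simp_all add: eval_nat_numeral)
        moreover have "0 \<le> t^3" using t0 by simp
        ultimately show ?thesis using t3 p2 p1 a by linarith
      qed
      then show ?thesis using t0 by (simp add: field_simps)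
    qed
    ultimately show ?thesis by linarith
  next
    case False
    define c where "c = t + 1/2"
    have c: "c > 0" "c \<le> 3/2 * t" using False by (auto simp: c_def)
    \<comment> \<open>Since \<open>n >= c\<close>, the subtracted end term is at most one eighth of
      the leading one, which leaves \<open>(1 - 1/8) / 3 = 7/24\<close>.\<close>
    have "(2 * c)^3 \<le> (c + real n)^3" using n c by (intro power_mono) (auto simp: c_def)
    then have "1 / (c + real n)^3 \<le> 1 / (8 * c^3)" using c by (intro frac_le) (auto simp: power_mult_distrib)
    then have "(1 / c^3 - 1 / (8 * c^3)) / 3 \<le> (1 / c^3 - 1 / (c + real n)^3) / 3"
      by (intro divide_right_mono diff_left_mono) auto
    also note inverse_power4_sum_ge[OF c(1), of n]
    finally have "(1 / c^3 - 1 / (8 * c^3)) / 3 \<le> (\<Sum>k<n. 1 / (c + real k)^4)" .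
    then have "7 / 24 / c^3 \<le> (\<Sum>k<n. 1 / (c + real k)^4)" by simp
    moreover have "7 / 24 / (27 / 8 * t^3) \<le> 7 / 24 / c^3"
    proof (intro divide_left_mono)
      have "c^3 \<le> (3/2 * t)^3" using c by (intro power_mono) auto
      then show "c^3 \<le> 27 / 8 * t^3" by (simp add: power_mult_distrib power_divide)
    qed (use c t0 in auto)
    moreover have "(1 / (12 * t))^3 / 6 \<le> 7 / 24 / (27 / 8 * t^3) / 240"
      using t0 by (simp add: field_simps)
    ultimately show ?thesis by (simp add: c_def)
  qed
  have "\<forall>\<^sub>F n in sequentially. real n \<ge> t + 1/2"
    by (rule eventually_compose_filterlim[OF eventually_ge_at_top filterlim_real_sequentially])
  then show ?thesis
    unfolding t_def[symmetric] by eventually_elim (use goal le in \<open>blast intro: order_trans\<close>)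
qed

lemma Re_complex_of_real_mult: "Re (complex_of_real c * w) = c * Re w"
  by simp

text \<open>For \<open>\<bar>Arg z\<bar> > pi / 8\<close> the integrand \<open>Re (1 / (z + r)^4)\<close> is negative exactly for \<open>r < r0\<close>; there the
  weight \<open>(r (1 - r))\<^sup>2\<close> is estimated by \<open>(k + r)\<^sup>2\<close>, for which an explicit antiderivative \<open>F\<close> exists.\<close>

lemma binet_defect_ge_increment:
  fixes z :: complex and k :: nat
  assumes z: "Re z > 0" "\<bar>Im z\<bar> \<le> Re z" "Re z \<le> (1 + sqrt 2) * \<bar>Im z\<bar>"
  defines "r0 \<equiv> (1 + sqrt 2) * \<bar>Im z\<bar> - Re z"
  defines "F \<equiv> \<lambda>r. Re ((of_real r / (of_real r + z)) ^ 3 / (12 * z))"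
  shows "F (min (real k + 1) r0) - F (min (real k) r0) \<le> Re (binet_defect (z + of_nat k))"
proof -
  \<comment> \<open>Clamping the argument at \<open>r0\<close> makes \<open>G\<close> constant after
    the sign change, so that \<open>g\<close> is zero there and only the negative part of the
    integrand is integrated.\<close>
  define G where "G = (\<lambda>r. F (min (real k + r) r0))"
  define g where "g = (\<lambda>r. if real k + r < r0 then (real k + r)\<^sup>2 / 4 * Re (1 / (z + of_nat k + of_real r) ^ 4) else 0)"
  have z0: "z \<noteq> 0" using z by auto
  have r0: "r0 \<ge> 0" using z by (simp add: r0_def)
  have nz: "of_real r + z \<noteq> 0" if "r \<ge> 0" for r using z that by (auto simp: complex_eq_iff)
  have dF: "(F has_vector_derivative (r\<^sup>2 / 4 * Re (1 / (z + of_real r) ^ 4))) (at r)" if "r \<ge> 0" for r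
  proof -
    define w where "w = of_real r + z"
    have r: "of_real r = w - z" by (simp add: w_def)
    have w0: "w \<noteq> 0" using nz[OF that] by (simp add: w_def)
    \<comment> \<open>The inner function \<open>(w - z) / w\<close> has derivative
      \<open>z / w^2\<close>; its cube, divided by \<open>12 z\<close>, therefore has derivative
      \<open>(w - z)^2 / (4 w^4)\<close>.\<close>
    have "((\<lambda>w. ((w - z) * inverse w) ^ 3 * (inverse z / 12)) has_field_derivative ((w - z)\<^sup>2 / 4 * (1 / w ^ 4))) (at w)"
      apply (rule derivative_eq_intros refl w0)+
      using w0 z0 apply (simp add: field_simps)
      apply (simp add: eval_nat_numeral algebra_simps)
      done
    then have d1: "((\<lambda>w. ((w - z) * inverse w) ^ 3 * (inverse z / 12)) has_field_derivative ((w - z)\<^sup>2 / 4 * (1 / w ^ 4)))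
        (at (of_real r + z) within (\<lambda>r. of_real r + z) ` UNIV)"
      unfolding w_def by (rule has_field_derivative_at_within)
    have d2: "((\<lambda>r. of_real r + z) has_vector_derivative 1) (at r within UNIV)"
      by (auto intro!: derivative_eq_intros)
    have "((\<lambda>r. ((of_real r + z - z) * inverse (of_real r + z)) ^ 3 * (inverse z / 12)) has_vector_derivative
        ((w - z)\<^sup>2 / 4 * (1 / w ^ 4))) (at r)"
      using field_vector_diff_chain_within[OF d2 d1] by (simp only: o_def mult_1)
    from bounded_linear.has_vector_derivative[OF bounded_linear_Re this]
    have "((\<lambda>r. Re (((of_real r + z - z) * inverse (of_real r + z)) ^ 3 * (inverse z / 12))) has_vector_derivative
        Re ((of_real r)\<^sup>2 / 4 * (1 / (z + of_real r) ^ 4))) (at r)"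
      unfolding r[symmetric] by (simp only: w_def add.commute)
    moreover have "Re (((of_real r + z - z) * inverse (of_real r + z)) ^ 3 * (inverse z / 12)) = F r" for r
    proof -
      have "x ^ 3 * (inverse z / 12) = x ^ 3 / (12 * z)" for x
        using z0 by (simp add: field_simps)
      then show ?thesis unfolding F_def divide_inverse[of "of_real r" "of_real r + z"] by (simp add: mult.commute)
    qed
    moreover have "Re ((complex_of_real r)\<^sup>2 / 4 * (1 / (z + of_real r) ^ 4)) = r\<^sup>2 / 4 * Re (1 / (z + of_real r) ^ 4)"
      using Re_complex_of_real_mult[of "r\<^sup>2 / 4" "1 / (z + of_real r) ^ 4"]
      by (simp only: of_real_power of_real_divide of_real_numeral)
    ultimately show ?thesis by (simp only:)
  qed
  have "(g has_integral (G 1 - G 0)) {0..1}"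
  \<comment> \<open>The kink of the clamped function at \<open>r0 - k\<close> is the exceptional
    point.\<close>
  proof (rule fundamental_theorem_of_calculus_interior_strong[where S = "{r0 - real k}"])
    fix r :: real assume r: "r \<in> {0<..<1} - {r0 - real k}"
    show "(G has_vector_derivative g r) (at r)"
    proof (cases "real k + r < r0")
      case True
      have "((F \<circ> (\<lambda>r. real k + r)) has_vector_derivative (1 *\<^sub>R ((real k + r)\<^sup>2 / 4 * Re (1 / (z + of_real (real k + r)) ^ 4)))) (at r)"
      proof (rule vector_diff_chain_at)
        show "((+) (real k) has_vector_derivative 1) (at r)" by (auto intro!: derivative_eq_intros)
        show "(F has_vector_derivative ((real k + r)\<^sup>2 / 4 * Re (1 / (z + of_real (real k + r)) ^ 4))) (at (real k + r))"
          by (rule dF) (use r in auto)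
      qed
      then have "((\<lambda>r. F (real k + r)) has_vector_derivative g r) (at r)"
        using True by (simp add: g_def o_def add.assoc)
      then show ?thesis
      proof (rule has_vector_derivative_transform_within_open)
        show "open {..<r0 - real k}" by simp
        show "F (real k + x) = G x" if "x \<in> {..<r0 - real k}" for x
          using that by (simp add: G_def min_def)
      qed (use True in auto)
    next
      case False
      have "((\<lambda>r. F r0) has_vector_derivative 0) (at r)" by simp
      then have "(G has_vector_derivative 0) (at r)"
      proof (rule has_vector_derivative_transform_within_open)
        show "open {r0 - real k<..}" by simp
        show "F r0 = G x" if "x \<in> {r0 - real k<..}" for x
          using that by (simp add: G_def min_def)
      qed (use False r in auto)
      then show ?thesis using False by (simp add: g_def)
    qed
  next
    have "continuous_on {0..} F"
      by (intro continuous_at_imp_continuous_on ballI has_vector_derivative_continuous[OF dF]) auto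
    then show "continuous_on {0..1} G"
      unfolding G_def by (rule continuous_on_compose2) (use r0 in \<open>auto intro!: continuous_intros\<close>)
  qed auto
  moreover have "((\<lambda>r. (r * (1 - r))\<^sup>2 / 4 * Re (1 / (z + of_nat k + of_real r) ^ 4)) has_integral
      Re (binet_defect (z + of_nat k))) {0..1}"
    by (rule Re_binet_defect_integral) (use z in auto)
  ultimately have "G 1 - G 0 \<le> Re (binet_defect (z + of_nat k))"
  proof (rule has_integral_le)
    fix r :: real assume r: "r \<in> {0..1}"
    let ?w = "z + of_nat k + of_real r"
    show "g r \<le> (r * (1 - r))\<^sup>2 / 4 * Re (1 / ?w ^ 4)"
    proof (cases "real k + r < r0")
      case True
      have "Re (1 / ?w ^ 4) \<le> 0"
        by (rule Re_inverse_power4_nonpos) (use True r z in \<open>auto simp: r0_def\<close>)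
      moreover have "(r * (1 - r))\<^sup>2 \<le> (real k + r)\<^sup>2"
      proof (rule power_mono)
        show "r * (1 - r) \<le> real k + r" using mult_left_mono[of "1 - r" 1 r] r by simp
      qed (use r in auto)
      ultimately have "(real k + r)\<^sup>2 * Re (1 / ?w ^ 4) \<le> (r * (1 - r))\<^sup>2 * Re (1 / ?w ^ 4)"
        by (intro mult_right_mono_neg) auto
      then show ?thesis using True by (simp add: g_def)
    next
      case False
      have "Re (1 / ?w ^ 4) \<ge> 0"
        by (rule Re_inverse_power4_nonneg) (use False r z in \<open>auto simp: r0_def\<close>)
      then show ?thesis using False by (simp add: g_def)
    qed
  qed
  then show ?thesis by (simp add: G_def add.commute)
qed

text \<open>The increments of \<open>F\<close> telescope to \<open>F r0\<close>. In the coordinates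
  \<open>y = |Im z|\<close> and \<open>m = Re z / y\<close>, with \<open>m\<close> between
  \<open>1\<close> and \<open>c = 1 + sqrt 2\<close>, the exponent has the closed form
  \<open>(m + (c - m)^4 / A^2) / (12 y (1 + m^2))\<close>, and
  \<open>|z| = y sqrt (1 + m^2)\<close>.\<close>

lemma cmod_scaled_Gamma_le_exp_intermediate:
  assumes z: "Re z > 0" "\<bar>Im z\<bar> \<le> Re z" "Re z \<le> (1 + sqrt 2) * \<bar>Im z\<bar>"
  shows "cmod (scaled_Gamma z) \<le> exp (9661/10000 / (12 * cmod z))"
proof -
  define r0 where "r0 = (1 + sqrt 2) * \<bar>Im z\<bar> - Re z"
  define F where "F = (\<lambda>r. Re ((of_real r / (of_real r + z)) ^ 3 / (12 * z)))"
  have r0: "r0 \<ge> 0" using z by (simp add: r0_def)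
  have sum: "F (min (real n) r0) \<le> (\<Sum>k<n. Re (binet_defect (z + of_nat k)))" for n
  proof (induction n)
    case 0
    then show ?case using r0 by (simp add: F_def)
  next
    case (Suc n)
    have "F (min (real n + 1) r0) - F (min (real n) r0) \<le> Re (binet_defect (z + of_nat n))"
      unfolding F_def r0_def by (rule binet_defect_ge_increment[OF z])
    then show ?case using Suc by (simp add: add.commute)
  qed
  have "\<forall>\<^sub>F n in sequentially. real n \<ge> r0"
    by (rule eventually_compose_filterlim[OF eventually_ge_at_top filterlim_real_sequentially])
  then have "\<forall>\<^sub>F n in sequentially. F r0 \<le> (\<Sum>k<n. Re (binet_defect (z + of_nat k)))"
    by eventually_elim (metis sum min.absorb2)
  then have le: "cmod (scaled_Gamma z) \<le> exp (Re (1 / (12 * z)) - F r0)"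
    by (rule cmod_scaled_Gamma_le_exp[OF z(1)])
  define y where "y = \<bar>Im z\<bar>"
  define m where "m = Re z / y"
  define e where "e = sgn (Im z)"
  define c where "c = 1 + sqrt 2"
  have y: "y > 0" using z by (auto simp: y_def intro: ccontr)
  have e: "e * e = 1" using y by (auto simp: e_def y_def sgn_if)
  have zf: "z = of_real y * (of_real m + \<i> * of_real e)"
  proof -
    have "y * m = Re z" using y by (simp add: m_def)
    moreover have "y * e = Im z" by (simp add: e_def y_def sgn_if)
    ultimately show ?thesis by (simp add: complex_eq_iff)
  qed
  have m: "1 \<le> m" "m \<le> c" using z y by (auto simp: m_def y_def c_def field_simps)
  have r0f: "r0 = y * (c - m)" using y by (simp add: r0_def c_def y_def m_def algebra_simps)
  have c2: "c * c = 2 * c + 1" by (simp add: c_def algebra_simps)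
  define A where "A = 4 + 2 * sqrt 2"
  have Ac: "A = 2 * c + 2" by (simp add: A_def c_def)
  have A0: "A > 0" by (simp add: A_def add_pos_nonneg)
  \<comment> \<open>\<open>u\<close> has argument \<open>+-pi / 8\<close> because
    \<open>c = cot (pi / 8)\<close>; its cube has argument \<open>+-3 pi / 8\<close>, whose tangent
    is again \<open>+-c\<close>. Moreover \<open>|u|^2 = 1 + c^2 = A\<close>.\<close>
  define u where "u = complex_of_real c + \<i> * of_real e"
  have u3: "u ^ 3 = of_real A * (1 + \<i> * of_real (c * e))"
  proof -
    have c3: "c * (c * c) = 5 * c + 2" unfolding c2 using c2 by (simp add: algebra_simps)
    have e3: "e * (e * e) = e" using e by simp
    have "Re (u ^ 3) = c * (c * c) - 3 * c * (e * e)" by (simp add: u_def power3_eq_cube algebra_simps)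
    also have "\<dots> = A" unfolding c3 e Ac by simp
    finally have R: "Re (u ^ 3) = A" .
    have "Im (u ^ 3) = 3 * (c * c) * e - e * (e * e)" by (simp add: u_def power3_eq_cube algebra_simps)
    also have "\<dots> = (6 * c + 2) * e" unfolding c2 e3 by (simp add: algebra_simps)
    also have "\<dots> = (2 * (c * c) + 2 * c) * e" unfolding c2 by (simp add: algebra_simps)
    also have "\<dots> = A * (c * e)" unfolding Ac by (simp add: algebra_simps)
    finally show ?thesis using R by (simp add: complex_eq_iff)
  qed
  have u0: "u \<noteq> 0" using e by (auto simp: u_def complex_eq_iff)
  have wz: "of_real r0 + z = of_real y * u" unfolding r0f zf u_def by (simp add: algebra_simps)
  define v where "v = complex_of_real m + \<i> * of_real e"
  have v0: "v \<noteq> 0" using e by (auto simp: v_def complex_eq_iff)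
  have Rv: "Re (1 / v) = m / (1 + m\<^sup>2)" using e by (simp add: v_def Re_divide power2_eq_square add.commute)
  have R1: "Re (1 / (12 * z)) = m / (12 * y * (1 + m\<^sup>2))"
  proof -
    have "1 / (12 * z) = of_real (1 / (12 * y)) * (1 / v)" unfolding zf v_def by simp
    then have "Re (1 / (12 * z)) = (1 / (12 * y)) * Re (1 / v)" by (simp only: Re_complex_of_real_mult)
    then show ?thesis by (simp add: Rv)
  qed
  have Ruv: "Re (1 / (u ^ 3 * v)) = - (c - m) / (A\<^sup>2 * (1 + m\<^sup>2))"
  proof -
    define q where "q = (1 + \<i> * of_real (c * e)) * v"
    have q: "q = of_real (m - c) + \<i> * of_real (e * (1 + c * m))"
      unfolding q_def v_def using e by (simp add: complex_eq_iff algebra_simps)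
    have "(m - c)\<^sup>2 + (e * (1 + c * m))\<^sup>2 = (m - c)\<^sup>2 + (e * e) * (1 + c * m)\<^sup>2" by (simp add: power2_eq_square)
    also have "\<dots> = (1 + c * c) * (1 + m\<^sup>2)" unfolding e by (simp add: power2_eq_square algebra_simps)
    also have "\<dots> = A * (1 + m\<^sup>2)" unfolding c2 Ac by simp
    finally have "Re (1 / q) = (m - c) / (A * (1 + m\<^sup>2))" unfolding q by (simp add: Re_divide)
    moreover have "1 / (u ^ 3 * v) = of_real (1 / A) * (1 / q)" unfolding u3 q_def by (simp add: mult.assoc)
    then have "Re (1 / (u ^ 3 * v)) = (1 / A) * Re (1 / q)" by (simp only: Re_complex_of_real_mult)
    ultimately show ?thesis by (simp add: power2_eq_square)
  qed
  have "F r0 = - ((c - m) ^ 4) / (12 * y * A\<^sup>2 * (1 + m\<^sup>2))"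
  proof -
    have "(of_real r0 / (of_real r0 + z)) ^ 3 / (12 * z) = of_real ((c - m) ^ 3 / (12 * y)) * (1 / (u ^ 3 * v))"
      unfolding wz using y by (subst zf) (simp add: r0f v_def power_divide power_mult_distrib)
    then have "F r0 = (c - m) ^ 3 / (12 * y) * Re (1 / (u ^ 3 * v))"
      unfolding F_def by (simp only: Re_complex_of_real_mult)
    also have "\<dots> = (c - m) ^ 3 / (12 * y) * (- (c - m) / (A\<^sup>2 * (1 + m\<^sup>2)))" unfolding Ruv ..
    also have "C ^ 3 / (12 * y) * (- C / (B * M)) = - (C ^ 4) / (12 * y * B * M)" for C B M
      by (simp add: eval_nat_numeral)
    finally show ?thesis .
  qed
  then have eq: "Re (1 / (12 * z)) - F r0 = (m + (c - m) ^ 4 / A\<^sup>2) / (12 * y * (1 + m\<^sup>2))"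
    unfolding R1 by (simp add: add_divide_distrib)
  have s2: "sqrt 2 \<le> 1.4143" by (rule real_le_lsqrt) (simp_all add: power2_eq_square)
  have s1: "sqrt 2 \<ge> 1.414" by (rule real_le_rsqrt) (simp add: power2_eq_square)
  have A2: "A\<^sup>2 \<ge> 46.6"
  proof -
    have "6.828 \<le> A" using s1 by (simp add: A_def)
    then have "6.828\<^sup>2 \<le> A\<^sup>2" by (intro power_mono) auto
    then show ?thesis by (simp add: power2_eq_square)
  qed
  \<comment> \<open>From \<open>m >= 1\<close> follows \<open>c - m <= sqrt 2\<close>. Three of the
    four factors are bounded by constants and one is kept, so the numerator gets a majorant that is
    linear in \<open>m\<close>.\<close>
  have "(c - m) ^ 3 \<le> 1.4143 ^ 3" using m s2 by (intro power_mono) (auto simp: c_def)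
  then have "(c - m) ^ 4 \<le> 2.83 * (c - m)"
    using mult_right_mono[of "(c - m) ^ 3" "2.83" "c - m"] m by (simp add: eval_nat_numeral)
  then have "(c - m) ^ 4 / A\<^sup>2 \<le> 2.83 * (c - m) / 46.6"
    using A2 m by (intro frac_le) auto
  also have "\<dots> \<le> 0.0608 * (2.4143 - m)" using m s2 by (simp add: c_def)
  finally have "m + (c - m) ^ 4 / A\<^sup>2 \<le> 0.9392 * m + 0.1468" by simp
  \<comment> \<open>The constant \<open>0.9661\<close> is just above \<open>sqrt (14/15)\<close>,
    the bound for \<open>Re z / |z|\<close> outside the narrow cone, so one constant serves both
    cases of \<open>cmod_scaled_Gamma_le\<close>. The value \<open>2.7\<close> is close to the
    minimum point of the quadratic difference of the squared sides.\<close>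
  also have "\<dots> \<le> 0.9661 * sqrt (1 + m\<^sup>2)"
  proof -
    have "0 \<le> (m - 2.7)\<^sup>2" by simp
    then have "(0.9392 * m + 0.1468)\<^sup>2 \<le> 0.9661\<^sup>2 * (1 + m\<^sup>2)"
      using m by (simp add: power2_eq_square algebra_simps)
    then have "sqrt ((0.9392 * m + 0.1468)\<^sup>2) \<le> sqrt (0.9661\<^sup>2 * (1 + m\<^sup>2))" by (rule real_sqrt_le_mono)
    then show ?thesis using m by (simp add: real_sqrt_mult)
  qed
  finally have "(m + (c - m) ^ 4 / A\<^sup>2) / (12 * y * (1 + m\<^sup>2)) \<le> 0.9661 * sqrt (1 + m\<^sup>2) / (12 * y * (1 + m\<^sup>2))"
    using y by (intro divide_right_mono) (auto simp: add_nonneg_nonneg)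
  also have "\<dots> = 0.9661 / (12 * (y * sqrt (1 + m\<^sup>2)))"
  proof -
    have "sqrt (1 + m\<^sup>2) * sqrt (1 + m\<^sup>2) = 1 + m\<^sup>2" by (simp add: add_nonneg_nonneg)
    moreover have "sqrt (1 + m\<^sup>2) > 0" by (simp add: add_pos_nonneg)
    ultimately show ?thesis using y by (simp add: frac_eq_eq add_nonneg_eq_0_iff)
  qed
  also have "y * sqrt (1 + m\<^sup>2) = cmod z"
  proof -
    have "cmod v = sqrt (1 + m\<^sup>2)" using e by (simp add: v_def cmod_def power2_eq_square add.commute)
    then show ?thesis unfolding zf norm_mult v_def[symmetric] using y by simp
  qed
  finally have "exp (Re (1 / (12 * z)) - F r0) \<le> exp (9661/10000 / (12 * cmod z))"
    unfolding eq by simp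
  then show ?thesis using le by linarith
qed

section \<open>The scaled gamma function near the origin\<close>

lemma cmod_Gamma_le_Gamma_Re:
  assumes "Re z > 0"
  shows "cmod (Gamma z) \<le> Gamma (Re z)"
proof -
  have 1: "((\<lambda>t. of_real t powr (z - 1) / of_real (exp t)) has_integral Gamma z) {0..}"
    by (rule Gamma_integral_complex[OF assms])
  have 2: "((\<lambda>t. t powr (Re z - 1) / exp t) has_integral Gamma (Re z)) {0..}"
    by (rule Gamma_integral_real[OF assms])
  have "norm (integral {0..} (\<lambda>t. complex_of_real t powr (z - 1) / of_real (exp t)))
      \<le> integral {0..} (\<lambda>t. t powr (Re z - 1) / exp t)"
    by (rule Henstock_Kurzweil_Integration.integral_norm_bound_integral[OF has_integral_integrable[OF 1] has_integral_integrable[OF 2]])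
       (simp add: norm_divide norm_powr_real_powr)
  then show ?thesis using 1 2 by (simp add: integral_unique)
qed

text \<open>Logarithmic convexity between the equal values
  \<open>Gamma 1 = Gamma 2 = 1\<close>.\<close>

lemma Gamma_le_one:
  fixes y :: real
  assumes "1 \<le> y" "y \<le> 2"
  shows "Gamma y \<le> 1"
proof -
  have c: "convex_on {1..2} (ln \<circ> Gamma :: real \<Rightarrow> real)"
    by (rule convex_on_subset[OF log_convex_Gamma_real]) auto
  have G2: "Gamma (2::real) = 1" using Gamma_fact[of 1, where ?'a = real] by simp
  have "(ln \<circ> Gamma) y \<le> ((ln \<circ> Gamma) 2 - (ln \<circ> Gamma) 1) / (2 - 1) * (y - 1) + (ln \<circ> Gamma) 1"
    by (rule convex_onD_Icc'[OF c]) (use assms in auto)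
  then have "ln (Gamma y) \<le> 0" by (simp add: G2)
  moreover have "Gamma y > 0" using assms by (intro Gamma_real_pos) auto
  ultimately show ?thesis by (simp add: ln_le_zero_iff)
qed

text \<open>This controls the factor \<open>exp (Im z * Arg z)\<close> in \<open>|z powr z|\<close>.
  In terms of the half angle \<open>h\<close> the sides are \<open>4 h sin h cos h\<close> and
  \<open>4 (sin h)^2\<close>, so the claim is \<open>h cos h <= sin h\<close>.\<close>

lemma mult_sin_le_double_one_minus_cos:
  fixes x :: real
  assumes "\<bar>x\<bar> \<le> pi"
  shows "x * sin x \<le> 2 * (1 - cos x)"
proof -
  define h where "h = \<bar>x\<bar> / 2"
  have h: "0 \<le> h" "h \<le> pi" using assms by (auto simp: h_def)
  have "sin 0 - 0 * cos 0 \<le> sin h - h * cos h"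
  proof (rule DERIV_nonneg_imp_nondecreasing[OF h(1)])
    fix x assume x: "0 \<le> x" "x \<le> h"
    have "((\<lambda>x. sin x - x * cos x) has_real_derivative x * sin x) (at x)"
      by (auto intro!: derivative_eq_intros)
    moreover have "x * sin x \<ge> 0" using x h by (intro mult_nonneg_nonneg sin_ge_zero) auto
    ultimately show "\<exists>y. ((\<lambda>x. sin x - x * cos x) has_real_derivative y) (at x) \<and> 0 \<le> y" by blast
  qed
  then have "h * cos h \<le> sin h" by simp
  then have "4 * sin h * (h * cos h) \<le> 4 * sin h * sin h"
    using sin_ge_zero[OF h] by (intro mult_left_mono) auto
  moreover have "x * sin x = \<bar>x\<bar> * sin \<bar>x\<bar>" by (simp add: abs_if)
  moreover have "\<bar>x\<bar> * sin \<bar>x\<bar> = 4 * sin h * (h * cos h)"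
    using sin_double[of h] by (simp add: h_def)
  moreover have "cos x = 1 - 2 * sin h * sin h"
  proof -
    have "cos x = cos \<bar>x\<bar>" by (simp add: abs_if)
    also have "\<dots> = cos (2 * h)" by (simp add: h_def)
    finally show ?thesis by (simp add: cos_double_sin power2_eq_square)
  qed
  ultimately show ?thesis by simp
qed

text \<open>Complements Gudermann's series for small \<open>|z|\<close>. From
  \<open>|Gamma (z + 1)| <= 1\<close> comes \<open>|Gamma z| <= 1 / |z|\<close>. The hypothesis
  gives \<open>1 - ln |z| >= 2\<close>, the factor in
  \<open>mult_sin_le_double_one_minus_cos\<close>; thus the exponent, as a function of the argument,
  is largest for real \<open>z\<close>.\<close>

lemma cmod_scaled_Gamma_le_near_zero:
  assumes z: "Re z > 0" and t: "cmod z \<le> exp (-1)"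
  shows "cmod (scaled_Gamma z) \<le> exp (cmod z * (1 - ln (cmod z))) / sqrt (2 * pi * cmod z)"
proof -
  define t \<phi> where "t = cmod z" and "\<phi> = Arg z"
  have t0: "t > 0" using z by (auto simp: t_def)
  have t1: "t \<le> 1" using assms(2) by (simp add: t_def) (smt (verit) exp_le_one_iff)
  have lt: "ln t \<le> -1" 
  proof -
    have "ln t \<le> ln (exp (-1))" using t t0 by (subst ln_le_cancel_iff) (auto simp: t_def)
    then show ?thesis by simp
  qed
  have z0: "z \<noteq> 0" using z by auto
  have zc: "z = of_real t * cis \<phi>" using rcis_cmod_Arg[of z] by (simp add: t_def \<phi>_def rcis_def)
  have X: "Re z = t * cos \<phi>" and Y: "Im z = t * sin \<phi>" by (subst zc, simp)+
  have Ln: "Ln z = of_real (ln t) + \<i> * of_real \<phi>" using z0 by (simp add: Ln_Arg t_def \<phi>_def)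
  have np: "z \<notin> \<int>\<^sub>\<le>\<^sub>0" using z by (auto elim!: nonpos_Ints_cases)
  have "cmod (Gamma (z + 1)) \<le> Gamma (Re z + 1)" using cmod_Gamma_le_Gamma_Re[of "z + 1"] z by simp
  also have "\<dots> \<le> 1"
  proof (rule Gamma_le_one)
    show "Re z + 1 \<le> 2" using complex_Re_le_cmod[of z] t1 by (simp add: t_def)
  qed (use z in auto)
  also have "cmod (Gamma (z + 1)) = t * cmod (Gamma z)" by (simp add: Gamma_plus1[OF np] norm_mult t_def)
  finally have G: "cmod (Gamma z) \<le> 1 / t" using t0 by (simp add: field_simps)
  have "cmod (z powr (z - 1/2)) = exp ((Re z - 1/2) * ln t - Im z * \<phi>)"
    using z0 by (simp add: powr_def Ln)
  then have "cmod (scaled_Gamma z) = cmod (Gamma z) / (sqrt (2 * pi) * exp ((Re z - 1/2) * ln t - Im z * \<phi>) * exp (- Re z))"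
    by (simp add: scaled_Gamma_def norm_divide norm_mult)
  also have "\<dots> = cmod (Gamma z) * exp (Re z - (Re z - 1/2) * ln t + Im z * \<phi>) / sqrt (2 * pi)"
  proof -
    have E: "exp (X - P + Q) = inverse (exp (P - Q) * exp (- X))" for X P Q :: real
      unfolding exp_add[symmetric] exp_minus[symmetric] by (rule arg_cong[where f = exp]) simp
    show ?thesis unfolding E divide_inverse inverse_mult_distrib by (simp only: mult_ac)
  qed
  also have "\<dots> \<le> 1 / t * exp (t * (1 - ln t) + ln t / 2) / sqrt (2 * pi)"
  proof (intro divide_right_mono mult_mono G)
    have "\<bar>\<phi>\<bar> \<le> pi" using Arg_bounded[of z] by (simp add: \<phi>_def abs_le_iff)
    then have "\<phi> * sin \<phi> \<le> 2 * (1 - cos \<phi>)" by (rule mult_sin_le_double_one_minus_cos)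
    also have "\<dots> \<le> (1 - ln t) * (1 - cos \<phi>)" using lt by (intro mult_right_mono) auto
    finally have "t * (\<phi> * sin \<phi>) \<le> t * ((1 - ln t) * (1 - cos \<phi>))" using t0 by (intro mult_left_mono) auto
    then have "Re z - (Re z - 1/2) * ln t + Im z * \<phi> \<le> t * (1 - ln t) + ln t / 2"
      unfolding X Y by (simp add: algebra_simps)
    then show "exp (Re z - (Re z - 1/2) * ln t + Im z * \<phi>) \<le> exp (t * (1 - ln t) + ln t / 2)" by simp
  qed (use t0 in auto)
  also have "\<dots> = exp (t * (1 - ln t)) / sqrt (2 * pi * t)"
  proof -
    have "exp (ln t / 2) = sqrt t" using t0 by (simp flip: ln_sqrt)
    moreover have q: "1 / t * sqrt t = 1 / sqrt t" using t0 by (simp add: field_simps)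
    have "1 / t * (E * sqrt t) / S = E / (S * sqrt t)" for E S
    proof -
      have "1 / t * (E * sqrt t) / S = E / S * (1 / t * sqrt t)" by simp
      then show ?thesis unfolding q by simp
    qed
    ultimately show ?thesis by (simp add: exp_add real_sqrt_mult)
  qed
  finally show ?thesis by (simp add: t_def)
qed

text \<open>Explains the target \<open>x^3 / 6\<close> for the defect. With \<open>q\<close> the
  quadratic, \<open>ln q - x + x^3 / 6\<close> has derivative
  \<open>x^2 / 2 * (1 - 1 / q) >= 0\<close>.\<close>

lemma exp_tail_le_quadratic:
  fixes x :: real
  assumes "x \<ge> 0"
  shows "exp (x - x^3 / 6) \<le> 1 + x + x\<^sup>2 / 2"
proof -
  have p: "1 + y + y\<^sup>2 / 2 > 0" if "y \<ge> 0" for y :: real using that by (simp add: add_pos_nonneg)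
  have "ln (1 + 0 + 0\<^sup>2 / 2) - 0 + 0^3 / 6 \<le> ln (1 + x + x\<^sup>2 / 2) - x + x^3 / 6"
  proof (rule DERIV_nonneg_imp_nondecreasing[OF assms])
    fix y :: real assume y: "0 \<le> y" "y \<le> x"
    define q where "q = 1 + y + y\<^sup>2 / 2"
    have q: "q \<ge> 1" using y by (simp add: q_def)
    have d: "((\<lambda>x. ln (1 + x + x\<^sup>2 / 2) - x + x^3 / 6) has_real_derivative (1 + y) / q - 1 + y\<^sup>2 / 2) (at y)"
      using p[OF y(1)] by (auto intro!: derivative_eq_intros simp: q_def)
    have eq: "(1 + y) / q - 1 + y\<^sup>2 / 2 = y\<^sup>2 / 2 * (1 - 1 / q)"
    proof -
      have "1 + y = q - y\<^sup>2 / 2" by (simp add: q_def)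
      then show ?thesis using q by (simp add: field_simps)
    qed
    have "(1 + y) / q - 1 + y\<^sup>2 / 2 \<ge> 0" unfolding eq using q by (intro mult_nonneg_nonneg) auto
    then show "\<exists>d. ((\<lambda>x. ln (1 + x + x\<^sup>2 / 2) - x + x^3 / 6) has_real_derivative d) (at y) \<and> 0 \<le> d"
      using d by blast
  qed
  then have "x - x^3 / 6 \<le> ln (1 + x + x\<^sup>2 / 2)" by simp
  then show ?thesis using p[OF assms] by (simp add: ln_ge_iff)
qed

text \<open>The threshold \<open>0.185\<close> lies just below the point where the increasing
  function \<open>t (1 - ln t)\<close> reaches \<open>1/2\<close>. The proof needs \<open>ln\<close>
  only at the threshold and bounds it elsewhere by \<open>ln x <= x - 1\<close>.\<close>

lemma mult_one_minus_ln_le_half: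
  fixes t :: real
  assumes "0 < t" "t \<le> 185/1000"
  shows "t * (1 - ln t) \<le> 1/2"
proof -
  define s :: real where "s = 185/1000"
  have s0: "s > 0" by (simp add: s_def)
  \<comment> \<open>\<open>0.2125 = 1.7 / 8\<close>: the quadratic Taylor bound becomes sharp enough
    for \<open>exp 1.7 >= 1 / 0.185\<close> after taking the eighth power.\<close>
  have "1 + 0.2125 + 0.2125\<^sup>2 / 2 \<le> exp (0.2125 :: real)" by (rule exp_lower_Taylor_quadratic) simp
  then have "(1.235 :: real) ^ 8 \<le> exp 0.2125 ^ 8" by (intro power_mono) (auto simp: power2_eq_square)
  also have "exp (0.2125 :: real) ^ 8 = exp 1.7" by (simp flip: exp_of_nat_mult)
  finally have "1 / s \<le> exp 1.7" by (simp add: s_def eval_nat_numeral)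
  then have "ln (1 / s) \<le> 1.7" using s0 by (metis exp_gt_zero ln_exp ln_le_cancel_iff zero_less_divide_1_iff)
  then have ls: "- ln s \<le> 1.7" using s0 by (simp add: ln_div)
  have "ln (s / t) \<le> s / t - 1" using assms s0 by (intro ln_le_minus_one) auto
  then have "- ln t \<le> s / t - 1 - ln s" using assms s0 by (simp add: ln_div)
  then have "t * (1 - ln t) \<le> t * (s / t - ln s)" using assms by (intro mult_left_mono) auto
  also have "\<dots> = s + t * (- ln s)" using assms by (simp add: field_simps)
  also have "\<dots> \<le> s + s * 1.7"
    using assms ls s0 by (intro add_left_mono mult_mono') (auto simp: s_def)
  also have "\<dots> \<le> 1/2" by (simp add: s_def)
  finally show ?thesis .
qed

text \<open>Beyond \<open>|z| = 0.185\<close>, where \<open>x <= 0.45046\<close>, both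
  \<open>x - x^3 / 6\<close> and \<open>0.9661 * x\<close> are admissible exponents. In the narrow
  cone \<open>Re (1 / (12 z))\<close> can be as large as \<open>x\<close>, so the defect must supply
  \<open>x^3 / 6\<close>. Between the cone and \<open>pi / 8\<close> the defect is nonnegative and
  the factor \<open>cos (Arg z)\<close> supplies \<open>0.9661\<close>; beyond \<open>pi / 8\<close>
  the intermediate estimate does.\<close>

theorem cmod_scaled_Gamma_le:
  assumes z: "Re z > 0" "\<bar>Im z\<bar> \<le> Re z"
  shows "cmod (scaled_Gamma z) \<le> 1 + 1 / (12 * cmod z) + 1 / (288 * (cmod z)\<^sup>2)"
proof -
  define t where "t = cmod z"
  define x where "x = 1 / (12 * t)"
  have t0: "t > 0" using z by (auto simp: t_def)
  have x0: "x > 0" using t0 by (simp add: x_def)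
  have tx: "t = 1 / (12 * x)" using t0 by (simp add: x_def)
  have x2: "1 / (288 * t\<^sup>2) = x\<^sup>2 / 2" using t0 by (simp add: x_def power_divide power_mult_distrib)
  have "cmod (scaled_Gamma z) \<le> 1 + x + x\<^sup>2 / 2"
  proof (cases "t \<le> 185/1000")
    case True
    have e1: "exp 1 < (272/100 :: real)" by (rule e_less_272)
    have "exp (-1) \<ge> (185/1000 :: real)"
      using e1 by (simp add: exp_minus field_simps)
    then have "cmod z \<le> exp (-1)" using True by (simp add: t_def)
    from cmod_scaled_Gamma_le_near_zero[OF z(1) this]
    have "cmod (scaled_Gamma z) \<le> exp (t * (1 - ln t)) / sqrt (2 * pi * t)" by (simp add: t_def)
    also have "\<dots> \<le> exp (1/2) / sqrt (2 * pi * t)"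
      using mult_one_minus_ln_le_half[OF t0 True] t0 by (intro divide_right_mono) auto
    also have "\<dots> \<le> 1 + x + x\<^sup>2 / 2"
    proof (rule power2_le_imp_le)
      have "(exp (1/2) / sqrt (2 * pi * t))\<^sup>2 = exp 1 / (2 * pi * t)"
        using t0 by (simp add: power_divide flip: exp_of_nat_mult)
      also have "\<dots> = exp 1 * 6 * x / pi" by (simp add: tx)
      also have "\<dots> \<le> 52/10 * x"
      proof -
        have "exp 1 * 6 \<le> 52/10 * pi" using e1 pi_approx by simp
        then have "exp 1 * 6 * x \<le> 52/10 * pi * x" using x0 by (intro mult_right_mono) auto
        then show ?thesis by (simp add: field_simps)
      qed
      \<comment> \<open>The powers \<open>x^3\<close> and \<open>x^4\<close> are replaced by their
        tangents at \<open>0.55\<close> and \<open>x^2\<close> by its tangent at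
        \<open>0.535\<close>, which reduces the quartic inequality to a linear one.\<close>
      also have "52/10 * x \<le> (1 + x + x\<^sup>2 / 2)\<^sup>2"
      proof -
        define b where "b = x - 55/100"
        have "b\<^sup>2 * (x + 11/10) = x^3 - (9075/10000 * x - 33275/100000)"
          by (simp add: b_def eval_nat_numeral field_simps)
        moreover have "0 \<le> b\<^sup>2 * (x + 11/10)" using x0 by simp
        ultimately have c3: "9075/10000 * x - 33275/100000 \<le> x^3" by linarith
        have "b\<^sup>2 * ((x + 55/100)\<^sup>2 + 605/1000) = x^4 - (6655/10000 * x - 27451875/100000000)"
          by (simp add: b_def eval_nat_numeral field_simps)
        moreover have "0 \<le> b\<^sup>2 * ((x + 55/100)\<^sup>2 + 605/1000)" by simp
        ultimately have c4: "6655/10000 * x - 27451875/100000000 \<le> x^4" by linarith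
        have "(x - 535/1000)\<^sup>2 = x^2 - (107/100 * x - 286225/1000000)" by (simp add: power2_eq_square field_simps)
        moreover have "0 \<le> (x - 535/1000)\<^sup>2" by simp
        ultimately have c2: "107/100 * x - 286225/1000000 \<le> x^2" by linarith
        have "(1 + x + x\<^sup>2 / 2)\<^sup>2 = 1 + 2 * x + 2 * x^2 + x^3 + x^4 / 4"
          by (simp add: eval_nat_numeral field_simps)
        then show ?thesis using c2 c3 c4 x0 by linarith
      qed
      finally show "(exp (1/2) / sqrt (2 * pi * t))\<^sup>2 \<le> (1 + x + x\<^sup>2 / 2)\<^sup>2" .
    qed (use x0 in auto)
    finally show ?thesis .
  next
    case False
    then have t: "t \<ge> 185/1000" by simp
    have Rez: "Re (1 / (12 * z)) = Re z / (12 * t\<^sup>2)"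
    proof -
      have "1 / (12 * z) = of_real (1/12) * (1 / z)" by simp
      then have "Re (1 / (12 * z)) = (1/12) * Re (1 / z)" by (simp only: Re_complex_of_real_mult)
      also have "Re (1 / z) = Re z / t\<^sup>2" by (simp add: Re_divide t_def cmod_power2)
      finally show ?thesis by simp
    qed
    have Rle: "Re z \<le> t" by (simp add: t_def complex_Re_le_cmod)
    have small: "exp (0.9661 * x) \<le> 1 + x + x\<^sup>2 / 2"
    proof -
      have "x \<le> 0.45046" using t t0 by (simp add: x_def field_simps)
      then have "x\<^sup>2 \<le> 0.45046\<^sup>2" using x0 by (intro power_mono) auto
      then have "x\<^sup>2 / 6 \<le> 0.0339" by (simp add: power2_eq_square)
      then have "x * (x\<^sup>2 / 6) \<le> x * 0.0339" using x0 by (intro mult_left_mono) auto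
      then have "0.9661 * x \<le> x - x^3 / 6" by (simp add: eval_nat_numeral algebra_simps)
      then have "exp (0.9661 * x) \<le> exp (x - x^3 / 6)" by simp
      also have "\<dots> \<le> 1 + x + x\<^sup>2 / 2" using x0 by (intro exp_tail_le_quadratic) auto
      finally show ?thesis .
    qed
    show ?thesis
    proof (cases "14 * (Im z)\<^sup>2 \<le> (Re z)\<^sup>2")
      case True
      have "\<forall>\<^sub>F n in sequentially. x^3 / 6 \<le> (\<Sum>k<n. Re (binet_defect (z + of_nat k)))"
        using binet_defect_sum_ge[OF z(1) True] t by (simp add: x_def t_def)
      then have "cmod (scaled_Gamma z) \<le> exp (Re (1 / (12 * z)) - x^3 / 6)"
        by (rule cmod_scaled_Gamma_le_exp[OF z(1)])
      also have "\<dots> \<le> exp (x - x^3 / 6)"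
        using Rle t0 unfolding Rez by (simp add: x_def field_simps power2_eq_square)
      also have "\<dots> \<le> 1 + x + x\<^sup>2 / 2" using x0 by (intro exp_tail_le_quadratic) auto
      finally show ?thesis .
    next
      case F: False
      show ?thesis
      proof (cases "Re z \<le> (1 + sqrt 2) * \<bar>Im z\<bar>")
        case True
        have "cmod (scaled_Gamma z) \<le> exp (9661/10000 / (12 * cmod z))"
          by (rule cmod_scaled_Gamma_le_exp_intermediate[OF z True])
        also have "9661/10000 / (12 * cmod z) = 0.9661 * x" by (simp add: x_def t_def)
        finally show ?thesis using small by linarith
      next
        case False
        have "0 \<le> Re (binet_defect (z + of_nat k))" for k
          by (rule Re_binet_defect_nonneg) (use z False in auto)
        then have "\<forall>\<^sub>F n in sequentially. 0 \<le> (\<Sum>k<n. Re (binet_defect (z + of_nat k)))"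
          by (intro always_eventually allI sum_nonneg) auto
        then have "cmod (scaled_Gamma z) \<le> exp (Re (1 / (12 * z)) - 0)"
          by (rule cmod_scaled_Gamma_le_exp[OF z(1)])
        moreover have "Re z \<le> 0.9661 * t"
        proof (rule power2_le_imp_le)
          have "t\<^sup>2 = (Re z)\<^sup>2 + (Im z)\<^sup>2" by (simp add: t_def cmod_power2)
          then have "15 * (Re z)\<^sup>2 \<le> 14 * t\<^sup>2" using F by simp
          then have "(Re z)\<^sup>2 \<le> 14/15 * t\<^sup>2" by simp
          also have "\<dots> \<le> 0.9661\<^sup>2 * t\<^sup>2" by (intro mult_right_mono) (simp_all add: power2_eq_square)
          finally show "(Re z)\<^sup>2 \<le> (0.9661 * t)\<^sup>2" by (simp only: power_mult_distrib)
        qed (use t0 in auto)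
        then have "Re (1 / (12 * z)) \<le> 0.9661 * x"
          unfolding Rez using t0 by (simp add: x_def field_simps power2_eq_square)
        ultimately show ?thesis using small by (smt (verit) exp_le_cancel_iff)
      qed
    qed
  qed
  then show ?thesis using x2 by (simp add: x_def t_def)
qed

section \<open>Integrals over half-lines\<close>

lemma set_integrable_FTC_at_top:
  fixes f F :: "real \<Rightarrow> real"
  assumes "f \<in> borel_measurable borel"
    and "\<And>x. a \<le> x \<Longrightarrow> DERIV F x :> f x"
    and "\<And>x. a \<le> x \<Longrightarrow> 0 \<le> f x"
    and "(F \<longlongrightarrow> T) at_top"
  shows "set_integrable lborel {a..} f"
proof -
  have "(\<integral>\<^sup>+x. ennreal (indicator {a..} x * f x) \<partial>lborel) = (\<integral>\<^sup>+x. ennreal (f x) * indicator {a ..} x \<partial>lborel)"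
    by (intro nn_integral_cong) (auto simp: indicator_def)
  also have "\<dots> = T - F a" by (rule nn_integral_FTC_atLeast[OF assms])
  finally have "(\<integral>\<^sup>+x. ennreal (indicator {a..} x * f x) \<partial>lborel) = ennreal (T - F a)" .
  moreover have "(\<lambda>x. indicator {a..} x * f x) \<in> borel_measurable lborel" using assms(1) by simp
  ultimately have "integrable lborel (\<lambda>x. indicator {a..} x * f x)"
    using assms(3) by (intro integrableI_nonneg) (auto simp: indicator_def)
  then show ?thesis by (simp add: set_integrable_def)
qed

lemma set_integrable_greaterThan:
  fixes f :: "real \<Rightarrow> 'a :: {banach, second_countable_topology}"
  assumes "set_integrable lborel {a..} f"
  shows "set_integrable lborel {a<..} f"
  by (rule set_integrable_subset[OF assms]) auto

lemma set_integral_FTC_at_top: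
  fixes f F :: "real \<Rightarrow> 'a :: euclidean_space"
  assumes F: "\<And>x. a \<le> x \<Longrightarrow> (F has_vector_derivative f x) (at x within {a..})"
    and int: "set_integrable lborel {a<..} f" and lim: "(F \<longlongrightarrow> L) at_top"
  shows "(LINT x:{a<..}|lborel. f x) = L - F a"
proof (rule LIMSEQ_unique)
  show "(\<lambda>n. LINT x:{a<..a + real n}|lborel. f x) \<longlonglongrightarrow> (LINT x:{a<..}|lborel. f x)"
  proof -
    have U: "(\<Union>n. {a<..a + real n}) = {a<..}"
    proof (intro equalityI subsetI)
      fix x assume "x \<in> {a<..}"
      moreover obtain n where "x - a \<le> real n" using real_arch_simple by blast
      ultimately show "x \<in> (\<Union>n. {a<..a + real n})" by (auto intro!: exI[of _ n])
    qed auto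
    have "(\<lambda>n. LINT x:{a<..a + real n}|lborel. f x) \<longlonglongrightarrow> (LINT x:(\<Union>n. {a<..a + real n})|lborel. f x)"
      by (rule set_integral_cont_up) (use int in \<open>auto simp: incseq_def U\<close>)
    then show ?thesis unfolding U .
  qed
  have "(LINT x:{a<..a + real n}|lborel. f x) = F (a + real n) - F a" for n
  proof -
    have i: "set_integrable lborel {a<..a + real n} f" by (rule set_integrable_subset[OF int]) auto
    have "(f has_integral (F (a + real n) - F a)) {a..a + real n}"
      by (rule fundamental_theorem_of_calculus) (auto intro!: has_vector_derivative_within_subset[OF F])
    moreover have "negligible {x \<in> {a..a + real n} - {a<..a + real n}. f x \<noteq> 0}"
      "negligible {x \<in> {a<..a + real n} - {a..a + real n}. f x \<noteq> 0}"
      by (rule negligible_subset[of "{a}"], auto)+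
    ultimately have "(f has_integral (F (a + real n) - F a)) {a<..a + real n}"
      by (simp add: has_integral_spike_set_eq[of "{a..a + real n}" "{a<..a + real n}"])
    then show ?thesis using set_borel_integral_eq_integral(2)[OF i] by (simp add: integral_unique)
  qed
  moreover have "filterlim (\<lambda>n. a + real n) at_top sequentially"
    by (intro filterlim_tendsto_add_at_top[OF tendsto_const] filterlim_real_sequentially)
  then have "(\<lambda>n. F (a + real n)) \<longlonglongrightarrow> L" by (rule filterlim_compose[OF lim])
  then have "(\<lambda>n. F (a + real n) - F a) \<longlonglongrightarrow> L - F a" by (intro tendsto_intros)
  ultimately show "(\<lambda>n. LINT x:{a<..a + real n}|lborel. f x) \<longlonglongrightarrow> L - F a" by simp
qed

text \<open>Half of the exponential decay absorbs the power, by
  \<open>(t c / 2)^n / n! <= exp (t c / 2)\<close>.\<close>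

lemma set_integrable_power_exp:
  fixes c :: real
  assumes c: "c > 0"
  shows "set_integrable lborel {0<..} (\<lambda>t. t ^ n * exp (- (t * c)))"
proof (rule set_integrable_bound)
  have "set_integrable lborel {0..} (\<lambda>t. exp (- (t * (c/2))))"
  proof (rule set_integrable_FTC_at_top)
    show "DERIV (\<lambda>t. - exp (- (t * (c/2))) / (c/2)) x :> exp (- (x * (c/2)))" for x
      using c by (auto intro!: derivative_eq_intros)
    have "((\<lambda>t. - exp (- (t * (c/2))) / (c/2)) \<longlongrightarrow> - 0 / (c/2)) at_top"
      by (intro tendsto_intros filterlim_compose[OF exp_at_bot] filterlim_uminus_at_bot_at_top[THEN filterlim_compose]
            filterlim_at_top_mult_tendsto_pos[OF tendsto_const] filterlim_ident) (use c in auto)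
    then show "((\<lambda>t. - exp (- (t * (c/2))) / (c/2)) \<longlongrightarrow> 0) at_top" by simp
  qed auto
  then have "set_integrable lborel {0<..} (\<lambda>t. exp (- (t * (c/2))))" by (rule set_integrable_greaterThan)
  then show "set_integrable lborel {0<..} (\<lambda>t. (fact n * (2 / c) ^ n) * exp (- (t * (c/2))))"
    by (rule set_integrable_mult_right)
  show "set_borel_measurable lborel {0<..} (\<lambda>t. t ^ n * exp (- (t * c)))"
    unfolding set_borel_measurable_def by measurable
  show "AE t in lborel. t \<in> {0<..} \<longrightarrow> norm (t ^ n * exp (- (t * c))) \<le> norm (fact n * (2 / c) ^ n * exp (- (t * (c/2))))"
  proof (rule AE_I2, rule impI)
    fix t :: real assume "t \<in> {0<..}"
    then have t: "t > 0" by simp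
    have "(t * (c/2)) ^ n / fact n \<le> exp (t * (c/2))"
    proof -
      have "(\<Sum>k\<in>{n}. (t * (c/2)) ^ k /\<^sub>R fact k) \<le> (\<Sum>k. (t * (c/2)) ^ k /\<^sub>R fact k)"
        by (rule sum_le_suminf[OF summable_exp_generic]) (use t c in auto)
      then show ?thesis by (simp add: exp_def field_simps)
    qed
    then have "t ^ n \<le> fact n * (2 / c) ^ n * exp (t * (c/2))"
      using c by (simp add: field_simps power_mult_distrib power_divide)
    then have "t ^ n * exp (- (t * c)) \<le> fact n * (2 / c) ^ n * exp (t * (c/2)) * exp (- (t * c))"
      by (intro mult_right_mono) auto
    also have "\<dots> = fact n * (2 / c) ^ n * exp (- (t * (c/2)))"
      by (simp add: mult.assoc flip: exp_add)
    finally show "norm (t ^ n * exp (- (t * c))) \<le> norm (fact n * (2 / c) ^ n * exp (- (t * (c/2))))"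
      using t c by simp
  qed
qed

lemma set_integrable_power_cexp:
  fixes q :: complex
  assumes "Re q > 0"
  shows "set_integrable lborel {0<..} (\<lambda>t. of_real t ^ n * exp (- (of_real t * q)))"
proof (rule set_integrable_bound[OF set_integrable_power_exp[OF assms, of n]])
  show "set_borel_measurable lborel {0<..} (\<lambda>t. complex_of_real t ^ n * exp (- (of_real t * q)))"
    unfolding set_borel_measurable_def
    by (intro borel_measurable_scaleR borel_measurable_indicator) (auto intro!: borel_measurable_continuous_onI continuous_intros)
qed (auto simp: norm_mult norm_power)

lemma set_integral_power_cexp:
  fixes q :: complex
  assumes q: "Re q > 0"
  shows "(LINT t:{0<..}|lborel. of_real t ^ n * exp (- (of_real t * q))) = fact n / q ^ Suc n"
proof (induction n)
  have q0: "q \<noteq> 0" using q by auto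
  have lim: "((\<lambda>t. of_real t ^ n * exp (- (of_real t * q))) \<longlongrightarrow> 0) at_top" for n
  proof (rule tendsto_norm_zero_cancel)
    have "((\<lambda>t. t ^ n / exp t) \<longlongrightarrow> (0::real)) at_top" by (rule tendsto_power_div_exp_0)
    moreover have "filterlim (\<lambda>t. t * Re q) at_top at_top"
      by (rule filterlim_at_top_mult_tendsto_pos[OF tendsto_const q filterlim_ident])
    ultimately have "((\<lambda>t. (t * Re q) ^ n / exp (t * Re q) * (1 / Re q ^ n)) \<longlongrightarrow> 0 * (1 / Re q ^ n)) at_top"
      by (intro tendsto_mult tendsto_const) (rule filterlim_compose)
    then have 1: "((\<lambda>t. (t * Re q) ^ n / exp (t * Re q) * (1 / Re q ^ n)) \<longlongrightarrow> 0) at_top" by simp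
    have "\<forall>\<^sub>F t in at_top. (t * Re q) ^ n / exp (t * Re q) * (1 / Re q ^ n) = norm (complex_of_real t ^ n * exp (- (of_real t * q)))"
      using eventually_ge_at_top[of 0]
    proof eventually_elim
      case (elim t)
      then have "norm (complex_of_real t ^ n * exp (- (of_real t * q))) = t ^ n * exp (- (t * Re q))"
        by (simp add: norm_mult norm_power)
      then show ?case using q by (simp add: power_mult_distrib exp_minus field_simps)
    qed
    from Lim_transform_eventually[OF 1 this]
    show "((\<lambda>t. norm (complex_of_real t ^ n * exp (- (of_real t * q)))) \<longlongrightarrow> 0) at_top" .
  qed
  have d0: "((\<lambda>t. - (1/q) * exp (- (of_real t * q))) has_vector_derivative exp (- (of_real t * q))) (at t within A)" for t A
  proof -
    have "((\<lambda>z. - (1/q) * exp (- (z * q))) has_field_derivative exp (- (of_real t * q))) (at (of_real t))"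
      using q0 by (auto intro!: derivative_eq_intros)
    then show ?thesis by (rule has_vector_derivative_at_within[OF has_vector_derivative_real_field])
  qed
  {
    case 0
    have "(LINT t:{0<..}|lborel. exp (- (of_real t * q))) = 0 - (- (1/q) * exp (- (of_real 0 * q)))"
    proof (rule set_integral_FTC_at_top)
      show "set_integrable lborel {0<..} (\<lambda>t. exp (- (of_real t * q)))"
        using set_integrable_power_cexp[OF q, of 0] by simp
      have "((\<lambda>t. - (1/q) * exp (- (complex_of_real t * q))) \<longlongrightarrow> - (1/q) * 0) at_top"
        using lim[of 0] by (intro tendsto_intros) simp
      then show "((\<lambda>t. - (1/q) * exp (- (complex_of_real t * q))) \<longlongrightarrow> 0) at_top" by simp
    qed (rule d0)
    then show ?case by simp
  next
    case (Suc n)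
    let ?F = "\<lambda>t. - (1/q) * (of_real t ^ Suc n * exp (- (of_real t * q)))"
    let ?g = "\<lambda>n t. complex_of_real t ^ n * exp (- (of_real t * q))"
    have "(LINT t:{0<..}|lborel. ?g (Suc n) t - of_nat (Suc n) / q * ?g n t) = 0 - ?F 0"
    proof (rule set_integral_FTC_at_top)
      show "(?F has_vector_derivative ?g (Suc n) t - of_nat (Suc n) / q * ?g n t) (at t within {0..})" for t :: real
      proof -
        have "((\<lambda>z. - (1/q) * (z ^ Suc n * exp (- (z * q)))) has_field_derivative
            of_real t ^ Suc n * exp (- (of_real t * q)) - of_nat (Suc n) / q * (of_real t ^ n * exp (- (of_real t * q)))) (at (of_real t))"
          by (rule derivative_eq_intros refl)+ (use q0 in \<open>simp add: field_simps\<close>)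
        then show ?thesis by (rule has_vector_derivative_at_within[OF has_vector_derivative_real_field])
      qed
      show "set_integrable lborel {0<..} (\<lambda>t. ?g (Suc n) t - of_nat (Suc n) / q * ?g n t)"
        by (intro set_integral_diff set_integrable_mult_right set_integrable_power_cexp q)
      have "(?F \<longlongrightarrow> - (1/q) * 0) at_top" by (intro tendsto_mult tendsto_const lim)
      then show "(?F \<longlongrightarrow> 0) at_top" by simp
    qed
    moreover have "(LINT t:{0<..}|lborel. ?g (Suc n) t - of_nat (Suc n) / q * ?g n t) =
       (LINT t:{0<..}|lborel. ?g (Suc n) t) - of_nat (Suc n) / q * (LINT t:{0<..}|lborel. ?g n t)"
      using set_integral_diff(2)[OF set_integrable_power_cexp[OF q, of "Suc n"]
          set_integrable_mult_right[of "of_nat (Suc n) / q", OF set_integrable_power_cexp[OF q, of n]]]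
      by (simp only: set_integral_mult_right)
    ultimately have "(LINT t:{0<..}|lborel. ?g (Suc n) t) = of_nat (Suc n) / q * (fact n / q ^ Suc n)"
      using Suc.IH by simp
    then show ?case by (simp add: field_simps)
  }
qed

lemma integrable_inverse_square_shifted_abs:
  fixes b c :: real
  assumes b: "b > 0"
  shows "integrable lborel (\<lambda>y. 1 / (\<bar>y + c\<bar> + b)\<^sup>2)"
proof -
  let ?h = "\<lambda>x::real. indicator {0..} x * (1 / (x + b)\<^sup>2)"
  have "set_integrable lborel {0..} (\<lambda>x. 1 / (\<bar>x\<bar> + b)\<^sup>2)"
  proof (rule set_integrable_FTC_at_top)
    show "(\<lambda>x. 1 / (\<bar>x\<bar> + b)\<^sup>2) \<in> borel_measurable borel" by measurable
    show "DERIV (\<lambda>x. - (1 / (x + b))) x :> 1 / (\<bar>x\<bar> + b)\<^sup>2" if "0 \<le> x" for x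
      using that b by (auto intro!: derivative_eq_intros simp: power2_eq_square field_simps)
    have "filterlim (\<lambda>x. b + x) at_top at_top"
      by (intro filterlim_tendsto_add_at_top[OF tendsto_const] filterlim_ident)
    then have "((\<lambda>x. - (1 / (x + b))) \<longlongrightarrow> - 0) at_top"
      by (intro tendsto_minus tendsto_divide_0[OF tendsto_const] filterlim_at_top_imp_at_infinity) (simp add: add.commute)
    then show "((\<lambda>x. - (1 / (x + b))) \<longlongrightarrow> 0) at_top" by simp
  qed auto
  then have h: "integrable lborel ?h"
    unfolding set_integrable_def by (rule Bochner_Integration.integrable_cong[THEN iffD1, rotated 2]) (auto simp: indicator_def)
  have 1: "integrable lborel (\<lambda>y. ?h (c + 1 * y))" by (rule lborel_integrable_real_affine[OF h]) simp
  have 2: "integrable lborel (\<lambda>y. ?h (- c + (-1) * y))" by (rule lborel_integrable_real_affine[OF h]) simp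
  show ?thesis
  proof (rule Bochner_Integration.integrable_bound[OF Bochner_Integration.integrable_add[OF 1 2]])
    show "(\<lambda>y. 1 / (\<bar>y + c\<bar> + b)\<^sup>2) \<in> borel_measurable lborel" by measurable
    show "AE y in lborel. norm (1 / (\<bar>y + c\<bar> + b)\<^sup>2) \<le> norm (?h (c + 1 * y) + ?h (- c + (-1) * y))"
    proof (rule AE_I2)
      fix y :: real
      have nn: "?h x \<ge> 0" for x by (simp add: indicator_def)
      have "1 / (\<bar>y + c\<bar> + b)\<^sup>2 \<le> ?h (c + 1 * y) + ?h (- c + (-1) * y)"
      proof (cases "y + c \<ge> 0")
        case True
        then have "1 / (\<bar>y + c\<bar> + b)\<^sup>2 = ?h (c + 1 * y)" by (simp add: add_ac)
        then show ?thesis using nn[of "- c + (-1) * y"] by linarith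
      next
        case False
        then have "1 / (\<bar>y + c\<bar> + b)\<^sup>2 = ?h (- c + (-1) * y)" by (simp add: add_ac)
        then show ?thesis using nn[of "c + 1 * y"] by linarith
      qed
      then show "norm (1 / (\<bar>y + c\<bar> + b)\<^sup>2) \<le> norm (?h (c + 1 * y) + ?h (- c + (-1) * y))"
        by (simp only: real_norm_def abs_ge_zero)  (smt (verit) zero_le_divide_1_iff zero_le_power2)
    qed
  qed
qed

lemma integrable_inverse_power_shifted_abs:
  fixes b c :: real
  assumes b: "b > 0" and n: "n \<ge> 2"
  shows "integrable lborel (\<lambda>y. 1 / (\<bar>y + c\<bar> + b) ^ n)"
proof (rule Bochner_Integration.integrable_bound[OF integrable_mult_right[OF integrable_inverse_square_shifted_abs[OF b, of c], of "1 / b ^ (n - 2)"]])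
  show "AE y in lborel. norm (1 / (\<bar>y + c\<bar> + b) ^ n) \<le> norm (1 / b ^ (n - 2) * (1 / (\<bar>y + c\<bar> + b)\<^sup>2))"
  proof (rule AE_I2)
    fix y :: real
    define m where "m = \<bar>y + c\<bar> + b"
    have m: "m \<ge> b" "m > 0" using b by (auto simp: m_def)
    have "b ^ (n - 2) * m\<^sup>2 \<le> m ^ (n - 2) * m\<^sup>2" using m b by (intro mult_right_mono power_mono) auto
    also have "\<dots> = m ^ n" using n by (metis le_add_diff_inverse2 power_add)
    finally have "1 / m ^ n \<le> 1 / (b ^ (n - 2) * m\<^sup>2)" using m b by (intro frac_le) auto
    then show "norm (1 / (\<bar>y + c\<bar> + b) ^ n) \<le> norm (1 / b ^ (n - 2) * (1 / (\<bar>y + c\<bar> + b)\<^sup>2))"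
      using m b unfolding m_def[symmetric] by simp
  qed
qed measurable

text \<open>\<open>f\<close> is cut off by both indicators and treated on the whole plane. Absolute
  integrability is checked with the \<open>x\<close>-integral innermost, the one that has a closed
  form for the ray kernel.\<close>

lemma set_Fubini:
  fixes f :: "real \<Rightarrow> real \<Rightarrow> complex"
  assumes meas: "case_prod f \<in> borel_measurable (lborel \<Otimes>\<^sub>M lborel)"
    and A: "A \<in> sets borel" and B: "B \<in> sets borel"
    and i1: "\<And>y. y \<in> B \<Longrightarrow> set_integrable lborel A (\<lambda>x. f x y)"
    and i2: "set_integrable lborel B (\<lambda>y. LINT x:A|lborel. cmod (f x y))"
  shows "set_integrable lborel A (\<lambda>x. LINT y:B|lborel. f x y)"
    and "(LINT x:A|lborel. LINT y:B|lborel. f x y) = (LINT y:B|lborel. LINT x:A|lborel. f x y)"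
    and "set_integrable lborel B (\<lambda>y. LINT x:A|lborel. f x y)"
proof -
  define g where "g = (\<lambda>(y, x). indicat_real B y *\<^sub>R (indicat_real A x *\<^sub>R f x y))"
  have sw: "(\<lambda>(y, x). f x y) \<in> borel_measurable (lborel \<Otimes>\<^sub>M lborel)"
    using measurable_pair_swap[OF meas] by (simp add: split_beta')
  have gm: "g \<in> borel_measurable (lborel \<Otimes>\<^sub>M lborel)"
  proof -
    have [measurable]: "A \<in> sets lborel" "B \<in> sets lborel" using A B by auto
    have [measurable]: "(\<lambda>p. f (snd p) (fst p)) \<in> borel_measurable (lborel \<Otimes>\<^sub>M lborel)"
      using sw by (simp add: split_beta')
    show ?thesis unfolding g_def split_beta' by measurable
  qed
  have nx: "(\<integral>x. norm (g (y, x)) \<partial>lborel) = indicator B y *\<^sub>R (LINT x:A|lborel. cmod (f x y))" for y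
    by (auto simp: g_def set_lebesgue_integral_def indicator_def intro!: Bochner_Integration.integral_cong)
  have gint: "integrable (lborel \<Otimes>\<^sub>M lborel) g"
  proof (rule lborel_pair.Fubini_integrable[OF gm])
    show "integrable lborel (\<lambda>y. \<integral>x. norm (g (y, x)) \<partial>lborel)"
      unfolding nx using i2 by (simp add: set_integrable_def)
    show "AE y in lborel. integrable lborel (\<lambda>x. g (y, x))"
    proof (rule AE_I2)
      fix y show "integrable lborel (\<lambda>x. g (y, x))"
        using i1[of y] by (cases "y \<in> B") (auto simp: g_def set_integrable_def)
    qed
  qed
  have gi': "integrable (lborel \<Otimes>\<^sub>M lborel) (case_prod (\<lambda>y x. g (y, x)))" using gint by simp
  have e1: "(\<integral>y. g (y, x) \<partial>lborel) = indicator A x *\<^sub>R (LINT y:B|lborel. f x y)" for x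
    by (auto simp: g_def set_lebesgue_integral_def indicator_def intro!: Bochner_Integration.integral_cong)
  have e2: "(\<integral>x. g (y, x) \<partial>lborel) = indicator B y *\<^sub>R (LINT x:A|lborel. f x y)" for y
    by (auto simp: g_def set_lebesgue_integral_def indicator_def intro!: Bochner_Integration.integral_cong)
  from lborel_pair.integrable_snd[OF gi']
  show "set_integrable lborel A (\<lambda>x. LINT y:B|lborel. f x y)"
    unfolding e1 set_integrable_def .
  from lborel_pair.integrable_fst[OF gi']
  show "set_integrable lborel B (\<lambda>y. LINT x:A|lborel. f x y)"
    unfolding e2 set_integrable_def .
  from lborel_pair.Fubini_integral[OF gi']
  show "(LINT x:A|lborel. LINT y:B|lborel. f x y) = (LINT y:B|lborel. LINT x:A|lborel. f x y)"
    unfolding e1 e2 by (simp add: set_lebesgue_integral_def)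
qed

section \<open>Residues in the strip of width two pi\<close>

lemma contour_integral_linepath_same_Im:
  assumes "a < b"
  shows "contour_integral (linepath (Complex a c) (Complex b c)) f = integral {a..b} (\<lambda>x. f (Complex x c))"
proof -
  have "contour_integral (linepath (Complex a c) (Complex b c)) f =
         (Complex b c - Complex a c) * integral {0..1} (\<lambda>x. f (linepath (Complex a c) (Complex b c) x))"
    by (simp add: contour_integral_integral)
  also have "Complex b c - Complex a c = of_real (b - a)"
    by (simp add: complex_eq_iff)
  also have "(\<lambda>x. f (linepath (Complex a c) (Complex b c) x)) = (\<lambda>x. f (Complex (a + (b - a) * x) c))"
    by (simp add: linepath_def complex_eq_iff algebra_simps Complex_eq scaleR_conv_of_real)
  also have "integral {0..1} (\<lambda>x. f (Complex (a + (b - a) * x) c)) =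
      integral {0..(b - a) / (b - a)} (\<lambda>x. f (Complex (a + (b - a) * x) c))"
    using \<open>a < b\<close> by simp
  also have "{0..(b - a) / (b - a)} = (\<lambda>x. x / (b - a)) ` {0..b - a}"
    using \<open>a < b\<close> by simp
  also have "integral \<dots> (\<lambda>x. f (Complex (a + (b - a) * x) c)) =
             integral {a-a..b-a} (\<lambda>x. f (Complex (x + a) c)) / of_real (b - a)"
    using \<open>a < b\<close> by (subst integral_stretch_real) (auto simp: scaleR_conv_of_real add_ac)
  also have "\<dots> = integral {a..b} (\<lambda>x. f (Complex x c)) / of_real (b - a)"
    by (subst integral_shift_real_ivl) (rule refl)
  finally show ?thesis
    using \<open>a < b\<close> by simp
qed

text \<open>The denominator in \<open>b_neg\<close>, extended to complex arguments.\<close>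

definition phase :: "real \<Rightarrow> complex \<Rightarrow> complex" where
  "phase l t = of_real l * exp t + t - of_real l"

lemma DERIV_phase: "(phase l has_field_derivative of_real l * exp t + 1) (at t)"
  unfolding phase_def by (auto intro!: derivative_eq_intros)

lemma holomorphic_on_phase [holomorphic_intros]: "phase l holomorphic_on S"
  unfolding phase_def by (intro holomorphic_intros)

lemma continuous_on_phase: "continuous_on S (phase l)"
  by (intro holomorphic_on_imp_continuous_on holomorphic_intros)

text \<open>In the closed strip \<open>sin (Im t)\<close> has the sign of \<open>Im t\<close>, so
  the imaginary part \<open>l exp (Re t) sin (Im t) + Im t\<close> vanishes only on the real axis,
  where \<open>phase\<close> is strictly increasing. The boundary lines are included because the
  contour runs along them.\<close>

lemma phase_eq_real_iff:
  fixes l p u :: real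
  assumes l: "l > 0" and t: "\<bar>Im t\<bar> \<le> pi" and p: "phase l (of_real p) = of_real u"
  shows "phase l t = of_real u \<longleftrightarrow> t = of_real p"
proof
  assume *: "phase l t = of_real u"
  define y where "y = Im t"
  have im: "l * (exp (Re t) * sin y) + y = 0"
    using arg_cong[OF *, of Im] by (simp add: phase_def Im_exp y_def)
  have y0: "y = 0"
  proof (rule ccontr)
    assume "y \<noteq> 0"
    then consider "y > 0" | "y < 0" by linarith
    then show False
    proof cases
      case 1
      then have "sin y \<ge> 0" using t by (intro sin_ge_zero) (auto simp: y_def)
      then have "l * (exp (Re t) * sin y) \<ge> 0" using l by simp
      then show False using im 1 by linarith
    next
      case 2
      then have "sin (- y) \<ge> 0" using t by (intro sin_ge_zero) (auto simp: y_def)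
      then have "l * (exp (Re t) * sin (- y)) \<ge> 0" using l by (intro mult_nonneg_nonneg) auto
      then show False using im 2 by simp
    qed
  qed
  have r1: "l * exp (Re t) + Re t - l = u" using arg_cong[OF *, of Re] y0 by (simp add: phase_def Re_exp y_def)
  have r2: "l * exp p + p - l = u" using arg_cong[OF p, of Re] by (simp add: phase_def Re_exp)
  have "Re t = p"
  proof (rule ccontr)
    assume "Re t \<noteq> p"
    then consider "Re t < p" | "p < Re t" by linarith
    then show False
    proof cases
      case 1
      then have "l * exp (Re t) < l * exp p" using l by simp
      then show False using r1 r2 1 by linarith
    next
      case 2
      then have "l * exp p < l * exp (Re t)" using l by simp
      then show False using r1 r2 2 by linarith
    qed
  qed
  then show "t = of_real p" using y0 by (simp add: complex_eq_iff y_def)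
qed (use p in simp)

text \<open>The reciprocal divided difference of \<open>phase\<close> at \<open>p\<close>, with its
  removable singularity filled in. For \<open>p = 0\<close> it is the bracket in
  \<open>b_neg\<close> up to the factor \<open>l + 1\<close>, and its powers carry the residues of
  the powers of \<open>1 / (phase - u)\<close>.\<close>

definition phase_quotient :: "real \<Rightarrow> real \<Rightarrow> complex \<Rightarrow> complex" where
  "phase_quotient l p t = (if t = of_real p then 1 / (of_real l * exp (of_real p) + 1)
     else (t - of_real p) / (phase l t - phase l (of_real p)))"

lemma phase_deriv_nonzero:
  assumes "l > 0" shows "of_real l * exp (of_real p) + 1 \<noteq> (0::complex)"
proof -
  have "l * exp p + 1 > 0" using assms by (simp add: add_pos_pos)
  moreover have "of_real l * exp (of_real p) + 1 = complex_of_real (l * exp p + 1)" by (simp flip: exp_of_real)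
  ultimately show ?thesis by (metis less_irrefl of_real_eq_0_iff)
qed

lemma phase_quotient_tendsto:
  assumes "l > 0"
  shows "(phase_quotient l p \<longlongrightarrow> phase_quotient l p (of_real p)) (at (of_real p))"
proof -
  have "((\<lambda>t. (phase l t - phase l (of_real p)) / (t - of_real p)) \<longlongrightarrow> of_real l * exp (of_real p) + 1) (at (of_real p))"
    using DERIV_phase[of l "of_real p"] by (simp add: has_field_derivative_iff)
  from tendsto_inverse[OF this phase_deriv_nonzero[OF assms]]
  have "((\<lambda>t. (t - of_real p) / (phase l t - phase l (of_real p))) \<longlongrightarrow> phase_quotient l p (of_real p)) (at (of_real p))"
    by (simp add: phase_quotient_def inverse_eq_divide)
  moreover have "\<forall>\<^sub>F t in at (of_real p). (t - of_real p) / (phase l t - phase l (of_real p)) = phase_quotient l p t"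
    by (simp add: eventually_at_filter phase_quotient_def)
  ultimately show ?thesis by (rule Lim_transform_eventually)
qed

lemma phase_quotient_holomorphic:
  assumes "l > 0" "open S" and zero: "\<And>t. t \<in> S \<Longrightarrow> phase l t = phase l (of_real p) \<Longrightarrow> t = of_real p"
  shows "phase_quotient l p holomorphic_on S"
proof (rule no_isolated_singularity'[where K = "{of_real p}"])
  show "(phase_quotient l p \<longlongrightarrow> phase_quotient l p z) (at z within S)" if "z \<in> {of_real p}" for z
    using that phase_quotient_tendsto[OF assms(1)] by (auto intro: tendsto_within_subset)
  have "(\<lambda>t. (t - of_real p) / (phase l t - phase l (of_real p))) holomorphic_on S - {of_real p}"
    using zero by (intro holomorphic_intros) auto
  then show "phase_quotient l p holomorphic_on S - {of_real p}"
    by (rule holomorphic_transform) (auto simp: phase_quotient_def)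
qed (use assms in auto)

text \<open>The residue theorem needs an open set around the closed rectangle without further zeros,
  while the zeros are known only in the closed strip. A compactness argument separates the rectangle
  from any others.\<close>

lemma strip_neighbourhood:
  fixes l p u R :: real
  assumes l: "l > 0" and p: "phase l (of_real p) = of_real u" and R: "R \<ge> 0"
  obtains d where "d > 0"
    "\<And>t. t \<in> box (Complex (- R - d) (- pi - d)) (Complex (R + d) (pi + d)) \<Longrightarrow> phase l t = of_real u \<Longrightarrow> t = of_real p"
proof -
  define K where "K = cbox (Complex (- R) (- pi)) (Complex R pi)"
  \<comment> \<open>Restricting to \<open>|Im t| >= pi / 2\<close> removes the real zero
    \<open>p\<close> itself and keeps the set closed. A zero near the rectangle that is not in
    \<open>Z\<close> lies in the strip, hence equals \<open>p\<close>.\<close>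
  define Z where "Z = {t. phase l t = of_real u} \<inter> ({t. Im t \<ge> pi / 2} \<union> {t. Im t \<le> - (pi / 2)})"
  have "closed {t. phase l t = of_real u}"
    using continuous_closed_vimage[of "{of_real u}" "phase l"] continuous_on_phase[of UNIV l]
    by (auto simp: vimage_def continuous_on_eq_continuous_at)
  then have "closed Z" unfolding Z_def
    by (intro closed_Int closed_Un closed_halfspace_Im_ge closed_halfspace_Im_le)
  moreover have "K \<inter> Z = {}"
  proof -
    have "t \<notin> Z" if "t \<in> K" for t
    proof
      assume tZ: "t \<in> Z"
      have "\<bar>Im t\<bar> \<le> pi" using that by (auto simp: K_def in_cbox_complex_iff abs_le_iff)
      then have "t = of_real p" using phase_eq_real_iff[OF l _ p] tZ by (auto simp: Z_def)
      then have "Im t = 0" by simp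
      then show False using tZ pi_gt_zero by (simp add: Z_def)
    qed
    then show ?thesis by auto
  qed
  ultimately obtain \<delta> where \<delta>: "\<delta> > 0" "\<And>x y. x \<in> K \<Longrightarrow> y \<in> Z \<Longrightarrow> \<delta> \<le> dist x y"
    using separate_compact_closed[of K Z] by (auto simp: K_def)
  show ?thesis
  proof (rule that[of "\<delta> / 4"])
    fix t assume t: "t \<in> box (Complex (- R - \<delta>/4) (- pi - \<delta>/4)) (Complex (R + \<delta>/4) (pi + \<delta>/4))" "phase l t = of_real u"
    define s where "s = Complex (max (- R) (min R (Re t))) (max (- pi) (min pi (Im t)))"
    have "s \<in> K" using R by (auto simp: K_def s_def in_cbox_complex_iff)
    have clamp: "\<bar>max (- a) (min a x) - x\<bar> \<le> \<delta>/4" if "a \<ge> 0" "- a - \<delta>/4 < x" "x < a + \<delta>/4" for a x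
      using that \<delta>(1) by (simp add: max_def min_def abs_le_iff)
    have "\<bar>Re (s - t)\<bar> \<le> \<delta>/4" "\<bar>Im (s - t)\<bar> \<le> \<delta>/4"
    proof -
      have b: "- R - \<delta>/4 < Re t" "Re t < R + \<delta>/4" "- pi - \<delta>/4 < Im t" "Im t < pi + \<delta>/4"
        using t(1) by (auto simp: in_box_complex_iff)
      have "Re (s - t) = max (- R) (min R (Re t)) - Re t" "Im (s - t) = max (- pi) (min pi (Im t)) - Im t"
        by (simp_all only: s_def minus_complex.sel complex.sel)
      then show "\<bar>Re (s - t)\<bar> \<le> \<delta>/4" "\<bar>Im (s - t)\<bar> \<le> \<delta>/4"
        using clamp[OF R b(1,2)] clamp[OF pi_ge_zero b(3,4)] by (simp_all only:)
    qed
    then have "cmod (s - t) \<le> \<delta>/4 + \<delta>/4" using cmod_le[of "s - t"] by linarith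
    then have "dist s t < \<delta>" using \<delta>(1) by (simp add: dist_norm)
    then have "t \<notin> Z" using \<delta>(2)[OF \<open>s \<in> K\<close>] by force
    then have "\<bar>Im t\<bar> \<le> pi" using t(2) pi_gt_zero by (auto simp: Z_def abs_le_iff)
    then show "t = of_real p" using phase_eq_real_iff[OF l _ p] t(2) by auto
  qed (use \<delta> in auto)
qed

text \<open>The residue theorem on a rectangle around the only zero \<open>p\<close>. Writing the
  integrand as \<open>phase_quotient^(n + 1) / (t - p)^(n + 1)\<close> exposes the order of the
  pole, and the residue becomes an \<open>n\<close>-th derivative over \<open>n!\<close>.\<close>

lemma phase_rectangle_integral:
  fixes l p u R :: real and n :: nat
  assumes l: "l > 0" and p: "phase l (of_real p) = of_real u" and R: "R > \<bar>p\<bar>"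
  defines "F \<equiv> \<lambda>t. 1 / (phase l t - of_real u) ^ Suc n"
  shows "integral {-R..R} (\<lambda>x. F (Complex x (- pi))) - integral {-R..R} (\<lambda>x. F (Complex x pi))
      + contour_integral (linepath (Complex R (- pi)) (Complex R pi)) F
      - contour_integral (linepath (Complex (- R) (- pi)) (Complex (- R) pi)) F
    = 2 * of_real pi * \<i> * ((deriv ^^ n) (\<lambda>t. phase_quotient l p t ^ Suc n) (of_real p) / fact n)"
proof -
  obtain d where d: "d > 0"
    "\<And>t. t \<in> box (Complex (- R - d) (- pi - d)) (Complex (R + d) (pi + d)) \<Longrightarrow> phase l t = of_real u \<Longrightarrow> t = of_real p"
    using strip_neighbourhood[OF l p, of R] R by (metis abs_ge_zero less_eq_real_def order_trans)
  define S where "S = box (Complex (- R - d) (- pi - d)) (Complex (R + d) (pi + d))"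
  let ?a1 = "Complex (- R) (- pi)" and ?a3 = "Complex R pi"
  \<comment> \<open>\<open>G\<close> agrees with \<open>F\<close> except at \<open>p\<close>, which
    the contour avoids.\<close>
  define G where "G = (\<lambda>t. phase_quotient l p t ^ Suc n / (t - of_real p) ^ Suc n)"
  have S: "open S" "connected S" by (auto simp: S_def intro: convex_connected)
  have sub: "cbox ?a1 ?a3 \<subseteq> S" using d(1) by (auto simp: S_def in_cbox_complex_iff in_box_complex_iff)
  have pbox: "of_real p \<in> box ?a1 ?a3" using R pi_gt_zero by (auto simp: in_box_complex_iff)
  have pS: "of_real p \<in> S" using pbox sub box_subset_cbox by blast
  have holH: "phase_quotient l p holomorphic_on S"
    by (rule phase_quotient_holomorphic[OF l S(1)]) (use d(2) p in \<open>auto simp: S_def\<close>)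
  have FG: "G t = F t" if "t \<noteq> of_real p" for t
    using that by (simp add: G_def F_def phase_quotient_def p power_divide)
  have holG: "G holomorphic_on S - {of_real p}"
    unfolding G_def using holH by (intro holomorphic_intros) (auto intro: holomorphic_on_subset)
  have path: "path_image (rectpath ?a1 ?a3) \<subseteq> S - {of_real p}"
    using sub pbox by (auto simp: path_image_rectpath_cbox_minus_box R pi_gt_zero) (use R pi_gt_zero path_image_rectpath_cbox_minus_box[of ?a1 ?a3] in \<open>auto simp: in_box_complex_iff\<close>)
  have "contour_integral (rectpath ?a1 ?a3) G = 2 * pi * \<i> * (\<Sum>q\<in>{of_real p}. winding_number (rectpath ?a1 ?a3) q * residue G q)"
  proof (rule Residue_theorem[OF S])
    show "\<forall>z. z \<notin> S \<longrightarrow> winding_number (rectpath ?a1 ?a3) z = 0"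
      using sub R pi_gt_zero by (auto intro!: winding_number_rectpath_outside)
  qed (use holG path in auto)
  also have "\<dots> = 2 * pi * \<i> * residue G (of_real p)"
    using winding_number_rectpath[OF pbox] by simp
  also have "residue G (of_real p) = (deriv ^^ n) (\<lambda>t. phase_quotient l p t ^ Suc n) (of_real p) / fact n"
    unfolding G_def by (rule residue_holomorphic_over_power[OF S(1) pS]) (intro holomorphic_intros holH)
  finally have I: "contour_integral (rectpath ?a1 ?a3) G = 2 * pi * \<i> * ((deriv ^^ n) (\<lambda>t. phase_quotient l p t ^ Suc n) (of_real p) / fact n)" .
  let ?a2 = "Complex R (- pi)" and ?a4 = "Complex (- R) pi"
  let ?segs = "closed_segment ?a1 ?a2 \<union> closed_segment ?a2 ?a3 \<union> closed_segment ?a3 ?a4 \<union> closed_segment ?a4 ?a1"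
  have pi_seg: "path_image (rectpath ?a1 ?a3) = ?segs"
    by (simp add: rectpath_def Let_def path_image_join Un_assoc)
  have contG: "continuous_on ?segs G"
    using holomorphic_on_imp_continuous_on[OF holG] path unfolding pi_seg by (rule continuous_on_subset)
  have ci: "G contour_integrable_on linepath ?a1 ?a2" "G contour_integrable_on linepath ?a2 ?a3"
      "G contour_integrable_on linepath ?a3 ?a4" "G contour_integrable_on linepath ?a4 ?a1"
    by (rule contour_integrable_continuous_linepath, rule continuous_on_subset[OF contG], blast)+
  have "contour_integral (rectpath ?a1 ?a3) G = contour_integral (linepath ?a1 ?a2) G + (contour_integral (linepath ?a2 ?a3) G
      + (contour_integral (linepath ?a3 ?a4) G + contour_integral (linepath ?a4 ?a1) G))"
    unfolding rectpath_def Let_def using ci by (simp add: contour_integrable_joinI)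
  also have "contour_integral (linepath ?a3 ?a4) G = - contour_integral (linepath ?a4 ?a3) G"
    by (rule contour_integral_reverse_linepath, rule continuous_on_subset[OF contG]) auto
  also have "contour_integral (linepath ?a4 ?a1) G = - contour_integral (linepath ?a1 ?a4) G"
    by (rule contour_integral_reverse_linepath, rule continuous_on_subset[OF contG]) auto
  also have "contour_integral (linepath ?a1 ?a2) G = integral {-R..R} (\<lambda>x. G (Complex x (- pi)))"
    by (rule contour_integral_linepath_same_Im) (use R in auto)
  also have "\<dots> = integral {-R..R} (\<lambda>x. F (Complex x (- pi)))"
    by (rule Henstock_Kurzweil_Integration.integral_cong, rule FG) (auto simp: complex_eq_iff)
  also have "contour_integral (linepath ?a4 ?a3) G = integral {-R..R} (\<lambda>x. G (Complex x pi))"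
    by (rule contour_integral_linepath_same_Im) (use R in auto)
  also have "\<dots> = integral {-R..R} (\<lambda>x. F (Complex x pi))"
    by (rule Henstock_Kurzweil_Integration.integral_cong, rule FG) (auto simp: complex_eq_iff)
  also have "contour_integral (linepath ?a2 ?a3) G = contour_integral (linepath ?a2 ?a3) F"
    by (rule contour_integral_eq, rule FG) (use path pi_seg in auto)
  also have "contour_integral (linepath ?a1 ?a4) G = contour_integral (linepath ?a1 ?a4) F"
    by (rule contour_integral_eq, rule FG) (use path pi_seg in \<open>auto simp: closed_segment_commute\<close>)
  finally show ?thesis unfolding I by (simp add: algebra_simps)
qed

section \<open>Estimates on the edges of the strip and the limit of wide rectangles\<close>

lemma exp_minus_self_ge_abs: "\<bar>v\<bar> \<le> exp v - (v::real)"
proof (cases "v \<ge> 0")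
  case True
  have "1 + v + v\<^sup>2 / 2 \<le> exp v" by (rule exp_lower_Taylor_quadratic[OF True])
  moreover have "0 \<le> (v - 1)\<^sup>2" by simp
  ultimately show ?thesis using True by (simp add: power2_eq_square algebra_simps)
qed simp

lemma phase_upper_line: "phase l (Complex y pi) = of_real (y - l - l * exp y) + \<i> * of_real pi"
  by (simp add: phase_def complex_eq_iff Re_exp Im_exp)

lemma phase_lower_line: "phase l (Complex y (- pi)) = cnj (phase l (Complex y pi))"
  by (simp add: phase_def complex_eq_iff Re_exp Im_exp)

text \<open>With \<open>v = y + ln l\<close> the right side is
  \<open>u + (exp v - v) + l + ln l\<close>. This is the source of the hypothesis
  \<open>l + ln l > 0\<close>: it keeps the real part of \<open>phase - u\<close> away from zero on
  the upper line.\<close>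

lemma real_phase_upper_line_ge:
  fixes l u y :: real
  assumes "l > 0" "u \<ge> 0"
  shows "\<bar>y + ln l\<bar> + (l + ln l) \<le> u + l + l * exp y - y"
proof -
  have "l * exp y = exp (y + ln l)" using assms by (simp add: exp_add)
  then show ?thesis using exp_minus_self_ge_abs[of "y + ln l"] assms by linarith
qed

lemma cmod_phase_upper_line_ge:
  assumes "l > 0" "u \<ge> 0"
  shows "\<bar>y + ln l\<bar> + (l + ln l) \<le> cmod (phase l (Complex y pi) - of_real u)"
proof -
  have "u + l + l * exp y - y = - Re (phase l (Complex y pi) - of_real u)"
    by (simp add: phase_upper_line)
  also have "\<dots> \<le> cmod (phase l (Complex y pi) - of_real u)"
    using abs_Re_le_cmod[of "phase l (Complex y pi) - of_real u"] by linarith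
  finally show ?thesis using real_phase_upper_line_ge[OF assms, of y] by linarith
qed

lemma phase_upper_line_nonzero: "phase l (Complex y pi) - of_real u \<noteq> 0"
  by (simp add: phase_upper_line complex_eq_iff)

lemma integrable_phase_upper_line:
  assumes l: "l > 0" "l + ln l > 0" and u: "u \<ge> 0" and n: "n \<ge> 1"
  shows "integrable lborel (\<lambda>y. 1 / (phase l (Complex y pi) - of_real u) ^ Suc n)"
proof (rule Bochner_Integration.integrable_bound[OF integrable_inverse_power_shifted_abs[OF l(2), of "Suc n" "ln l"]])
  have "continuous_on UNIV (\<lambda>y. 1 / (phase l (Complex y pi) - of_real u) ^ Suc n)"
    using phase_upper_line_nonzero[of l _ u] by (auto simp: phase_upper_line intro!: continuous_intros)
  then show "(\<lambda>y. 1 / (phase l (Complex y pi) - of_real u) ^ Suc n) \<in> borel_measurable lborel"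
    using borel_measurable_continuous_onI by simp
  show "AE y in lborel. norm (1 / (phase l (Complex y pi) - of_real u) ^ Suc n) \<le> norm (1 / (\<bar>y + ln l\<bar> + (l + ln l)) ^ Suc n)"
  proof (rule AE_I2)
    fix y
    define m where "m = \<bar>y + ln l\<bar> + (l + ln l)"
    have m: "m > 0" "m \<le> cmod (phase l (Complex y pi) - of_real u)"
      using l cmod_phase_upper_line_ge[OF l(1) u, of y] by (auto simp: m_def)
    then have "m ^ Suc n \<le> cmod (phase l (Complex y pi) - of_real u) ^ Suc n" by (intro power_mono) auto
    then have "1 / cmod (phase l (Complex y pi) - of_real u) ^ Suc n \<le> 1 / m ^ Suc n" using m by (intro frac_le) auto
    then show "norm (1 / (phase l (Complex y pi) - of_real u) ^ Suc n) \<le> norm (1 / (\<bar>y + ln l\<bar> + (l + ln l)) ^ Suc n)"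
      using m unfolding m_def[symmetric] norm_divide norm_power by simp
  qed
qed (use n in auto)

text \<open>On the right edge \<open>l exp R >= l R^2 / 2 >= 4 R\<close>, using
  \<open>R >= 8 / l\<close>, and the other terms take away at most
  \<open>R + (pi + l + u) <= 3 R\<close>. On the left edge the real part is at most
  \<open>- R\<close>.\<close>

lemma cmod_phase_vertical_ge:
  assumes l: "l > 0" and u: "u \<ge> 0" and t: "\<bar>Im t\<bar> \<le> pi"
    and R: "R \<ge> 0" "R \<ge> 8 / l" "R \<ge> (pi + l + u) / 2" and Re: "Re t = R \<or> Re t = - R"
  shows "R \<le> cmod (phase l t - of_real u)"
  using Re
proof
  assume Rt: "Re t = R"
  have ct: "cmod t \<le> R + pi" using cmod_le[of t] Rt R t by linarith
  have "l * (R * R / 2) \<ge> l * (8 / l * R / 2)" using R l by (intro mult_left_mono divide_right_mono mult_right_mono) auto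
  then have 1: "l * (R\<^sup>2 / 2) \<ge> 4 * R" using l by (simp add: power2_eq_square)
  have "1 + R + R\<^sup>2 / 2 \<le> exp R" by (rule exp_lower_Taylor_quadratic[OF R(1)])
  then have "R\<^sup>2 / 2 \<le> exp R" using R by linarith
  then have "l * (R\<^sup>2 / 2) \<le> l * exp R" using l by (intro mult_left_mono) auto
  then have 2: "4 * R \<le> l * exp R" using 1 by linarith
  have "of_real l * exp t = (phase l t - of_real u) + (- t + of_real (l + u))"
    by (simp add: phase_def)
  then have "cmod (of_real l * exp t) \<le> cmod (phase l t - of_real u) + cmod (- t + of_real (l + u))"
    by (metis norm_triangle_ineq)
  moreover have "cmod (- t + of_real (l + u)) \<le> cmod t + (l + u)"
    using norm_triangle_ineq[of "- t" "of_real (l + u)"] l u by (simp del: of_real_add)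
  moreover have "cmod (of_real l * exp t) = l * exp R" using l Rt by (simp add: norm_mult)
  ultimately show ?thesis using ct 2 R(3) by simp
next
  assume Rt: "Re t = - R"
  have "exp (- R) * cos (Im t) \<le> exp (- R) * 1" by (intro mult_left_mono) auto
  also have "\<dots> \<le> 1" using R by simp
  finally have "l * (exp (- R) * cos (Im t)) \<le> l * 1" using l by (intro mult_left_mono) auto
  moreover have "Re (phase l t - of_real u) = l * (exp (- R) * cos (Im t)) - R - l - u"
    by (simp add: phase_def Re_exp Rt)
  ultimately have "Re (phase l t - of_real u) \<le> - R" using u by linarith
  then show ?thesis using abs_Re_le_cmod[of "phase l t - of_real u"] by linarith
qed

lemma tendsto_integral_symmetric_interval:
  fixes f :: "real \<Rightarrow> complex"
  assumes "integrable lborel f"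
  shows "(\<lambda>k. integral {- real k..real k} f) \<longlonglongrightarrow> (\<integral>x. f x \<partial>lborel)"
proof -
  have U: "(\<Union>k. {- real k..real k}) = UNIV"
  proof (intro equalityI subsetI)
    fix x :: real
    obtain k where "\<bar>x\<bar> \<le> real k" using real_arch_simple by blast
    then show "x \<in> (\<Union>k. {- real k..real k})" by (auto simp: abs_le_iff intro!: exI[of _ k])
  qed auto
  have i: "set_integrable lborel A f" if "A \<in> sets borel" for A
    using assms that by (auto simp: set_integrable_def intro: integrable_mult_indicator)
  have "(\<lambda>k. LINT x:{- real k..real k}|lborel. f x) \<longlonglongrightarrow> (LINT x:(\<Union>k. {- real k..real k})|lborel. f x)"
    by (rule set_integral_cont_up) (use i in \<open>auto simp: incseq_def U\<close>)
  moreover have "(LINT x:{- real k..real k}|lborel. f x) = integral {- real k..real k} f" for k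
    by (rule set_borel_integral_eq_integral(2)[OF i]) simp
  ultimately show ?thesis by (simp add: U set_lebesgue_integral_def)
qed

text \<open>The lower line carries the conjugate values, so the horizontal sides tend to
  \<open>cnj I - I\<close>. The vertical sides have fixed length \<open>2 pi\<close>, while the
  integrand on them is at most \<open>R^(- n - 1)\<close>. With \<open>n >= 1\<close> the horizontal
  integrals converge absolutely.\<close>

theorem phase_strip_integral:
  fixes l p u :: real
  assumes l: "l > 0" "l + ln l > 0" and u: "u \<ge> 0" and p: "phase l (of_real p) = of_real u" and n: "n \<ge> 1"
  defines "I \<equiv> (\<integral>y. 1 / (phase l (Complex y pi) - of_real u) ^ Suc n \<partial>lborel)"
  shows "cnj I - I = 2 * of_real pi * \<i> * ((deriv ^^ n) (\<lambda>t. phase_quotient l p t ^ Suc n) (of_real p) / fact n)"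
proof -
  define F where "F = (\<lambda>t. 1 / (phase l t - of_real u) ^ Suc n)"
  define RV where "RV = 2 * of_real pi * \<i> * ((deriv ^^ n) (\<lambda>t. phase_quotient l p t ^ Suc n) (of_real p) / fact n)"
  define B where "B = (\<lambda>R. contour_integral (linepath (Complex R (- pi)) (Complex R pi)) F)"
  have iu: "integrable lborel (\<lambda>y. F (Complex y pi))"
    unfolding F_def by (rule integrable_phase_upper_line[OF l u n])
  have lc: "F (Complex y (- pi)) = cnj (F (Complex y pi))" for y
    by (simp add: F_def phase_lower_line)
  have il: "integrable lborel (\<lambda>y. F (Complex y (- pi)))"
    unfolding lc using iu by simp
  have II: "(\<integral>y. F (Complex y pi) \<partial>lborel) = I" unfolding I_def F_def ..
  have cI: "(\<integral>y. F (Complex y (- pi)) \<partial>lborel) = cnj I"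
  proof -
    have "(\<integral>y. F (Complex y (- pi)) \<partial>lborel) = (\<integral>y. cnj (F (Complex y pi)) \<partial>lborel)" by (simp only: lc)
    also have "\<dots> = cnj (\<integral>y. F (Complex y pi) \<partial>lborel)" by (rule integral_bounded_linear[OF bounded_linear_cnj iu])
    finally show ?thesis by (simp only: I_def F_def)
  qed
  have Bb: "cmod (B R') \<le> 1 / R ^ Suc n * (2 * pi)"
    if R: "R > 0" "R \<ge> 8 / l" "R \<ge> (pi + l + u) / 2" and R': "R' = R \<or> R' = - R" for R R'
  proof -
    have ge: "R \<le> cmod (phase l t - of_real u)" if tseg: "t \<in> closed_segment (Complex R' (- pi)) (Complex R' pi)" for t
    proof (rule cmod_phase_vertical_ge[OF l(1) u _ _ R(2,3)])
      have "Re t = R' \<and> Im t \<in> {- pi..pi}"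
      proof -
        obtain s where s: "0 \<le> s" "s \<le> 1" "t = (1 - s) *\<^sub>R Complex R' (- pi) + s *\<^sub>R Complex R' pi"
          using tseg unfolding in_segment by blast
        have "Im t = (2 * s - 1) * pi" unfolding s(3) by (simp add: algebra_simps)
        moreover have "(2 * s - 1) * pi \<le> 1 * pi" "(- 1) * pi \<le> (2 * s - 1) * pi"
          using s by (intro mult_right_mono; simp)+
        moreover have "Re t = R'" unfolding s(3) by (simp add: algebra_simps)
        ultimately show ?thesis by simp
      qed
      then show "\<bar>Im t\<bar> \<le> pi" "Re t = R \<or> Re t = - R" using R' by auto
    qed (use R in auto)
    have cont: "continuous_on (closed_segment (Complex R' (- pi)) (Complex R' pi)) F"
      unfolding F_def using ge R(1) by (intro continuous_intros continuous_on_phase) fastforce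
    have "cmod (B R') \<le> 1 / R ^ Suc n * norm (Complex R' pi - Complex R' (- pi))"
      unfolding B_def
    proof (rule contour_integral_bound_linepath)
      show "F contour_integrable_on linepath (Complex R' (- pi)) (Complex R' pi)"
        by (rule contour_integrable_continuous_linepath[OF cont])
      fix t assume "t \<in> closed_segment (Complex R' (- pi)) (Complex R' pi)"
      then have "R ^ Suc n \<le> cmod (phase l t - of_real u) ^ Suc n" using ge R by (intro power_mono) auto
      then show "cmod (F t) \<le> 1 / R ^ Suc n"
        unfolding F_def norm_divide norm_power using R(1) by (simp add: frac_le del: power_Suc)
    qed (use R in auto)
    also have "norm (Complex R' pi - Complex R' (- pi)) = 2 * pi"
      by (simp add: cmod_def real_sqrt_mult)
    finally show ?thesis .
  qed
  have "\<forall>\<^sub>F k in sequentially. real k \<ge> max 1 (max (8 / l) (max ((pi + l + u) / 2) (\<bar>p\<bar> + 1)))"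
    by (rule eventually_compose_filterlim[OF eventually_ge_at_top filterlim_real_sequentially])
  then have ev: "\<forall>\<^sub>F k in sequentially. real k \<ge> 1 \<and> real k \<ge> 8 / l \<and> real k \<ge> (pi + l + u) / 2 \<and> real k > \<bar>p\<bar>"
    by eventually_elim auto
  have lim0: "(\<lambda>k. 1 / real k ^ Suc n * (2 * pi)) \<longlonglongrightarrow> 0"
  proof -
    have "(\<lambda>k. inverse (real k) ^ Suc n * (2 * pi)) \<longlonglongrightarrow> 0 ^ Suc n * (2 * pi)"
      by (intro tendsto_intros lim_inverse_n)
    moreover have "1 / real k ^ Suc n = inverse (real k) ^ Suc n" for k
      by (simp only: power_one_over inverse_eq_divide)
    ultimately show ?thesis by (simp only: power_0_Suc mult_zero_left)
  qed
  have "\<forall>\<^sub>F k in sequentially. norm (B (real k)) \<le> 1 / real k ^ Suc n * (2 * pi)"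
    using ev by eventually_elim (rule Bb; simp)
  then have B1: "(\<lambda>k. B (real k)) \<longlonglongrightarrow> 0" by (rule Lim_null_comparison[OF _ lim0])
  have "\<forall>\<^sub>F k in sequentially. norm (B (- real k)) \<le> 1 / real k ^ Suc n * (2 * pi)"
    using ev by eventually_elim (rule Bb; simp)
  then have B2: "(\<lambda>k. B (- real k)) \<longlonglongrightarrow> 0" by (rule Lim_null_comparison[OF _ lim0])
  have "(\<lambda>k. integral {- real k..real k} (\<lambda>x. F (Complex x (- pi))) - integral {- real k..real k} (\<lambda>x. F (Complex x pi)) + B (real k) - B (- real k))
      \<longlonglongrightarrow> cnj I - I + 0 - 0"
    using tendsto_integral_symmetric_interval[OF il, unfolded cI] tendsto_integral_symmetric_interval[OF iu, unfolded II]
    by (intro tendsto_diff tendsto_add B1 B2)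
  moreover have "\<forall>\<^sub>F k in sequentially. integral {- real k..real k} (\<lambda>x. F (Complex x (- pi))) - integral {- real k..real k} (\<lambda>x. F (Complex x pi)) + B (real k) - B (- real k) = RV"
    using ev
  proof eventually_elim
    case (elim k)
    then have "real k > \<bar>p\<bar>" by blast
    from phase_rectangle_integral[OF l(1) p this, of n] show ?case unfolding F_def B_def RV_def .
  qed
  then have "(\<lambda>k. integral {- real k..real k} (\<lambda>x. F (Complex x (- pi))) - integral {- real k..real k} (\<lambda>x. F (Complex x pi)) + B (real k) - B (- real k))
      \<longlonglongrightarrow> RV"
    by (rule tendsto_eventually)
  ultimately show ?thesis unfolding RV_def using LIMSEQ_unique by fastforce
qed

section \<open>The integral along a ray\<close>

lemma exp_neg_le_inverse_square:
  fixes c m :: real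
  assumes "c > 0" "m > 0"
  shows "exp (- (c * m)) \<le> 2 / c\<^sup>2 * (1 / m\<^sup>2)"
proof -
  have "1 + c * m + (c * m)\<^sup>2 / 2 \<le> exp (c * m)" by (rule exp_lower_Taylor_quadratic) (use assms in auto)
  then have "(c * m)\<^sup>2 / 2 \<le> exp (c * m)" using mult_pos_pos[OF assms] by linarith
  then have "1 / exp (c * m) \<le> 1 / ((c * m)\<^sup>2 / 2)" using assms by (intro frac_le) auto
  then show ?thesis using assms by (simp add: exp_minus inverse_eq_divide power_mult_distrib)
qed

lemma double_exponential_le:
  fixes l c y :: real
  assumes "l > 0" "c > 0"
  shows "exp (c * (y - l * exp y)) \<le> exp (c - c * ln l) * (2 / c\<^sup>2) * (1 / (\<bar>y + ln l\<bar> + 1)\<^sup>2)"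
proof -
  have "exp (y + ln l) = l * exp y" using assms by (simp add: exp_add)
  then have "y - l * exp y \<le> - \<bar>y + ln l\<bar> - ln l" using exp_minus_self_ge_abs[of "y + ln l"] by linarith
  then have "c * (y - l * exp y) \<le> c * (- \<bar>y + ln l\<bar> - ln l)" using assms by (intro mult_left_mono) auto
  also have "\<dots> = (c - c * ln l) + - (c * (\<bar>y + ln l\<bar> + 1))" by (simp add: algebra_simps)
  finally have "exp (c * (y - l * exp y)) \<le> exp ((c - c * ln l) + - (c * (\<bar>y + ln l\<bar> + 1)))" by simp
  also have "\<dots> = exp (c - c * ln l) * exp (- (c * (\<bar>y + ln l\<bar> + 1)))" by (rule exp_add)
  also have "\<dots> \<le> exp (c - c * ln l) * (2 / c\<^sup>2 * (1 / (\<bar>y + ln l\<bar> + 1)\<^sup>2))"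
    using assms by (intro mult_left_mono exp_neg_le_inverse_square) auto
  finally show ?thesis by (simp only: mult.assoc)
qed

lemma integrable_double_exponential:
  fixes l c :: real
  assumes "l > 0" "c > 0"
  shows "integrable lborel (\<lambda>y. exp (c * (y - l * exp y)))"
proof (rule Bochner_Integration.integrable_bound)
  show "integrable lborel (\<lambda>y. exp (c - c * ln l) * (2 / c\<^sup>2) * (1 / (\<bar>y + ln l\<bar> + 1)\<^sup>2))"
    by (intro integrable_mult_right integrable_inverse_square_shifted_abs) simp
  show "(\<lambda>y. exp (c * (y - l * exp y))) \<in> borel_measurable lborel" by measurable
  show "AE y in lborel. norm (exp (c * (y - l * exp y))) \<le> norm (exp (c - c * ln l) * (2 / c\<^sup>2) * (1 / (\<bar>y + ln l\<bar> + 1)\<^sup>2))"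
    by (rule AE_I2) (use double_exponential_le[OF assms] in \<open>auto intro: order_trans[OF _ abs_ge_self]\<close>)
qed

text \<open>Euler's integral under the substitution \<open>s = l x exp y\<close>, for which
  \<open>ds = s dy\<close>.\<close>

lemma Gamma_double_exponential_real:
  fixes l x :: real
  assumes l: "l > 0" and x: "x > 0"
  shows "(\<integral>y. exp (x * (y - l * exp y)) \<partial>lborel) = Gamma x * (l * x) powr (- x)"
proof -
  define f where "f = (\<lambda>s. s powr (x - 1) / exp s)"
  define g where "g = (\<lambda>y. l * x * exp y)"
  have lx: "l * x > 0" using assms by simp
  have fg: "f (g y) * g y = (l * x) powr x * exp (x * (y - l * exp y))" for y
  proof -
    have "f (g y) * g y = g y powr x / exp (g y)" using lx by (simp add: f_def g_def powr_diff)
    also have "\<dots> = (l * x) powr x * (exp (x * y) / exp (l * x * exp y))"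
      using lx by (simp add: g_def powr_mult powr_def[of "exp y"])
    also have "exp (x * y) / exp (l * x * exp y) = exp (x * (y - l * exp y))"
      by (simp add: exp_diff[symmetric] algebra_simps)
    finally show ?thesis .
  qed
  have intfg: "set_integrable lborel (einterval (- \<infinity>) \<infinity>) (\<lambda>y. f (g y) * g y)"
    unfolding fg using integrable_double_exponential[OF assms] by (simp add: set_integrable_def)
  have d: "DERIV g y :> g y" for y using DERIV_cmult[OF DERIV_exp, of "l * x" y] by (simp add: g_def[abs_def])
  have cf: "isCont f (g y)" for y
    using lx unfolding f_def g_def by (intro continuous_intros) auto
  have cg: "isCont g y" for y unfolding g_def by (intro continuous_intros)
  have "(g \<longlongrightarrow> l * x * 0) at_bot" unfolding g_def by (intro tendsto_intros exp_at_bot)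
  then have A: "((ereal \<circ> g \<circ> real_of_ereal) \<longlongrightarrow> 0) (at_right (- \<infinity>))"
    by (simp add: ereal_tendsto_simps zero_ereal_def)
  have "filterlim g at_top at_top" unfolding g_def
    by (rule filterlim_tendsto_pos_mult_at_top[OF tendsto_const lx exp_at_top])
  then have B: "((ereal \<circ> g \<circ> real_of_ereal) \<longlongrightarrow> \<infinity>) (at_left \<infinity>)"
    by (simp add: ereal_tendsto_simps)
  have g0: "0 \<le> g y" for y using lx by (simp add: g_def)
  have f0: "0 \<le> f s" for s by (simp add: f_def)
  note sub = interval_integral_substitution_nonneg[where f = f and g = g and g' = g, OF _ d cf cg f0 g0 A B intfg]
  have "set_integrable lborel (einterval 0 \<infinity>) f \<and> (LBINT s=0..\<infinity>. f s) = (LBINT y=-\<infinity>..\<infinity>. f (g y) * g y)"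
    using sub by simp
  moreover have e0: "einterval 0 \<infinity> = {0::real<..}" by (auto simp: einterval_def)
  ultimately have fi: "set_integrable lborel {0<..} f" and eq: "(LBINT s=0..\<infinity>. f s) = (LBINT y=-\<infinity>..\<infinity>. f (g y) * g y)"
    by auto
  have "(f has_integral Gamma x) {0..}" using Gamma_integral_real[OF x] by (simp add: f_def)
  then have "(f has_integral Gamma x) {0<..}"
    by (subst (asm) has_integral_spike_set_eq[of "{0..}" "{0<..}"]) (auto intro: negligible_subset[of "{0}"])
  then have "(LINT s:{0<..}|lborel. f s) = Gamma x"
    using set_borel_integral_eq_integral(2)[OF fi] by (simp add: integral_unique)
  moreover have "(LBINT s=0..\<infinity>. f s) = (LINT s:{0<..}|lborel. f s)"
    by (simp add: interval_lebesgue_integral_def e0)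
  moreover have "(LBINT y=-\<infinity>..\<infinity>. f (g y) * g y) = (l * x) powr x * (\<integral>y. exp (x * (y - l * exp y)) \<partial>lborel)"
    unfolding fg by (simp add: interval_lebesgue_integral_def set_lebesgue_integral_def)
  ultimately have "Gamma x = (l * x) powr x * (\<integral>y. exp (x * (y - l * exp y)) \<partial>lborel)" using eq by simp
  moreover have "(l * x) powr x * (l * x) powr (- x) = 1" using assms by (simp flip: powr_add)
  ultimately show ?thesis by simp
qed

lemma one_islimpt_positive_reals: "(1::complex) islimpt (of_real ` {0<..})"
  unfolding islimpt_approachable
proof (intro allI impI)
  fix e :: real assume "e > 0"
  show "\<exists>x'\<in>of_real ` {0<..}. x' \<noteq> (1::complex) \<and> dist x' 1 < e"
  proof (intro bexI conjI)
    show "complex_of_real (1 + e/2) \<in> of_real ` {0<..}" using \<open>e > 0\<close> by (intro imageI) simp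
  qed (use \<open>e > 0\<close> in \<open>auto simp: dist_norm\<close>)
qed

text \<open>Analytic continuation from positive \<open>x\<close> to the right half-plane, as the
  argument will be a point \<open>t * w\<close> of the ray.\<close>

lemma Gamma_double_exponential:
  fixes l :: real and x :: complex
  assumes l: "l > 0" and x: "Re x > 0"
  shows "(\<integral>y. exp (x * of_real (y - l * exp y)) \<partial>lborel) = Gamma x * (of_real l * x) powr (- x)"
proof -
  define S where "S = {x. Re x > 0}"
  define d where "d = (\<lambda>x::complex. (\<integral>y. exp (x * of_real (y - l * exp y)) \<partial>lborel) - Gamma x * (of_real l * x) powr (- x))"
  have "(\<lambda>x. \<integral>y. exp (x * of_real (y - l * exp y)) \<partial>lborel) holomorphic_on S"
  proof (rule holomorphic_on_lebesgue_integral)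
    show "(\<lambda>x. exp (x * of_real (y - l * exp y))) holomorphic_on S" for y by (intro holomorphic_intros)
    have "continuous_on UNIV (\<lambda>y::real. exp (x * of_real (y - l * exp y)))" for x :: complex
      by (intro continuous_intros)
    then show "(\<lambda>y. exp (x * of_real (y - l * exp y))) \<in> borel_measurable lborel" for x :: complex
      using borel_measurable_continuous_onI by simp
    fix a assume "a \<in> S"
    define r where "r = Re a / 2"
    have r: "r > 0" using \<open>a \<in> S\<close> by (simp add: r_def S_def)
    have ball: "r \<le> Re z \<and> Re z \<le> 3 * r" if "z \<in> cball a r" for z
      using that abs_Re_le_cmod[of "a - z"] by (simp add: dist_norm r_def abs_le_iff)
    show "\<exists>r>0. \<exists>g. cball a r \<subseteq> S \<and> integrable lborel g \<and> (\<forall>z\<in>cball a r. \<forall>y\<in>space lborel. cmod (exp (z * of_real (y - l * exp y))) \<le> g y)"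
    proof (intro exI[of _ r] conjI exI[of _ "\<lambda>y. exp (r * (y - l * exp y)) + exp (3 * r * (y - l * exp y))"] ballI)
      show "cball a r \<subseteq> S" using ball r by (auto simp: S_def) (smt (verit))
      show "integrable lborel (\<lambda>y. exp (r * (y - l * exp y)) + exp (3 * r * (y - l * exp y)))"
        by (intro Bochner_Integration.integrable_add integrable_double_exponential l) (use r in auto)
      fix z y assume z: "z \<in> cball a r"
      define s where "s = y - l * exp y"
      \<comment> \<open>As \<open>s\<close> may have either sign, the exponential at
        \<open>Re z\<close> between \<open>r\<close> and \<open>3 r\<close> is bounded by the sum of
        its values at the two ends.\<close>
      have "Re z * s \<le> r * s \<or> Re z * s \<le> 3 * r * s"
        using ball[OF z] by (cases "s \<ge> 0") (auto intro: mult_right_mono mult_right_mono_neg)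
      then have "exp (Re z * s) \<le> exp (r * s) + exp (3 * r * s)"
        by (smt (verit) exp_gt_zero exp_le_cancel_iff)
      then show "cmod (exp (z * of_real (y - l * exp y))) \<le> exp (r * (y - l * exp y)) + exp (3 * r * (y - l * exp y))"
        unfolding s_def[symmetric] by simp
    qed (use r in auto)
  qed
  moreover have "(\<lambda>x. Gamma x * (of_real l * x) powr (- x)) holomorphic_on S"
    using l by (intro holomorphic_intros) (auto simp: S_def complex_nonpos_Reals_iff mult_le_0_iff elim!: nonpos_Ints_cases)
  ultimately have hol: "d holomorphic_on S" unfolding d_def by (rule holomorphic_on_diff)
  have "d x = 0"
  proof (rule analytic_continuation[OF hol])
    show "open S" unfolding S_def by (rule open_halfspace_Re_gt)
    show "connected S" unfolding S_def by (rule convex_connected[OF convex_halfspace_Re_gt])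
    show "complex_of_real ` {0<..} \<subseteq> S" by (auto simp: S_def)
    show "1 \<in> S" by (simp add: S_def)
    show "x \<in> S" using x by (simp add: S_def)
    show "d z = 0" if zpos: "z \<in> of_real ` {0<..}" for z
    proof -
      obtain t where t: "t > 0" "z = of_real t" using zpos by auto
      have "(\<integral>y. exp (z * of_real (y - l * exp y)) \<partial>lborel) = (\<integral>y. complex_of_real (exp (t * (y - l * exp y))) \<partial>lborel)"
        by (rule Bochner_Integration.integral_cong) (auto simp: t(2) simp flip: exp_of_real)
      also have "\<dots> = of_real (\<integral>y. exp (t * (y - l * exp y)) \<partial>lborel)" by (rule integral_complex_of_real)
      also have "\<dots> = of_real (Gamma t * (l * t) powr (- t))" using Gamma_double_exponential_real[OF l t(1)] by simp
      also have "\<dots> = Gamma z * (of_real l * z) powr (- z)"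
        using l t by (simp add: Gamma_complex_of_real powr_of_real[symmetric])
      finally show ?thesis by (simp add: d_def)
    qed
  qed (rule one_islimpt_positive_reals)
  then show ?thesis by (simp add: d_def)
qed

lemma set_integral_power_exp:
  fixes c :: real
  assumes "c > 0"
  shows "(LINT t:{0<..}|lborel. t ^ n * exp (- (t * c))) = fact n / c ^ Suc n"
proof -
  have "complex_of_real (LINT t:{0<..}|lborel. t ^ n * exp (- (t * c))) = (LINT t:{0<..}|lborel. complex_of_real (t ^ n * exp (- (t * c))))"
    by (rule set_integral_complex_of_real[symmetric])
  also have "\<dots> = (LINT t:{0<..}|lborel. of_real t ^ n * exp (- (of_real t * of_real c)))"
    by (simp flip: exp_of_real)
  also have "\<dots> = complex_of_real (fact n / c ^ Suc n)"
    using set_integral_power_cexp[of "of_real c" n] assms by simp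
  finally show ?thesis by (simp only: of_real_eq_iff)
qed

text \<open>For \<open>Re x > 0\<close> this is the integral of
  \<open>exp (x * phase l (y + i pi))\<close> over real \<open>y\<close>, in the closed form
  supplied by \<open>Gamma_double_exponential\<close>.\<close>

definition ray_kernel :: "real \<Rightarrow> complex \<Rightarrow> complex" where
  "ray_kernel l x = exp (- x * (of_real l - \<i> * of_real pi)) * (Gamma x * (of_real l * x) powr (- x))"

text \<open>Each \<open>1 / (phase - u)^(n + 1)\<close> is a Laplace integral in the direction
  \<open>w\<close>, and the two integrations are interchanged. As \<open>Q = u - phase\<close> has
  imaginary part \<open>- pi\<close>, the condition \<open>Im w >= 0\<close> only increases
  \<open>Re (w * Q)\<close>, which is thus at least \<open>m y > 0\<close>.\<close>

lemma ray_kernel_Fubini: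
  fixes l u :: real and w :: complex
  assumes l: "l > 0" "l + ln l > 0" and u: "u \<ge> 0" and w: "Re w > 0" "Im w \<ge> 0" and n: "n \<ge> 1"
  shows "set_integrable lborel {0<..} (\<lambda>t. of_real t ^ n * ray_kernel l (of_real t * w) * exp (- of_real t * w * of_real u))" (is ?A)
    and "(LINT t:{0<..}|lborel. of_real t ^ n * ray_kernel l (of_real t * w) * exp (- of_real t * w * of_real u))
      = fact n * (- 1 / w) ^ Suc n * (\<integral>y. 1 / (phase l (Complex y pi) - of_real u) ^ Suc n \<partial>lborel)" (is ?B)
proof -
  define Q where "Q = (\<lambda>y. of_real u - phase l (Complex y pi))"
  define f where "f = (\<lambda>t y. complex_of_real t ^ n * exp (- (of_real t * (w * Q y))))"
  define m where "m = (\<lambda>y. Re w * (\<bar>y + ln l\<bar> + (l + ln l)))"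
  have m: "m y > 0" for y using l w by (simp add: m_def add_nonneg_pos)
  have ReQ: "m y \<le> Re (w * Q y)" for y
  proof -
    have "Re (w * Q y) = Re w * (u + l + l * exp y - y) + Im w * pi"
      by (simp add: Q_def phase_upper_line algebra_simps)
    moreover have "m y \<le> Re w * (u + l + l * exp y - y)"
      unfolding m_def using real_phase_upper_line_ge[OF l(1) u, of y] w by (intro mult_left_mono) auto
    ultimately show ?thesis using w by (simp add: add_increasing2)
  qed
  then have posQ: "Re (w * Q y) > 0" for y using m[of y] by (rule less_le_trans[rotated])
  have w0: "w \<noteq> 0" using w by auto
  have fm: "case_prod f \<in> borel_measurable (lborel \<Otimes>\<^sub>M lborel)"
  proof -
    have "continuous_on UNIV (\<lambda>p. f (fst p) (snd p))"
      unfolding f_def Q_def phase_upper_line by (intro continuous_intros)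
    then have "(\<lambda>p. f (fst p) (snd p)) \<in> borel_measurable (borel :: (real \<times> real) measure)"
      by (rule borel_measurable_continuous_onI)
    then show ?thesis by (simp add: split_beta' lborel_prod)
  qed
  have i1: "set_integrable lborel {0<..} (\<lambda>t. f t y)" for y
    unfolding f_def by (rule set_integrable_power_cexp[OF posQ])
  have nf: "(LINT t:{0<..}|lborel. cmod (f t y)) = fact n / Re (w * Q y) ^ Suc n" for y
  proof -
    have "(LINT t:{0<..}|lborel. cmod (f t y)) = (LINT t:{0<..}|lborel. t ^ n * exp (- (t * Re (w * Q y))))"
      by (rule set_lebesgue_integral_cong) (auto simp: f_def norm_mult norm_power)
    then show ?thesis using set_integral_power_exp[OF posQ] by simp
  qed
  have cQ: "continuous_on UNIV (\<lambda>y. Re (w * Q y))" unfolding Q_def phase_upper_line by (intro continuous_intros)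
  have i2: "set_integrable lborel UNIV (\<lambda>y. LINT t:{0<..}|lborel. cmod (f t y))"
    unfolding nf set_integrable_def
  proof (rule Bochner_Integration.integrable_bound)
    show "integrable lborel (\<lambda>y. fact n / Re w ^ Suc n * (1 / (\<bar>y + ln l\<bar> + (l + ln l)) ^ Suc n))"
      by (intro integrable_mult_right integrable_inverse_power_shifted_abs l) (use n in auto)
    have "continuous_on UNIV (\<lambda>y. fact n / Re (w * Q y) ^ Suc n)"
      using posQ by (intro continuous_on_divide continuous_on_power continuous_on_const cQ ballI power_not_zero less_imp_neq[symmetric])
    then show "(\<lambda>y. indicator UNIV y *\<^sub>R (fact n / Re (w * Q y) ^ Suc n)) \<in> borel_measurable lborel"
      using borel_measurable_continuous_onI by simp
    show "AE y in lborel. norm (indicator UNIV y *\<^sub>R (fact n / Re (w * Q y) ^ Suc n)) \<le> norm (fact n / Re w ^ Suc n * (1 / (\<bar>y + ln l\<bar> + (l + ln l)) ^ Suc n))"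
    proof (rule AE_I2)
      fix y
      have "fact n / Re (w * Q y) ^ Suc n \<le> fact n / m y ^ Suc n"
        using ReQ[of y] m[of y] by (intro divide_left_mono power_mono mult_pos_pos zero_less_power) auto
      also have "\<dots> = fact n / Re w ^ Suc n * (1 / (\<bar>y + ln l\<bar> + (l + ln l)) ^ Suc n)"
        unfolding m_def power_mult_distrib by simp
      finally have "fact n / Re (w * Q y) ^ Suc n \<le> fact n / Re w ^ Suc n * (1 / (\<bar>y + ln l\<bar> + (l + ln l)) ^ Suc n)" .
      moreover have "0 \<le> fact n / Re (w * Q y) ^ Suc n" using posQ[of y] by simp
      ultimately show "norm (indicator UNIV y *\<^sub>R (fact n / Re (w * Q y) ^ Suc n)) \<le> norm (fact n / Re w ^ Suc n * (1 / (\<bar>y + ln l\<bar> + (l + ln l)) ^ Suc n))"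
        by (simp only: indicator_UNIV scaleR_one real_norm_def)
    qed
  qed
  have inner: "(LINT y:UNIV|lborel. f t y) = of_real t ^ n * ray_kernel l (of_real t * w) * exp (- of_real t * w * of_real u)"
    if "t > 0" for t
  proof -
    have "f t y = of_real t ^ n * exp (- (of_real t * w) * (of_real l - \<i> * of_real pi)) * exp (- of_real t * w * of_real u)
        * exp (of_real t * w * of_real (y - l * exp y))" for y
    proof -
      have "- (of_real t * (w * Q y)) = - (of_real t * w) * (of_real l - \<i> * of_real pi) + (- of_real t * w * of_real u) + of_real t * w * of_real (y - l * exp y)"
        by (simp add: Q_def phase_upper_line algebra_simps)
      then show ?thesis unfolding f_def by (simp only: exp_add mult.assoc)
    qed
    then have "(LINT y:UNIV|lborel. f t y) = of_real t ^ n * exp (- (of_real t * w) * (of_real l - \<i> * of_real pi)) * exp (- of_real t * w * of_real u)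
        * (\<integral>y. exp (of_real t * w * of_real (y - l * exp y)) \<partial>lborel)"
      by (simp add: set_lebesgue_integral_def)
    also have "(\<integral>y. exp (of_real t * w * of_real (y - l * exp y)) \<partial>lborel) = Gamma (of_real t * w) * (of_real l * (of_real t * w)) powr (- (of_real t * w))"
      by (rule Gamma_double_exponential[OF l(1)]) (use that w in simp)
    finally show ?thesis by (simp add: ray_kernel_def mult_ac)
  qed
  note F = set_Fubini[OF fm _ _ i1 i2]
  have cong: "(LINT t:{0<..}|lborel. LINT y:UNIV|lborel. f t y) = (LINT t:{0<..}|lborel. of_real t ^ n * ray_kernel l (of_real t * w) * exp (- of_real t * w * of_real u))"
    by (rule set_lebesgue_integral_cong) (auto simp: inner)
  show ?A
    by (rule set_integrable_cong[THEN iffD1, OF refl refl _ F(1)]) (auto simp: inner)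
  have "(LINT y:UNIV|lborel. LINT t:{0<..}|lborel. f t y) = (\<integral>y. fact n * (- 1 / w) ^ Suc n * (1 / (phase l (Complex y pi) - of_real u) ^ Suc n) \<partial>lborel)"
    unfolding set_lebesgue_integral_def[of lborel UNIV]
  proof (rule Bochner_Integration.integral_cong)
    fix y
    have "(LINT t:{0<..}|lborel. f t y) = fact n / (w * Q y) ^ Suc n"
      unfolding f_def by (rule set_integral_power_cexp[OF posQ])
    also have "\<dots> = fact n * (- 1 / w) ^ Suc n * (1 / (phase l (Complex y pi) - of_real u) ^ Suc n)"
    proof -
      define c where "c = - 1 / w"
      have "w * Q y = (phase l (Complex y pi) - of_real u) / c" using w0 by (simp add: Q_def c_def algebra_simps)
      then show ?thesis unfolding c_def[symmetric]
        by (simp only: power_divide divide_divide_eq_right times_divide_eq_right mult_1_right)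
    qed
    finally show "indicat_real UNIV y *\<^sub>R (LINT t:{0<..}|lborel. f t y) = fact n * (- 1 / w) ^ Suc n * (1 / (phase l (Complex y pi) - of_real u) ^ Suc n)"
      by (simp only: indicator_UNIV scaleR_one)
  qed simp
  also have "\<dots> = fact n * (- 1 / w) ^ Suc n * (\<integral>y. 1 / (phase l (Complex y pi) - of_real u) ^ Suc n \<partial>lborel)"
    by (rule integral_mult_right_zero)
  finally show ?B using F(2) cong by simp
qed

text \<open>Bridges the real derivatives in \<open>b_neg\<close> and the complex ones in the
  residue. The derivative along the real axis of a function with real values there is real.\<close>

lemma higher_deriv_of_real:
  fixes f :: "complex \<Rightarrow> complex" and g :: "real \<Rightarrow> real"
  assumes f: "f holomorphic_on S" and S: "open S"
    and fg: "\<And>x. of_real x \<in> S \<Longrightarrow> f (of_real x) = of_real (g x)"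
    and x: "of_real x \<in> S"
  shows "(deriv ^^ n) f (of_real x) = of_real ((deriv ^^ n) g x)"
  using x
proof (induction n arbitrary: x)
  case 0
  then show ?case by (simp add: fg)
next
  case (Suc n)
  define D where "D = deriv ((deriv ^^ n) f) (of_real x)"
  have "((deriv ^^ n) f has_field_derivative D) (at (of_real x))"
    unfolding D_def using holomorphic_derivI[OF holomorphic_higher_deriv[OF f S] S Suc.prems] by simp
  then have "((\<lambda>x. (deriv ^^ n) f (of_real x)) has_vector_derivative D) (at x)"
    by (rule has_vector_derivative_real_field)
  moreover have "open (of_real -` S :: real set)"
    by (intro open_vimage S continuous_intros)
  ultimately have "((\<lambda>x. complex_of_real ((deriv ^^ n) g x)) has_vector_derivative D) (at x)"
    by (rule has_vector_derivative_transform_within_open) (use Suc in auto)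
  note d = this
  have "((deriv ^^ n) g has_vector_derivative Re D) (at x)"
    using bounded_linear.has_vector_derivative[OF bounded_linear_Re d] by simp
  then have "deriv ((deriv ^^ n) g) x = Re D"
    by (intro DERIV_imp_deriv) (simp add: has_real_derivative_iff_has_vector_derivative)
  moreover have "((\<lambda>x::real. 0::real) has_vector_derivative Im D) (at x)"
    using bounded_linear.has_vector_derivative[OF bounded_linear_Im d] by simp
  then have "Im D = 0"
    using vector_derivative_unique_at[OF _ has_vector_derivative_const] by blast
  ultimately show ?case by (simp add: D_def complex_eq_iff)
qed

section \<open>Residues as coefficients and as Laplace density\<close>

lemma phase_0 [simp]: "phase l 0 = 0"
  by (simp add: phase_def)

text \<open>The bracket in \<open>b_neg\<close> is \<open>(l + 1) * phase_quotient l 0\<close>. Its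
  power contributes \<open>(l + 1)^(n + 1)\<close> and the prefactor \<open>(l + 1)^n\<close>, which
  together explain the exponent \<open>2 * n + 1\<close>.\<close>

lemma b_neg_eq_higher_deriv:
  assumes l: "l > 0"
  shows "complex_of_real (b_neg n l / (l + 1) ^ (2 * n + 1)) = (deriv ^^ n) (\<lambda>t. phase_quotient l 0 t ^ Suc n) 0"
proof -
  obtain d where d: "d > 0" "\<And>t. t \<in> box (Complex (- 0 - d) (- pi - d)) (Complex (0 + d) (pi + d)) \<Longrightarrow> phase l t = of_real 0 \<Longrightarrow> t = of_real 0"
    using strip_neighbourhood[OF l, of 0 0 0] by auto
  define S where "S = box (Complex (- 0 - d) (- pi - d)) (Complex (0 + d) (pi + d))"
  have S: "open S" "0 \<in> S" using d(1) add_pos_pos[OF d(1) pi_gt_zero] by (auto simp: S_def in_box_complex_iff)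
  have hol: "phase_quotient l 0 holomorphic_on S"
    by (rule phase_quotient_holomorphic[OF l S(1)]) (use d(2) in \<open>auto simp: S_def\<close>)
  have l1: "l + 1 > 0" using l by simp
  let ?g = "\<lambda>t. (if t = 0 then 1 else (l + 1) * t / (l * exp t + t - l)) ^ (n + 1)"
  have "(deriv ^^ n) (\<lambda>t. of_real ((l + 1) ^ Suc n) * phase_quotient l 0 t ^ Suc n) (of_real 0) = complex_of_real ((deriv ^^ n) ?g 0)"
  proof (rule higher_deriv_of_real[OF _ S(1)])
    show "(\<lambda>t. of_real ((l + 1) ^ Suc n) * phase_quotient l 0 t ^ Suc n) holomorphic_on S"
      by (intro holomorphic_intros hol)
    fix x :: real
    have "complex_of_real (l + 1) * phase_quotient l 0 (of_real x) = complex_of_real (if x = 0 then 1 else (l + 1) * x / (l * exp x + x - l))"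
    proof (cases "x = 0")
      case True
      then show ?thesis using l1 by (simp add: phase_quotient_def del: of_real_add) (metis of_real_1 of_real_add of_real_eq_0_iff less_irrefl divide_self)
    next
      case False
      have "phase l (of_real x) = complex_of_real (l * exp x + x - l)" by (simp add: phase_def exp_of_real)
      then show ?thesis using False by (simp add: phase_quotient_def)
    qed
    then have "(complex_of_real (l + 1) * phase_quotient l 0 (of_real x)) ^ Suc n = complex_of_real (if x = 0 then 1 else (l + 1) * x / (l * exp x + x - l)) ^ Suc n"
      by (rule arg_cong)
    then show "of_real ((l + 1) ^ Suc n) * phase_quotient l 0 (of_real x) ^ Suc n = complex_of_real (?g x)"
      by (simp only: power_mult_distrib of_real_power Suc_eq_plus1)
  qed (use S in auto)
  also have "(deriv ^^ n) (\<lambda>t. of_real ((l + 1) ^ Suc n) * phase_quotient l 0 t ^ Suc n) (of_real 0)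
      = of_real ((l + 1) ^ Suc n) * (deriv ^^ n) (\<lambda>t. phase_quotient l 0 t ^ Suc n) 0"
    using higher_deriv_cmult[of "\<lambda>t. phase_quotient l 0 t ^ Suc n" S 0 n "of_real ((l + 1) ^ Suc n)"] S
    by (simp add: holomorphic_on_power[OF hol] del: power_Suc)
  finally have e: "of_real ((l + 1) ^ Suc n) * (deriv ^^ n) (\<lambda>t. phase_quotient l 0 t ^ Suc n) 0 = complex_of_real ((deriv ^^ n) ?g 0)" .
  have "b_neg n l / (l + 1) ^ (2 * n + 1) = (deriv ^^ n) ?g 0 / (l + 1) ^ Suc n"
  proof -
    have "(l + 1) ^ (2 * n + 1) = (l + 1) ^ n * (l + 1) ^ Suc n" by (simp add: mult_2 power_add)
    then show ?thesis using l1 unfolding b_neg_def by (simp del: power_Suc)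
  qed
  also have "complex_of_real \<dots> = (deriv ^^ n) (\<lambda>t. phase_quotient l 0 t ^ Suc n) 0"
  proof -
    have nz: "complex_of_real ((l + 1) ^ Suc n) \<noteq> 0" using l1 by (metis of_real_eq_0_iff less_irrefl zero_less_power)
    show ?thesis unfolding of_real_divide e[symmetric] using nz by (simp del: of_real_power of_real_add power_Suc)
  qed
  finally show ?thesis .
qed

text \<open>Let \<open>q\<close> be the quotient. Differentiating
  \<open>q * (phase - u) = t - p\<close> twice at \<open>p\<close> gives
  \<open>2 q' phase' + q phase'' = 0\<close>, where \<open>q = 1 / phase'\<close> and
  \<open>phase'' = l exp p\<close>; the derivative of \<open>q^2\<close> is
  \<open>2 q q'\<close>.\<close>

lemma deriv_phase_quotient_squared:
  fixes l p :: real
  assumes l: "l > 0"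
  shows "(deriv ^^ 1) (\<lambda>t. phase_quotient l p t ^ Suc 1) (of_real p) = - of_real (l * exp p) / of_real (l * exp p + 1) ^ 3"
proof -
  define u where "u = l * exp p + p - l"
  have pu: "phase l (of_real p) = of_real u" by (simp add: phase_def u_def exp_of_real)
  obtain d where d: "d > 0" "\<And>t. t \<in> box (Complex (- \<bar>p\<bar> - d) (- pi - d)) (Complex (\<bar>p\<bar> + d) (pi + d)) \<Longrightarrow> phase l t = of_real u \<Longrightarrow> t = of_real p"
    using strip_neighbourhood[OF l pu, of "\<bar>p\<bar>"] by auto
  define S where "S = box (Complex (- \<bar>p\<bar> - d) (- pi - d)) (Complex (\<bar>p\<bar> + d) (pi + d))"
  have S: "open S" "of_real p \<in> S" using d(1) add_pos_pos[OF d(1) pi_gt_zero] by (auto simp: S_def in_box_complex_iff)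
  let ?q = "phase_quotient l p"
  have hol: "?q holomorphic_on S"
    by (rule phase_quotient_holomorphic[OF l S(1)]) (use d(2) pu in \<open>auto simp: S_def\<close>)
  have dq: "(?q has_field_derivative deriv ?q t) (at t)" if "t \<in> S" for t
    by (rule holomorphic_derivI[OF hol S(1) that])
  have ddq: "(deriv ?q has_field_derivative deriv (deriv ?q) (of_real p)) (at (of_real p))"
    by (rule holomorphic_derivI[OF holomorphic_deriv[OF hol S(1)] S])
  let ?f = "\<lambda>t. of_real l * exp t + 1 :: complex"
  have one: "deriv ?q t * (phase l t - of_real u) + ?q t * ?f t = 1" if t: "t \<in> S" for t
  proof -
    have "((\<lambda>t. ?q t * (phase l t - of_real u)) has_field_derivative deriv ?q t * (phase l t - of_real u) + ?q t * ?f t) (at t)"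
      by (rule derivative_eq_intros dq[OF t] DERIV_phase refl)+ simp
    moreover have "((\<lambda>t. ?q t * (phase l t - of_real u)) has_field_derivative 1) (at t)"
    proof (rule has_field_derivative_transform_within_open[OF _ S(1) t])
      show "((\<lambda>t. t - of_real p) has_field_derivative 1) (at t)" by (auto intro!: derivative_eq_intros)
      show "x - of_real p = ?q x * (phase l x - of_real u)" if "x \<in> S" for x
      proof (cases "x = of_real p")
        case False
        then have "phase l x \<noteq> of_real u" using d(2)[of x] that unfolding S_def by blast
        then show ?thesis using False by (simp add: phase_quotient_def pu)
      qed (simp add: pu)
    qed
    ultimately show ?thesis by (rule DERIV_unique)
  qed
  have D1: "((\<lambda>t. deriv ?q t * (phase l t - of_real u) + ?q t * ?f t) has_field_derivative
      deriv (deriv ?q) (of_real p) * (phase l (of_real p) - of_real u) + deriv ?q (of_real p) * ?f (of_real p)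
       + (deriv ?q (of_real p) * ?f (of_real p) + ?q (of_real p) * (of_real l * exp (of_real p)))) (at (of_real p))"
    by (rule derivative_eq_intros dq[OF S(2)] ddq DERIV_phase refl)+ (simp add: algebra_simps)
  have D2: "((\<lambda>t. deriv ?q t * (phase l t - of_real u) + ?q t * ?f t) has_field_derivative 0) (at (of_real p))"
    by (rule has_field_derivative_transform_within_open[OF DERIV_const[of 1] S]) (simp add: one)
  from DERIV_unique[OF D1 D2] have z: "2 * deriv ?q (of_real p) * ?f (of_real p) + ?q (of_real p) * (of_real l * exp (of_real p)) = 0"
    unfolding pu by (simp add: algebra_simps)
  define A where "A = ?f (of_real p)"
  define E where "E = complex_of_real l * exp (of_real p)"
  have A: "A \<noteq> 0" unfolding A_def by (rule phase_deriv_nonzero[OF l])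
  have qp: "?q (of_real p) = 1 / A" by (simp add: phase_quotient_def A_def)
  have "2 * deriv ?q (of_real p) * A = - (1 / A * E)" using z unfolding qp unfolding A_def[symmetric] unfolding E_def[symmetric] by (simp add: eq_neg_iff_add_eq_0)
  then have q': "2 * deriv ?q (of_real p) = - E / A\<^sup>2" using A by (simp add: field_simps power2_eq_square)
  have "((\<lambda>t. ?q t ^ Suc 1) has_field_derivative (2 * deriv ?q (of_real p)) * ?q (of_real p)) (at (of_real p))"
    by (rule derivative_eq_intros dq[OF S(2)] refl)+ simp
  then have "deriv (\<lambda>t. ?q t ^ Suc 1) (of_real p) = (2 * deriv ?q (of_real p)) * ?q (of_real p)"
    by (rule DERIV_imp_deriv)
  also have "\<dots> = - E / A ^ 3" unfolding q' qp by (simp add: eval_nat_numeral)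
  finally show ?thesis by (simp add: E_def A_def exp_of_real)
qed

text \<open>The integral of \<open>x^n * ray_kernel l x * exp (- x * u)\<close> along the ray
  \<open>x = t * w\<close>; the factor \<open>w^(n + 1)\<close> comes from \<open>x^n dx\<close>.
  The normalisation of \<open>stieltjes\<close> is the same.\<close>

definition ray_moment :: "real \<Rightarrow> complex \<Rightarrow> nat \<Rightarrow> real \<Rightarrow> complex" where
  "ray_moment l w n u = w ^ Suc n *
     (LINT t:{0<..}|lborel. of_real t ^ n * ray_kernel l (of_real t * w) * exp (- of_real t * w * of_real u))"

text \<open>The powers of \<open>w\<close> cancel against \<open>(- 1 / w)^(n + 1)\<close>, so the
  moment is real up to the line integral \<open>I\<close>, and subtracting the conjugate leaves the
  residue of \<open>phase_strip_integral\<close>.\<close>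

lemma ray_moment_imaginary:
  fixes l u p :: real and w :: complex
  assumes l: "l > 0" "l + ln l > 0" and u: "u \<ge> 0" and w: "Re w > 0" "Im w \<ge> 0" and n: "n \<ge> 1"
    and p: "phase l (of_real p) = of_real u"
  shows "ray_moment l w n u - cnj (ray_moment l w n u)
     = 2 * of_real pi * \<i> * ((- 1) ^ n * (deriv ^^ n) (\<lambda>t. phase_quotient l p t ^ Suc n) (of_real p))"
proof -
  define I where "I = (\<integral>y. 1 / (phase l (Complex y pi) - of_real u) ^ Suc n \<partial>lborel)"
  define D where "D = (deriv ^^ n) (\<lambda>t. phase_quotient l p t ^ Suc n) (of_real p)"
  have w0: "w \<noteq> 0" using w by auto
  have wp: "w ^ Suc n * (- 1 / w) ^ Suc n = (- 1) ^ Suc n"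
    using w0 by (simp only: power_mult_distrib[symmetric]) simp
  have "ray_moment l w n u = w ^ Suc n * (fact n * (- 1 / w) ^ Suc n * I)"
    unfolding ray_moment_def I_def ray_kernel_Fubini(2)[OF l u w n] ..
  also have "\<dots> = fact n * (w ^ Suc n * (- 1 / w) ^ Suc n) * I" by (simp only: mult_ac)
  finally have R: "ray_moment l w n u = fact n * (- 1) ^ Suc n * I" unfolding wp .
  have "cnj I - I = 2 * of_real pi * \<i> * (D / fact n)"
    unfolding I_def D_def by (rule phase_strip_integral[OF l u p n])
  then have "fact n * (- 1) ^ n * (cnj I - I) = 2 * of_real pi * \<i> * ((- 1) ^ n * D)" by simp
  moreover have "ray_moment l w n u - cnj (ray_moment l w n u) = fact n * (- 1) ^ n * (cnj I - I)"
    unfolding R by (simp add: algebra_simps)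
  ultimately show ?thesis by (simp add: D_def)
qed

lemma set_Fubini_product_bound:
  fixes f :: "real \<Rightarrow> real \<Rightarrow> complex" and g h :: "real \<Rightarrow> real"
  assumes meas: "case_prod f \<in> borel_measurable (lborel \<Otimes>\<^sub>M lborel)"
    and A: "A \<in> sets borel" and B: "B \<in> sets borel"
    and g: "set_integrable lborel A g" and h: "set_integrable lborel B h"
    and le: "\<And>x y. x \<in> A \<Longrightarrow> y \<in> B \<Longrightarrow> cmod (f x y) \<le> g x * h y"
  shows "(LINT x:A|lborel. LINT y:B|lborel. f x y) = (LINT y:B|lborel. LINT x:A|lborel. f x y)"
    and "set_integrable lborel B (\<lambda>y. LINT x:A|lborel. f x y)"
proof -
  have fy: "(\<lambda>x. f x y) \<in> borel_measurable lborel" for y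
    using measurable_compose[OF measurable_Pair2'[of y lborel lborel] meas]
    by (simp add: measurable_Pair2' o_def)
  have i1: "set_integrable lborel A (\<lambda>x. f x y)" if y: "y \<in> B" for y
  proof (rule set_integrable_bound[OF set_integrable_mult_left[of "h y", OF g]])
    show "set_borel_measurable lborel A (\<lambda>x. f x y)"
      unfolding set_borel_measurable_def using A fy by (intro borel_measurable_scaleR borel_measurable_indicator) auto
    show "AE x in lborel. x \<in> A \<longrightarrow> norm (f x y) \<le> norm (g x * h y)"
      by (rule AE_I2) (use le y in \<open>auto intro: order_trans[OF _ abs_ge_self]\<close>)
  qed
  have i2: "set_integrable lborel B (\<lambda>y. LINT x:A|lborel. cmod (f x y))"
  proof (rule set_integrable_bound[OF set_integrable_mult_right[of "LINT x:A|lborel. g x", OF h]])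
    have "(\<lambda>(y, x). f x y) \<in> borel_measurable (lborel \<Otimes>\<^sub>M lborel)"
      using measurable_pair_swap[OF meas] by (simp add: split_beta')
    then have [measurable]: "(\<lambda>p. f (snd p) (fst p)) \<in> borel_measurable (lborel \<Otimes>\<^sub>M lborel)"
      by (simp add: split_beta')
    have [measurable]: "A \<in> sets lborel" using A by simp
    have "(\<lambda>(y, x). indicat_real A x *\<^sub>R cmod (f x y)) \<in> borel_measurable (lborel \<Otimes>\<^sub>M lborel)"
      unfolding split_beta' by measurable
    then have "(\<lambda>y. LINT x|lborel. indicat_real A x *\<^sub>R cmod (f x y)) \<in> borel_measurable lborel"
      by (rule lborel.borel_measurable_lebesgue_integral)
    then show "set_borel_measurable lborel B (\<lambda>y. LINT x:A|lborel. cmod (f x y))"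
      unfolding set_borel_measurable_def set_lebesgue_integral_def using B
      by (intro borel_measurable_scaleR borel_measurable_indicator) auto
    show "AE y in lborel. y \<in> B \<longrightarrow> norm (LINT x:A|lborel. cmod (f x y)) \<le> norm ((LINT x:A|lborel. g x) * h y)"
    proof (rule AE_I2, rule impI)
      fix y assume y: "y \<in> B"
      have "(LINT x:A|lborel. cmod (f x y)) \<le> (LINT x:A|lborel. g x * h y)"
        using i1[OF y] le y by (intro set_integral_mono set_integrable_norm set_integrable_mult_left g) auto
      moreover have "0 \<le> (LINT x:A|lborel. cmod (f x y))"
        unfolding set_lebesgue_integral_def by (intro Bochner_Integration.integral_nonneg) auto
      ultimately show "norm (LINT x:A|lborel. cmod (f x y)) \<le> norm ((LINT x:A|lborel. g x) * h y)"
        by simp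
    qed
  qed
  show "(LINT x:A|lborel. LINT y:B|lborel. f x y) = (LINT y:B|lborel. LINT x:A|lborel. f x y)"
    by (rule set_Fubini(2)[OF meas A B i1 i2])
  show "set_integrable lborel B (\<lambda>y. LINT x:A|lborel. f x y)"
    by (rule set_Fubini(3)[OF meas A B i1 i2])
qed

section \<open>The representation for positive parameters\<close>

text \<open>Taking \<open>z^(- a) exp (- z)\<close> out of the integrand leaves the exponent
  \<open>- a * (s / a + ln (1 + s / z))\<close>; for \<open>z = l a\<close> the inner bracket is the
  value of \<open>phase l\<close> at \<open>ln (1 + s / z)\<close>.\<close>

lemma upper_Gamma_positive_real:
  fixes a z :: real
  assumes a: "a > 0" and z: "z > 0"
  shows "upper_Gamma (- of_real a) (of_real z) / (of_real z powr (- of_real a) * exp (- of_real z))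
    = of_real (LINT s:{0<..}|lborel. exp (- a * (s / a + ln (1 + s / z))) / (z + s))"
proof -
  let ?g = "\<lambda>s. exp (- a * (s / a + ln (1 + s / z))) / (z + s)"
  let ?c = "z powr (- a) * exp (- z)"
  have "(complex_of_real z + of_real s) powr (- of_real a - 1) * exp (- (of_real z + of_real s)) = of_real (?c * ?g s)"
    if s: "s \<in> {0<..}" for s
  proof -
    have zs: "z + s > 0" "s > 0" using s z by auto
    have L: "ln (1 + s / z) = ln (z + s) - ln z"
    proof -
      have "1 + s / z = (z + s) / z" using z by (simp add: field_simps)
      then show ?thesis using zs z by (simp add: ln_div)
    qed
    have "- a * (s / a + K) = - s - a * K" for K using a by (simp add: field_simps)
    then have "- a * (s / a + ln (1 + s / z)) = - s - a * ln (1 + s / z)" .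
    also have "\<dots> = - s - a * ln (z + s) + a * ln z" unfolding L by (simp add: algebra_simps)
    finally have "- a * (s / a + ln (1 + s / z)) = - s - a * ln (z + s) + a * ln z" .
    then have "?c * ?g s = exp (- a * ln z) * exp (- z) * exp (- s - a * ln (z + s) + a * ln z) / (z + s)"
      using z by (simp add: powr_def)
    also have "\<dots> = exp (- a * ln z + - z + (- s - a * ln (z + s) + a * ln z)) / (z + s)"
      by (simp only: exp_add)
    also have "- a * ln z + - z + (- s - a * ln (z + s) + a * ln z) = - a * ln (z + s) + - (z + s)" by simp
    also have "exp (- a * ln (z + s) + - (z + s)) / (z + s) = (z + s) powr (- a - 1) * exp (- (z + s))"
    proof -
      have "(z + s) powr (- a - 1) = (z + s) powr (- a) / (z + s) powr 1" by (rule powr_diff)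
      also have "\<dots> = exp (- a * ln (z + s)) / (z + s)" using zs by (simp add: powr_def[of _ "- a"])
      finally show ?thesis by (simp only: exp_add times_divide_eq_left)
    qed
    finally have "of_real (?c * ?g s) = complex_of_real ((z + s) powr (- a - 1)) * of_real (exp (- (z + s)))" by simp
    also have "complex_of_real ((z + s) powr (- a - 1)) = of_real (z + s) powr of_real (- a - 1)"
      using zs by (intro powr_of_real[symmetric]) simp
    finally show ?thesis by (simp flip: exp_of_real)
  qed
  then have "upper_Gamma (- of_real a) (of_real z) = (LINT s:{0<..}|lborel. complex_of_real (?c * ?g s))"
    unfolding upper_Gamma_def by (intro set_lebesgue_integral_cong) auto
  also have "\<dots> = of_real (?c * (LINT s:{0<..}|lborel. ?g s))"
    by (simp only: set_integral_complex_of_real set_integral_mult_right)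
  finally have e: "upper_Gamma (- of_real a) (of_real z) = of_real ?c * of_real (LINT s:{0<..}|lborel. ?g s)" by simp
  have "of_real z powr (- of_real a) * exp (- of_real z) = complex_of_real ?c"
  proof -
    have "complex_of_real z powr (- of_real a) = of_real (z powr (- a))" using z powr_of_real[of z "- a"] by simp
    then show ?thesis by (simp flip: exp_of_real)
  qed
  then show ?thesis using e z by simp
qed

locale saddle_setup =
  fixes l :: real and w :: complex
  assumes l: "l > 0" "l + ln l > 0" and w: "Re w > 0" "Im w \<ge> 0"
begin

definition stieltjes :: "nat \<Rightarrow> complex \<Rightarrow> complex" where
  "stieltjes n a = w ^ Suc n * (LINT t:{0<..}|lborel. of_real t ^ n * ray_kernel l (of_real t * w) / (a + of_real t * w))"

lemma set_integrable_ray_kernel: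
  assumes "n \<ge> 1"
  shows "set_integrable lborel {0<..} (\<lambda>t. of_real t ^ n * ray_kernel l (of_real t * w))"
  using ray_kernel_Fubini(1)[OF l order_refl w assms] by simp

text \<open>With \<open>p = ln (1 + s / z)\<close>, \<open>\<phi> s\<close> is
  \<open>phase l\<close> at \<open>p\<close> and \<open>D s = l * exp p + 1\<close> is the
  derivative of \<open>phase l\<close> there.\<close>

context
  fixes a z :: real and \<phi> W D :: "real \<Rightarrow> real"
  assumes a: "a > 0" and z: "z = l * a"
  defines "\<phi> \<equiv> \<lambda>s. s / a + ln (1 + s / z)" and "W \<equiv> \<lambda>s. exp (- a * \<phi> s)" and "D \<equiv> \<lambda>s. (z + s) / a + 1"
begin

lemma z_pos: "z > 0" using a l z by simp

lemma phi_nonneg: "s \<ge> 0 \<Longrightarrow> \<phi> s \<ge> 0"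
  using a z_pos by (simp add: \<phi>_def)

lemma DERIV_phi: "s \<ge> 0 \<Longrightarrow> (\<phi> has_real_derivative D s / (z + s)) (at s)"
proof -
  assume s: "s \<ge> 0"
  have zs: "z + s > 0" "1 + s / z > 0" using z_pos s by (auto simp: add_pos_nonneg)
  have "(\<phi> has_real_derivative 1 / a + (1 / z) / (1 + s / z)) (at s)"
    unfolding \<phi>_def using a z_pos zs(2) by (auto intro!: derivative_eq_intros)
  moreover have "1 / a + (1 / z) / (1 + s / z) = D s / (z + s)"
  proof -
    have "z * (1 + s / z) = z + s" using z_pos by (simp add: field_simps)
    then have "(1 / z) / (1 + s / z) = 1 / (z + s)" by simp
    moreover have "D s / (z + s) = 1 / a + 1 / (z + s)" using zs(1) a by (simp add: D_def field_simps)
    ultimately show ?thesis by simp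
  qed
  ultimately show ?thesis by simp
qed

lemma D_pos: "s \<ge> 0 \<Longrightarrow> D s > 0"
  using a z_pos by (simp add: D_def add_pos_pos add_pos_nonneg)

lemma D_ge_1: "s \<ge> 0 \<Longrightarrow> D s \<ge> 1"
  using a z_pos by (simp add: D_def)

lemma W_le: "s \<ge> 0 \<Longrightarrow> W s \<le> exp (- (s * 1))"
proof -
  assume "s \<ge> 0"
  then have "a * ln (1 + s / z) \<ge> 0" using a z_pos by simp
  then show ?thesis using a by (simp add: W_def \<phi>_def algebra_simps)
qed

lemma phi_at_top: "filterlim \<phi> at_top at_top"
proof (rule filterlim_at_top_mono)
  have "filterlim (\<lambda>s. (1/a) * s) at_top at_top"
    by (rule filterlim_tendsto_pos_mult_at_top[OF tendsto_const _ filterlim_ident]) (use a in simp)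
  then show "filterlim (\<lambda>s. s / a) at_top at_top" by simp
  show "\<forall>\<^sub>F s in at_top. s / a \<le> \<phi> s"
    using eventually_ge_at_top[of 0] by eventually_elim (use z_pos in \<open>simp add: \<phi>_def\<close>)
qed

lemma measurable_phi [measurable]: "\<phi> \<in> borel_measurable borel"
  unfolding \<phi>_def by measurable

lemma W_tendsto: "(W \<longlongrightarrow> 0) at_top"
proof -
  have "filterlim (\<lambda>s. a * \<phi> s) at_top at_top"
    by (rule filterlim_tendsto_pos_mult_at_top[OF tendsto_const a phi_at_top])
  then have "filterlim (\<lambda>s. - (a * \<phi> s)) at_bot at_top" by (simp add: filterlim_uminus_at_bot)
  from filterlim_compose[OF exp_at_bot this] show ?thesis by (simp add: W_def)
qed

lemma set_integrable_exp_bounded: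
  assumes "h \<in> borel_measurable borel" and "\<And>s. s > 0 \<Longrightarrow> \<bar>h s\<bar> \<le> C"
  shows "set_integrable lborel {0<..} (\<lambda>s. W s * h s)"
proof (rule set_integrable_bound)
  show "set_integrable lborel {0<..} (\<lambda>s. C * (s ^ 0 * exp (- (s * 1))))"
    by (rule set_integrable_mult_right[OF set_integrable_power_exp]) simp
  show "set_borel_measurable lborel {0<..} (\<lambda>s. W s * h s)"
    unfolding set_borel_measurable_def W_def using assms(1) by measurable
  show "AE s in lborel. s \<in> {0<..} \<longrightarrow> norm (W s * h s) \<le> norm (C * (s ^ 0 * exp (- (s * 1))))"
  proof (rule AE_I2, rule impI)
    fix s :: real assume "s \<in> {0<..}"
    then have s: "s > 0" by simp
    have W0: "W s > 0" by (simp add: W_def)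
    have "W s * \<bar>h s\<bar> \<le> exp (- (s * 1)) * C"
      using W_le[of s] assms(2)[OF s] s W0 by (intro mult_mono) auto
    moreover have "C \<ge> 0" using assms(2)[OF s] by linarith
    ultimately show "norm (W s * h s) \<le> norm (C * (s ^ 0 * exp (- (s * 1))))"
      using W0 by (simp add: abs_mult mult.commute)
  qed
qed

text \<open>Integration by parts, with \<open>- W / (a D)\<close> differentiated. The boundary term
  at \<open>s = 0\<close> is the term \<open>n = 0\<close> of the expansion, since
  \<open>z + a = a (l + 1)\<close>; the remaining density belongs to order \<open>n = 1\<close>, the
  lowest at which \<open>ray_moment_imaginary\<close> applies.\<close>

lemma W_over_integral:
  "(LINT s:{0<..}|lborel. W s / (z + s)) = 1 / (a * (l + 1)) - (1 / a) * (LINT s:{0<..}|lborel. W s / (a * (D s)\<^sup>2))"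
proof -
  have mD: "D \<in> borel_measurable borel" unfolding D_def by measurable
  have i1: "set_integrable lborel {0<..} (\<lambda>s. W s * (1 / (z + s)))"
  proof (rule set_integrable_exp_bounded)
    show "\<bar>1 / (z + s)\<bar> \<le> 1 / z" if "s > 0" for s using that z_pos by (simp add: frac_le)
  qed measurable
  have i2: "set_integrable lborel {0<..} (\<lambda>s. W s * (1 / (a * (D s)\<^sup>2)))"
  proof (rule set_integrable_exp_bounded)
    show "\<bar>1 / (a * (D s)\<^sup>2)\<bar> \<le> 1 / a" if "s > 0" for s
    proof -
      have "1 \<le> (D s)\<^sup>2" using D_ge_1[of s] that by simp
      then have "a * 1 \<le> a * (D s)\<^sup>2" using a by (intro mult_left_mono) auto
      then show ?thesis using a by (simp add: frac_le)
    qed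
    show "(\<lambda>s. 1 / (a * (D s)\<^sup>2)) \<in> borel_measurable borel" using mD by measurable
  qed
  have "(LINT s:{0<..}|lborel. W s * (1 / (z + s)) + (1 / a) * (W s * (1 / (a * (D s)\<^sup>2)))) = 0 - (- W 0 / (a * D 0))"
  proof (rule set_integral_FTC_at_top)
    fix s :: real assume s: "0 \<le> s"
    have zs: "z + s > 0" using z_pos s by simp
    have Wd: "(W has_real_derivative W s * (- a * (D s / (z + s)))) (at s)"
      unfolding W_def by (rule derivative_eq_intros DERIV_phi[OF s] refl)+ simp
    have Dd: "(D has_real_derivative 1 / a) (at s)"
      unfolding D_def using a by (auto intro!: derivative_eq_intros)
    have "((\<lambda>s. - W s / (a * D s)) has_real_derivative W s * (1 / (z + s)) + (1 / a) * (W s * (1 / (a * (D s)\<^sup>2)))) (at s)"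
      apply (rule derivative_eq_intros Wd Dd refl)+
      using a D_pos[OF s] apply simp
      using a D_pos[OF s] zs apply (simp add: divide_simps)
      apply (simp add: power2_eq_square algebra_simps)
      done
    then show "((\<lambda>s. - W s / (a * D s)) has_vector_derivative W s * (1 / (z + s)) + (1 / a) * (W s * (1 / (a * (D s)\<^sup>2)))) (at s within {0..})"
      by (simp add: has_real_derivative_iff_has_vector_derivative has_vector_derivative_at_within)
  next
    show "set_integrable lborel {0<..} (\<lambda>s. W s * (1 / (z + s)) + (1 / a) * (W s * (1 / (a * (D s)\<^sup>2))))"
      by (intro set_integral_add i1 set_integrable_mult_right i2)
    have e1: "\<forall>\<^sub>F s in at_top. norm (- W s / (a * D s)) \<le> W s * (1 / a)"
      using eventually_ge_at_top[of 0]
    proof eventually_elim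
      case (elim s)
      have "a * 1 \<le> a * D s" using D_ge_1[OF elim] a by (intro mult_left_mono) auto
      then show ?case using a D_pos[OF elim] by (simp add: W_def frac_le)
    qed
    have "((\<lambda>s. W s * (1 / a)) \<longlongrightarrow> 0 * (1 / a)) at_top"
      by (intro tendsto_mult tendsto_const W_tendsto)
    then have e2: "((\<lambda>s. W s * (1 / a)) \<longlongrightarrow> 0) at_top" by simp
    show "((\<lambda>s. - W s / (a * D s)) \<longlongrightarrow> 0) at_top"
      by (rule Lim_null_comparison[OF e1 e2])
  qed
  moreover have "W 0 = 1" "D 0 = l + 1" using a z by (simp_all add: W_def \<phi>_def D_def)
  ultimately have "(LINT s:{0<..}|lborel. W s * (1 / (z + s))) + (1 / a) * (LINT s:{0<..}|lborel. W s * (1 / (a * (D s)\<^sup>2))) = 1 / (a * (l + 1))"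
    using set_integral_add(2)[OF i1 set_integrable_mult_right[of "1 / a", OF i2]] by (simp only: set_integral_mult_right)
  then show ?thesis by simp
qed

lemma phase_ln: "s \<ge> 0 \<Longrightarrow> phase l (of_real (ln (1 + s / z))) = of_real (\<phi> s)"
proof -
  assume "s \<ge> 0"
  then have "1 + s / z > 0" using z_pos by (simp add: add_pos_nonneg)
  then have "l * exp (ln (1 + s / z)) = l + s / a" using z_pos z l by (simp add: field_simps)
  then have "phase l (of_real (ln (1 + s / z))) = of_real (l + s / a + ln (1 + s / z) - l)"
    by (simp add: phase_def exp_of_real flip: of_real_mult)
  then show ?thesis by (simp add: \<phi>_def)
qed

text \<open>\<open>D s / (z + s)\<close> is the derivative of \<open>\<phi>\<close>, so in the
  variable \<open>u = \<phi> s\<close> this is the Laplace integral of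
  \<open>exp (- (a + x) u)\<close> over \<open>u > 0\<close>.\<close>

lemma exponential_integral:
  assumes x: "Re x \<ge> 0"
  shows "(LINT s:{0<..}|lborel. of_real (W s * (D s / (z + s))) * exp (- x * of_real (\<phi> s))) = 1 / (of_real a + x)"
    and "set_integrable lborel {0<..} (\<lambda>s. W s * (D s / (z + s)))"
proof -
  have bnd: "\<bar>D s / (z + s)\<bar> \<le> 1 / a + 1 / z" if "s > 0" for s
  proof -
    have "D s / (z + s) = 1 / a + 1 / (z + s)" using that z_pos by (simp add: D_def field_simps)
    moreover have "1 / (z + s) \<le> 1 / z" using that z_pos by (intro frac_le) auto
    moreover have "0 \<le> 1 / a + 1 / (z + s)" using that z_pos a by simp
    ultimately show ?thesis by simp
  qed
  have mD: "D \<in> borel_measurable borel" unfolding D_def by measurable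
  show i: "set_integrable lborel {0<..} (\<lambda>s. W s * (D s / (z + s)))"
    by (rule set_integrable_exp_bounded[OF _ bnd]) (use mD in measurable)
  define c where "c = of_real a + x"
  have c: "Re c > 0" "c \<noteq> 0" using a x by (auto simp: c_def complex_eq_iff)
  have We: "of_real (W s) * exp (- x * of_real (\<phi> s)) = exp (- c * of_real (\<phi> s))" for s
    by (simp add: W_def c_def exp_of_real[symmetric] algebra_simps flip: exp_add)
  have "(LINT s:{0<..}|lborel. of_real (D s / (z + s)) * exp (- c * of_real (\<phi> s))) = 0 - (- (1 / c) * exp (- c * of_real (\<phi> 0)))"
  proof (rule set_integral_FTC_at_top)
    fix s :: real assume s: "0 \<le> s"
    have "((\<lambda>s. complex_of_real (\<phi> s)) has_vector_derivative of_real (D s / (z + s))) (at s)"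
      using DERIV_phi[OF s] by (intro has_vector_derivative_of_real) (simp add: has_real_derivative_iff_has_vector_derivative)
    moreover have "((\<lambda>u. - (1 / c) * exp (- c * u)) has_field_derivative exp (- c * of_real (\<phi> s))) (at (of_real (\<phi> s)))"
      using c by (auto intro!: derivative_eq_intros)
    ultimately have "(((\<lambda>u. - (1 / c) * exp (- c * u)) \<circ> (\<lambda>s. complex_of_real (\<phi> s))) has_vector_derivative
        of_real (D s / (z + s)) * exp (- c * of_real (\<phi> s))) (at s)"
      by (rule field_vector_diff_chain_at)
    then show "((\<lambda>s. - (1 / c) * exp (- c * of_real (\<phi> s))) has_vector_derivative of_real (D s / (z + s)) * exp (- c * of_real (\<phi> s))) (at s within {0..})"
      by (simp only: o_def has_vector_derivative_at_within)
  next
    show "set_integrable lborel {0<..} (\<lambda>s. of_real (D s / (z + s)) * exp (- c * of_real (\<phi> s)))"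
    proof (rule set_integrable_bound[OF i])
      show "set_borel_measurable lborel {0<..} (\<lambda>s. of_real (D s / (z + s)) * exp (- c * of_real (\<phi> s)))"
      proof -
        have "(\<lambda>s. exp (- c * complex_of_real (\<phi> s))) \<in> borel_measurable borel"
          by (rule measurable_compose[OF measurable_phi borel_measurable_continuous_onI]) (intro continuous_intros)
        then show ?thesis unfolding set_borel_measurable_def using mD by measurable
      qed
      show "AE s in lborel. s \<in> {0<..} \<longrightarrow> norm (of_real (D s / (z + s)) * exp (- c * of_real (\<phi> s))) \<le> norm (W s * (D s / (z + s)))"
      proof (rule AE_I2, rule impI)
        fix s :: real assume "s \<in> {0<..}"
        then have "Re x * \<phi> s \<ge> 0" using x phi_nonneg[of s] by simp
        then have "exp (- Re c * \<phi> s) \<le> W s" by (simp add: W_def c_def algebra_simps)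
        then have "\<bar>D s / (z + s)\<bar> * exp (- Re c * \<phi> s) \<le> \<bar>D s / (z + s)\<bar> * W s" by (intro mult_left_mono) auto
        then show "norm (of_real (D s / (z + s)) * exp (- c * of_real (\<phi> s))) \<le> norm (W s * (D s / (z + s)))"
          unfolding norm_mult norm_of_real by (simp add: abs_mult W_def mult.commute)
      qed
    qed
    have "((\<lambda>s. exp (- (Re c * \<phi> s))) \<longlongrightarrow> 0) at_top"
    proof -
      have "filterlim (\<lambda>s. Re c * \<phi> s) at_top at_top"
        by (rule filterlim_tendsto_pos_mult_at_top[OF tendsto_const c(1) phi_at_top])
      then have "filterlim (\<lambda>s. - (Re c * \<phi> s)) at_bot at_top" by (simp add: filterlim_uminus_at_bot)
      from filterlim_compose[OF exp_at_bot this] show ?thesis .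
    qed
    then have "((\<lambda>s. norm (exp (- c * of_real (\<phi> s)))) \<longlongrightarrow> 0) at_top" by simp
    then have "((\<lambda>s. exp (- c * of_real (\<phi> s))) \<longlongrightarrow> 0) at_top" by (rule tendsto_norm_zero_cancel)
    then have "((\<lambda>s. - (1 / c) * exp (- c * of_real (\<phi> s))) \<longlongrightarrow> - (1 / c) * 0) at_top"
      by (intro tendsto_mult tendsto_const)
    then show "((\<lambda>s. - (1 / c) * exp (- c * of_real (\<phi> s))) \<longlongrightarrow> 0) at_top" by simp
  qed
  moreover have "\<phi> 0 = 0" by (simp add: \<phi>_def)
  ultimately have fin: "(LINT s:{0<..}|lborel. of_real (D s / (z + s)) * exp (- c * of_real (\<phi> s))) = 1 / c" by simp
  have eq: "of_real (W s * (D s / (z + s))) * exp (- x * of_real (\<phi> s)) = of_real (D s / (z + s)) * exp (- c * of_real (\<phi> s))" for s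
    unfolding We[symmetric] of_real_mult by (simp only: mult_ac)
  show "(LINT s:{0<..}|lborel. of_real (W s * (D s / (z + s))) * exp (- x * of_real (\<phi> s))) = 1 / (of_real a + x)"
    unfolding eq using fin by (simp only: c_def)
qed

text \<open>After interchanging the integrations, \<open>exponential_integral\<close> turns
  \<open>exp (- t w \<phi> s)\<close> into \<open>1 / (a + t w)\<close>. The exponential has modulus
  at most \<open>1\<close> because \<open>Re w > 0\<close> and \<open>\<phi> s >= 0\<close>, so a
  product bound justifies the interchange.\<close>

lemma ray_moment_phi_integral:
  shows "(LINT s:{0<..}|lborel. of_real (W s * (D s / (z + s))) * ray_moment l w 1 (\<phi> s)) = stieltjes 1 (of_real a)"
    and "set_integrable lborel {0<..} (\<lambda>s. of_real (W s * (D s / (z + s))) * ray_moment l w 1 (\<phi> s))"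
proof -
  define k where "k = (\<lambda>t. indicat_real {0<..} t *\<^sub>R (of_real t ^ 1 * ray_kernel l (of_real t * w)))"
  define g where "g = (\<lambda>s. W s * (D s / (z + s)))"
  define f where "f = (\<lambda>t s. k t * of_real (g s) * exp (- of_real t * w * of_real (\<phi> s)))"
  have ki: "integrable lborel k"
    using set_integrable_ray_kernel[OF order_refl] unfolding k_def set_integrable_def .
  have gm: "g \<in> borel_measurable borel" unfolding g_def W_def D_def by measurable
  have meas: "case_prod f \<in> borel_measurable (lborel \<Otimes>\<^sub>M lborel)"
  proof -
    have [measurable]: "k \<in> borel_measurable lborel" using ki by (rule borel_measurable_integrable)
    have [measurable]: "g \<in> borel_measurable lborel" "\<phi> \<in> borel_measurable lborel" using gm measurable_phi by auto
    have "(\<lambda>u. exp (- (w * u))) \<in> borel_measurable borel"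
      by (rule borel_measurable_continuous_onI) (intro continuous_intros)
    then have [measurable]: "(\<lambda>p. exp (- (w * complex_of_real (fst p * \<phi> (snd p))))) \<in> borel_measurable (lborel \<Otimes>\<^sub>M lborel)"
      by (rule measurable_compose[rotated]) measurable
    have "case_prod f = (\<lambda>p. k (fst p) * complex_of_real (g (snd p)) * exp (- (w * complex_of_real (fst p * \<phi> (snd p)))))"
      by (auto simp: f_def mult_ac)
    then show ?thesis by simp
  qed
  have gi: "set_integrable lborel {0<..} (\<lambda>s. \<bar>g s\<bar>)"
    using exponential_integral(2)[of 0] unfolding g_def by (intro set_integrable_abs) simp
  have kn: "set_integrable lborel {0<..} (\<lambda>t. cmod (k t))"
    unfolding set_integrable_def using ki by (intro integrable_mult_indicator integrable_norm) auto
  have le: "cmod (f t s) \<le> cmod (k t) * \<bar>g s\<bar>" if "t \<in> {0<..}" "s \<in> {0<..}" for t s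
  proof -
    have "t * Re w * \<phi> s \<ge> 0" using that w phi_nonneg[of s] by simp
    then have "cmod (exp (- of_real t * w * of_real (\<phi> s))) \<le> 1" by simp
    then have "cmod (k t * of_real (g s)) * cmod (exp (- of_real t * w * of_real (\<phi> s))) \<le> cmod (k t * of_real (g s)) * 1"
      by (rule mult_left_mono) simp
    then show ?thesis by (simp only: f_def norm_mult norm_of_real mult_1_right)
  qed
  note F = set_Fubini_product_bound[OF meas _ _ kn gi le]
  have inner_t: "(LINT t:{0<..}|lborel. f t s) = of_real (g s) * (LINT t:{0<..}|lborel. of_real t ^ 1 * ray_kernel l (of_real t * w) * exp (- of_real t * w * of_real (\<phi> s)))" for s
  proof -
    have "(LINT t:{0<..}|lborel. f t s) = (LINT t:{0<..}|lborel. of_real (g s) * (of_real t ^ 1 * ray_kernel l (of_real t * w) * exp (- of_real t * w * of_real (\<phi> s))))"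
      by (rule set_lebesgue_integral_cong) (auto simp: f_def k_def mult_ac)
    then show ?thesis by (simp only: set_integral_mult_right)
  qed
  have inner_s: "(LINT s:{0<..}|lborel. f t s) = of_real t ^ 1 * ray_kernel l (of_real t * w) / (of_real a + of_real t * w)" if t: "t \<in> {0<..}" for t
  proof -
    have "(LINT s:{0<..}|lborel. f t s) = (LINT s:{0<..}|lborel. k t * (of_real (g s) * exp (- (of_real t * w) * of_real (\<phi> s))))"
      by (simp add: f_def mult.assoc)
    also have "\<dots> = k t * (1 / (of_real a + of_real t * w))"
      unfolding g_def using exponential_integral(1)[of "of_real t * w"] t w by (simp only: set_integral_mult_right) simp
    finally show ?thesis using t by (simp add: k_def)
  qed
  have m: "of_real (g s) * ray_moment l w 1 (\<phi> s) = w ^ Suc 1 * (LINT t:{0<..}|lborel. f t s)" for s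
    unfolding inner_t ray_moment_def by (simp only: mult_ac)
  have "(LINT s:{0<..}|lborel. of_real (g s) * ray_moment l w 1 (\<phi> s)) = w ^ Suc 1 * (LINT s:{0<..}|lborel. LINT t:{0<..}|lborel. f t s)"
    unfolding m by (rule set_integral_mult_right)
  also have "(LINT s:{0<..}|lborel. LINT t:{0<..}|lborel. f t s) = (LINT t:{0<..}|lborel. LINT s:{0<..}|lborel. f t s)"
    by (rule F(1)[symmetric]) auto
  also have "\<dots> = (LINT t:{0<..}|lborel. of_real t ^ 1 * ray_kernel l (of_real t * w) / (of_real a + of_real t * w))"
    by (rule set_lebesgue_integral_cong) (auto simp: inner_s)
  finally show "(LINT s:{0<..}|lborel. of_real (W s * (D s / (z + s))) * ray_moment l w 1 (\<phi> s)) = stieltjes 1 (of_real a)"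
    unfolding g_def stieltjes_def .
  have "set_integrable lborel {0<..} (\<lambda>s. w ^ Suc 1 * (LINT t:{0<..}|lborel. f t s))"
    by (rule set_integrable_mult_right[OF F(2)]) auto
  then show "set_integrable lborel {0<..} (\<lambda>s. of_real (W s * (D s / (z + s))) * ray_moment l w 1 (\<phi> s))"
    unfolding m[symmetric] unfolding g_def .
qed

text \<open>By \<open>ray_moment_imaginary\<close> with \<open>n = 1\<close>, a moment minus its
  conjugate is \<open>2 pi i (D - 1) / D^3\<close>. Since \<open>D - 1 = (z + s) / a\<close>, the
  weight \<open>W D / (z + s)\<close> turns this into the integrand \<open>W / (a D^2)\<close> left
  by \<open>W_over_integral\<close>.\<close>

lemma W_over_stieltjes:
  "of_real (LINT s:{0<..}|lborel. W s / (z + s)) =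
     1 / (of_real a * of_real (l + 1)) - (stieltjes 1 (of_real a) - cnj (stieltjes 1 (of_real a))) / (2 * of_real pi * \<i> * of_real a)"
proof -
  let ?G = "\<lambda>s. complex_of_real (W s * (D s / (z + s)))"
  let ?m = "\<lambda>s. ray_moment l w 1 (\<phi> s)"
  note i = ray_moment_phi_integral(2)
  have c: "(LINT s:{0<..}|lborel. ?G s * cnj (?m s)) = cnj (stieltjes 1 (of_real a))"
    and ci: "set_integrable lborel {0<..} (\<lambda>s. ?G s * cnj (?m s))"
  proof -
    have e: "indicat_real {0<..} s *\<^sub>R (?G s * cnj (?m s)) = cnj (indicat_real {0<..} s *\<^sub>R (?G s * ?m s))" for s
      by (simp add: scaleR_conv_of_real)
    have int: "integrable lborel (\<lambda>s. indicat_real {0<..} s *\<^sub>R (?G s * ?m s))" using i by (simp only: set_integrable_def)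
    show "(LINT s:{0<..}|lborel. ?G s * cnj (?m s)) = cnj (stieltjes 1 (of_real a))"
      unfolding ray_moment_phi_integral(1)[symmetric] set_lebesgue_integral_def e
      by (rule integral_bounded_linear[OF bounded_linear_cnj int])
    show "set_integrable lborel {0<..} (\<lambda>s. ?G s * cnj (?m s))"
      unfolding set_integrable_def e by (rule integrable_bounded_linear[OF bounded_linear_cnj int])
  qed
  have "stieltjes 1 (of_real a) - cnj (stieltjes 1 (of_real a)) = (LINT s:{0<..}|lborel. ?G s * ?m s - ?G s * cnj (?m s))"
    using set_integral_diff(2)[OF i ci] by (simp only: c ray_moment_phi_integral(1))
  also have "\<dots> = (LINT s:{0<..}|lborel. 2 * of_real pi * \<i> * of_real (W s / (a * (D s)\<^sup>2)))"
  proof (rule set_lebesgue_integral_cong)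
    show "\<forall>s. s \<in> {0<..} \<longrightarrow> ?G s * ?m s - ?G s * cnj (?m s) = 2 * of_real pi * \<i> * of_real (W s / (a * (D s)\<^sup>2))"
    proof (intro allI impI)
      fix s :: real assume "s \<in> {0<..}"
      then have s: "s \<ge> 0" "s > 0" by auto
      define p where "p = ln (1 + s / z)"
      have zs: "1 + s / z > 0" "z + s > 0" using z_pos s by (auto simp: add_pos_nonneg)
      have lp: "l * exp p = D s - 1"
      proof -
        have "l * exp p = l * (1 + s / z)" unfolding p_def using zs by simp
        also have "\<dots> = D s - 1" using z a l by (simp add: D_def field_simps)
        finally show ?thesis .
      qed
      have "?m s - cnj (?m s) = 2 * of_real pi * \<i> * ((- 1) ^ 1 * (deriv ^^ 1) (\<lambda>t. phase_quotient l p t ^ Suc 1) (of_real p))"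
        by (rule ray_moment_imaginary[OF l phi_nonneg[OF s(1)] w order_refl]) (use phase_ln[OF s(1)] in \<open>simp add: p_def\<close>)
      also have "\<dots> = 2 * of_real pi * \<i> * of_real ((D s - 1) / D s ^ 3)"
        unfolding deriv_phase_quotient_squared[OF l(1)] lp by simp
      finally have d: "?m s - cnj (?m s) = 2 * of_real pi * \<i> * of_real ((D s - 1) / D s ^ 3)" .
      have "W s * (D s / (z + s)) * ((D s - 1) / D s ^ 3) = W s / (a * (D s)\<^sup>2)"
      proof -
        have D0: "D s > 0" by (rule D_pos[OF s(1)])
        have D1: "D s - 1 = (z + s) / a" by (simp add: D_def)
        have "x * (d / v) * (v / a / d ^ 3) = x / (a * d\<^sup>2)" if "d > 0" "v > 0" for x d v
          using that a by (simp add: field_simps eval_nat_numeral)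
        then show ?thesis unfolding D1 using D0 zs by simp
      qed
      then have e: "?G s * of_real ((D s - 1) / D s ^ 3) = complex_of_real (W s / (a * (D s)\<^sup>2))"
        by (metis of_real_mult)
      have "?G s * ?m s - ?G s * cnj (?m s) = ?G s * (?m s - cnj (?m s))" by (simp only: right_diff_distrib)
      also have "\<dots> = 2 * of_real pi * \<i> * (?G s * of_real ((D s - 1) / D s ^ 3))" unfolding d by (simp only: mult_ac)
      finally show "?G s * ?m s - ?G s * cnj (?m s) = 2 * of_real pi * \<i> * of_real (W s / (a * (D s)\<^sup>2))" unfolding e .
    qed
  qed auto
  also have "\<dots> = 2 * of_real pi * \<i> * of_real (LINT s:{0<..}|lborel. W s / (a * (D s)\<^sup>2))"
    by (simp only: set_integral_mult_right set_integral_complex_of_real)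
  finally have S: "stieltjes 1 (of_real a) - cnj (stieltjes 1 (of_real a)) = 2 * of_real pi * \<i> * of_real (LINT s:{0<..}|lborel. W s / (a * (D s)\<^sup>2))" .
  show ?thesis unfolding S W_over_integral using a by simp
qed

end

theorem upper_Gamma_stieltjes_real:
  assumes a: "a > 0"
  shows "upper_Gamma (- of_real a) (of_real l * of_real a) / ((of_real l * of_real a) powr (- of_real a) * exp (- (of_real l * of_real a)))
    = 1 / (of_real a * of_real (l + 1)) - (stieltjes 1 (of_real a) - cnj (stieltjes 1 (of_real a))) / (2 * of_real pi * \<i> * of_real a)"
proof -
  have z: "l * a > 0" using a l by simp
  show ?thesis
    using upper_Gamma_positive_real[OF a z] W_over_stieltjes[OF a refl] by simp
qed

end

section \<open>Continuation to the sector\<close>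

text \<open>Compactness on \<open>[0, T]\<close>; beyond \<open>T = (|a| + 1) / |w|\<close> the
  distance is at least \<open>1\<close>.\<close>

lemma ray_distance_pos:
  fixes a w :: complex
  assumes w: "w \<noteq> 0" and a: "\<And>t. t \<ge> 0 \<Longrightarrow> a + of_real t * w \<noteq> 0"
  obtains \<delta> where "\<delta> > 0" "\<And>t. t \<ge> 0 \<Longrightarrow> \<delta> \<le> cmod (a + of_real t * w)"
proof -
  define T where "T = (cmod a + 1) / cmod w"
  have T: "T \<ge> 0" by (simp add: T_def)
  have "continuous_on {0..T} (\<lambda>t. cmod (a + of_real t * w))" by (intro continuous_intros)
  then obtain t0 where t0: "t0 \<in> {0..T}" "\<And>t. t \<in> {0..T} \<Longrightarrow> cmod (a + of_real t0 * w) \<le> cmod (a + of_real t * w)"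
    using continuous_attains_inf[of "{0..T}" "\<lambda>t. cmod (a + of_real t * w)"] T by auto
  show ?thesis
  proof (rule that[of "min 1 (cmod (a + of_real t0 * w))"])
    show "min 1 (cmod (a + of_real t0 * w)) > 0" using a[of t0] t0(1) by auto
    fix t :: real assume t: "t \<ge> 0"
    show "min 1 (cmod (a + of_real t0 * w)) \<le> cmod (a + of_real t * w)"
    proof (cases "t \<le> T")
      case True
      then show ?thesis using t0(2)[of t] t by auto
    next
      case False
      then have "T * cmod w \<le> t * cmod w" by (intro mult_right_mono) auto
      then have "cmod a + 1 \<le> t * cmod w" using w by (simp add: T_def)
      moreover have "cmod (of_real t * w) \<le> cmod (a + of_real t * w) + cmod a"
        using norm_triangle_ineq4[of "a + of_real t * w" a] by simp
      ultimately show ?thesis using t by (simp add: norm_mult)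
    qed
  qed
qed

definition sector :: "real \<Rightarrow> complex set" where
  "sector \<alpha> = {a. a \<noteq> 0 \<and> \<bar>Arg a\<bar> < \<alpha>}"

lemma sector_not_nonpos_Reals: "\<alpha> \<le> pi \<Longrightarrow> a \<in> sector \<alpha> \<Longrightarrow> a \<notin> \<real>\<^sub>\<le>\<^sub>0"
proof
  assume \<alpha>: "\<alpha> \<le> pi" and a: "a \<in> sector \<alpha>" and "a \<in> \<real>\<^sub>\<le>\<^sub>0"
  then obtain x where x: "a = of_real x" "x \<le> 0" by (auto elim: nonpos_Reals_cases)
  then have "x < 0" using a by (auto simp: sector_def)
  then show False using a \<alpha> x by (simp add: sector_def)
qed

lemma open_sector:
  assumes "\<alpha> \<le> pi"
  shows "open (sector \<alpha>)"
proof -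
  have "sector \<alpha> = {a \<in> - \<real>\<^sub>\<le>\<^sub>0. \<bar>Im (Ln a)\<bar> \<in> {..<\<alpha>}}"
    using sector_not_nonpos_Reals[OF assms] by (auto simp: sector_def Arg_def)
  moreover have "open {a \<in> - \<real>\<^sub>\<le>\<^sub>0. \<bar>Im (Ln a)\<bar> \<in> {..<\<alpha>}}"
  proof -
    have "continuous_on (- \<real>\<^sub>\<le>\<^sub>0) (\<lambda>a. \<bar>Im (Ln a)\<bar>)" by (intro continuous_intros) auto
    then have "open (- \<real>\<^sub>\<le>\<^sub>0 \<inter> (\<lambda>a. \<bar>Im (Ln a)\<bar>) -` {..<\<alpha>})"
      by (rule continuous_open_preimage) auto
    then show ?thesis by (simp add: Collect_conj_eq vimage_def Compl_eq)
  qed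
  ultimately show ?thesis by simp
qed

lemma connected_sector:
  assumes "\<alpha> \<le> pi"
  shows "connected (sector \<alpha>)"
proof -
  have eq: "sector \<alpha> = exp ` {\<zeta>. \<bar>Im \<zeta>\<bar> < \<alpha>}"
  proof (intro equalityI subsetI)
    fix a assume "a \<in> sector \<alpha>"
    then have "a = exp (Ln a)" "\<bar>Im (Ln a)\<bar> < \<alpha>" by (auto simp: sector_def Arg_eq_Im_Ln)
    then show "a \<in> exp ` {\<zeta>. \<bar>Im \<zeta>\<bar> < \<alpha>}" by blast
  next
    fix a assume "a \<in> exp ` {\<zeta>. \<bar>Im \<zeta>\<bar> < \<alpha>}"
    then obtain \<zeta> where \<zeta>: "a = exp \<zeta>" "\<bar>Im \<zeta>\<bar> < \<alpha>" by auto
    then have "Ln a = \<zeta>" using assms by (intro Ln_unique) auto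
    then show "a \<in> sector \<alpha>" using \<zeta> by (auto simp: sector_def Arg_eq_Im_Ln)
  qed
  have "convex {\<zeta>. \<bar>Im \<zeta>\<bar> < \<alpha>}"
  proof -
    have "{\<zeta>. \<bar>Im \<zeta>\<bar> < \<alpha>} = {\<zeta>. Im \<zeta> < \<alpha>} \<inter> {\<zeta>. Im \<zeta> > - \<alpha>}" by auto
    then show ?thesis by (simp add: convex_Int convex_halfspace_Im_lt convex_halfspace_Im_gt)
  qed
  then have "connected {\<zeta>. \<bar>Im \<zeta>\<bar> < \<alpha>}" by (rule convex_connected)
  then show ?thesis
    unfolding eq by (rule connected_continuous_image[rotated]) (intro continuous_intros)
qed

lemma cnj_sector:
  "a \<in> sector \<alpha> \<Longrightarrow> cnj a \<in> sector \<alpha>"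
  by (auto simp: sector_def Arg_cnj)

text \<open>The points \<open>- t * cis \<omega>\<close> with \<open>t > 0\<close> have argument
  \<open>\<omega> - pi\<close> (or \<open>pi\<close> when \<open>\<omega> = 0\<close>), just outside
  the sector.\<close>

lemma sector_avoids_ray:
  assumes \<omega>: "0 \<le> \<omega>" "\<omega> < pi" and a: "a \<in> sector (pi - \<omega>)" and t: "t \<ge> 0"
  shows "a + of_real t * cis \<omega> \<noteq> 0"
proof
  assume *: "a + of_real t * cis \<omega> = 0"
  then have "a = - (of_real t * cis \<omega>)" by (simp add: eq_neg_iff_add_eq_0)
  moreover have "cis (\<omega> - pi) = - cis \<omega>" by (simp add: complex_eq_iff cos_diff sin_diff)
  ultimately have e: "a = rcis t (\<omega> - pi)" by (simp add: rcis_def)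
  have "t \<noteq> 0" using a e by (auto simp: sector_def)
  then have t: "t > 0" using t by simp
  have "Arg a = (if \<omega> = 0 then pi else \<omega> - pi)"
  proof (cases "\<omega> = 0")
    case True
    then have "a = - of_real t" using * by (simp add: eq_neg_iff_add_eq_0)
    then show ?thesis using t True by (simp add: Arg_eq_pi)
  next
    case False
    then show ?thesis unfolding e using t \<omega> by (simp add: Arg_rcis)
  qed
  then show False using a \<omega> by (auto simp: sector_def split: if_splits)
qed

text \<open>The work is in a locally uniform majorant. The modulus of a complex power of
  \<open>v = l a + u\<close> is governed by \<open>|ln |v||\<close> and the bounded argument, so
  \<open>|v|\<close> must be bounded below as well; writing \<open>v = l (a + u / l)\<close>, this
  follows from \<open>ray_distance_pos\<close> with direction \<open>1 / l\<close>.\<close>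

lemma upper_Gamma_holomorphic:
  fixes l :: real
  assumes l: "l > 0"
  shows "(\<lambda>a. upper_Gamma (- a) (of_real l * a)) holomorphic_on (- \<real>\<^sub>\<le>\<^sub>0)"
  unfolding upper_Gamma_def set_lebesgue_integral_def
proof (rule holomorphic_on_lebesgue_integral)
  let ?f = "\<lambda>(a::complex) (u::real). indicat_real {0<..} u *\<^sub>R ((of_real l * a + of_real u) powr (- a - 1) * exp (- (of_real l * a + of_real u)))"
  have np: "of_real l * a + of_real u \<notin> \<real>\<^sub>\<le>\<^sub>0" if "a \<notin> \<real>\<^sub>\<le>\<^sub>0" "u > 0" for a :: complex and u :: real
  proof
    assume "of_real l * a + of_real u \<in> \<real>\<^sub>\<le>\<^sub>0"
    then have H: "l * Re a + u \<le> 0" "l * Im a = 0" by (auto simp: complex_nonpos_Reals_iff)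
    then have "Re a > 0" using l that by (auto simp: complex_nonpos_Reals_iff)
    then have "l * Re a > 0" using l by simp
    then show False using H that by linarith
  qed
  show "(\<lambda>a. ?f a u) holomorphic_on - \<real>\<^sub>\<le>\<^sub>0" for u
  proof (cases "u > 0")
    case True
    then have "(\<lambda>a. (of_real l * a + of_real u) powr (- a - 1) * exp (- (of_real l * a + of_real u))) holomorphic_on - \<real>\<^sub>\<le>\<^sub>0"
      using np by (intro holomorphic_intros) auto
    then show ?thesis using True by simp
  qed simp
  show "(\<lambda>u. ?f a u) \<in> borel_measurable lborel" if "a \<in> - \<real>\<^sub>\<le>\<^sub>0" for a
  proof -
    have "continuous_on {0<..} (\<lambda>u. (of_real l * a + of_real u) powr (- a - 1) * exp (- (of_real l * a + of_real u)))"
    proof -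
      have "continuous_on (- \<real>\<^sub>\<le>\<^sub>0) (\<lambda>v. v powr (- a - 1) * exp (- v))"
        by (intro holomorphic_on_imp_continuous_on holomorphic_intros) auto
      then show ?thesis
        by (rule continuous_on_compose2) (use np[of a] that in \<open>auto intro!: continuous_intros\<close>)
    qed
    then have "set_borel_measurable borel {0<..} (\<lambda>u. (of_real l * a + of_real u) powr (- a - 1) * exp (- (of_real l * a + of_real u)))"
      by (intro borel_measurable_continuous_on_indicator[unfolded set_borel_measurable_def[symmetric]]) auto
    then show ?thesis by (simp add: set_borel_measurable_def)
  qed
  fix a0 :: complex assume a0: "a0 \<in> - \<real>\<^sub>\<le>\<^sub>0"
  have "a0 + of_real t * (1 / of_real l) \<noteq> 0" if "t \<ge> 0" for t
  proof
    assume "a0 + of_real t * (1 / of_real l) = 0"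
    then have "a0 = of_real (- (t / l))" by (simp add: eq_neg_iff_add_eq_0)
    then have "a0 \<in> \<real>\<^sub>\<le>\<^sub>0" using that l by (simp only: complex_nonpos_Reals_iff) simp
    then show False using a0 by simp
  qed
  then obtain \<delta> where \<delta>: "\<delta> > 0" "\<And>t. t \<ge> 0 \<Longrightarrow> \<delta> \<le> cmod (a0 + of_real t * (1 / of_real l))"
    using ray_distance_pos[of "1 / of_real l" a0] l by (metis divide_eq_0_iff of_real_eq_0_iff less_irrefl zero_neq_one)
  define r where "r = \<delta> / 2"
  have low: "l * r \<le> cmod (of_real l * a + of_real u)" if "a \<in> cball a0 r" "u \<ge> 0" for a u
  proof -
    have "\<delta> \<le> cmod (a0 + of_real u * (1 / of_real l))" by (rule \<delta>(2)) (use that in simp)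
    also have "\<dots> \<le> cmod (a + of_real u * (1 / of_real l)) + cmod (a0 - a)"
      using norm_triangle_ineq[of "a + of_real u * (1 / of_real l)" "a0 - a"] by (simp add: add_ac)
    also have "cmod (a0 - a) \<le> r" using that by (simp add: dist_norm)
    finally have "r \<le> cmod (a + of_real u * (1 / of_real l))" by (simp add: r_def)
    then have "l * r \<le> l * cmod (a + of_real u * (1 / of_real l))" using l by (intro mult_left_mono) auto
    also have "\<dots> = cmod (of_real l * (a + of_real u * (1 / of_real l)))" using l by (simp only: norm_mult norm_of_real)
    also have "of_real l * (a + of_real u * (1 / of_real l)) = of_real l * a + of_real u" using l by (simp add: algebra_simps)
    finally show ?thesis .
  qed
  define C where "C = l * (cmod a0 + r)"
  define M where "M = cmod a0 + r + 1"
  \<comment> \<open>Chosen so that \<open>B + u\<close> exceeds both \<open>|v|\<close> and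
    \<open>1 / |v|\<close>; hence \<open>|ln |v|| <= ln (B + u)\<close>.\<close>
  define B where "B = 1 / (l * r) + C + 1"
  define m where "m = nat \<lceil>M\<rceil>"
  have r0: "r > 0" using \<delta> by (simp add: r_def)
  have C0: "C \<ge> 0" using l r0 by (simp add: C_def)
  have B1: "B \<ge> 1" using l r0 C0 by (simp add: B_def)
  have M0: "M \<ge> 0" using r0 by (simp add: M_def add_nonneg_nonneg)
  \<comment> \<open>A translate by \<open>B\<close> of \<open>v^m exp (- v)\<close>, with the factor
    \<open>exp B\<close> compensating for the shift in the exponential.\<close>
  define g where "g = (\<lambda>u. exp (M * pi) * exp C * exp B * (indicat_real {0<..} (B + 1 * u) * ((B + 1 * u) ^ m * exp (- ((B + 1 * u) * 1)))))"
  show "\<exists>r>0. \<exists>g. cball a0 r \<subseteq> - \<real>\<^sub>\<le>\<^sub>0 \<and> integrable lborel g \<and> (\<forall>a\<in>cball a0 r. \<forall>u\<in>space lborel. cmod (?f a u) \<le> g u)"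
  proof (intro exI[of _ r] exI[of _ g] conjI r0 ballI subsetI)
    fix a assume a: "a \<in> cball a0 r"
    show "a \<in> - \<real>\<^sub>\<le>\<^sub>0"
    proof
      assume "a \<in> \<real>\<^sub>\<le>\<^sub>0"
      then have "Re a \<le> 0" "Im a = 0" by (auto simp: complex_nonpos_Reals_iff)
      then have "of_real l * a + of_real (- l * Re a) = 0" "- l * Re a \<ge> 0" using l by (auto simp: complex_eq_iff mult_nonneg_nonpos)
      then have "l * r \<le> 0" using low[OF a, of "- l * Re a"] by (metis norm_zero)
      then show False using l r0 by (simp add: mult_le_0_iff)
    qed
  next
    have h: "set_integrable lborel {0<..} (\<lambda>v::real. v ^ m * exp (- (v * 1)))" by (rule set_integrable_power_exp) simp
    have "integrable lborel (\<lambda>u. indicat_real {0<..} (B + 1 * u) *\<^sub>R ((B + 1 * u) ^ m * exp (- ((B + 1 * u) * 1))))"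
      by (rule lborel_integrable_real_affine[OF h[unfolded set_integrable_def]]) simp
    then show "integrable lborel g" unfolding g_def by (intro integrable_mult_right) simp
  next
    fix a u assume a: "a \<in> cball a0 r"
    show "cmod (?f a u) \<le> g u"
    proof (cases "u > 0")
      case False
      then show ?thesis using B1 by (simp add: g_def indicator_def)
    next
      case True
      define v where "v = of_real l * a + of_real u"
      have ca: "cmod a \<le> cmod a0 + r"
        using a norm_triangle_ineq2[of a a0] by (simp add: dist_norm norm_minus_commute)
      have la: "cmod (of_real l * a) \<le> C" using ca l by (simp add: norm_mult C_def)
      have lv: "l * r \<le> cmod v" unfolding v_def by (rule low[OF a]) (use True in simp)
      have v0: "cmod v > 0" using lv l r0 mult_pos_pos[of l r] by linarith
      have uv: "cmod v \<le> C + u" unfolding v_def using norm_triangle_ineq[of "of_real l * a" "of_real u"] la True by simp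
      have Bu: "cmod v \<le> B + u" "1 / cmod v \<le> B + u"
      proof -
        have "0 \<le> 1 / (l * r)" using l r0 by simp
        then show "cmod v \<le> B + u" using uv unfolding B_def by linarith
        have "1 / cmod v \<le> 1 / (l * r)" using lv l r0 by (intro frac_le) auto
        then show "1 / cmod v \<le> B + u" using C0 True unfolding B_def by linarith
      qed
      have "ln (cmod v) \<le> ln (B + u)" "ln (1 / cmod v) \<le> ln (B + u)" using Bu v0 B1 True by (auto intro!: ln_mono)
      then have lnv: "\<bar>ln (cmod v)\<bar> \<le> ln (B + u)" using v0 by (simp add: ln_div abs_le_iff)
      have vnz: "v \<noteq> 0" using v0 by auto
      have "cmod (Ln v) \<le> \<bar>Re (Ln v)\<bar> + \<bar>Im (Ln v)\<bar>" by (rule cmod_le)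
      also have "Re (Ln v) = ln (cmod v)" using vnz by simp
      also have "\<bar>Im (Ln v)\<bar> \<le> pi" using mpi_less_Im_Ln[OF vnz] Im_Ln_le_pi[OF vnz] by simp
      finally have Lv: "cmod (Ln v) \<le> ln (B + u) + pi" using lnv by linarith
      have "Re ((- a - 1) * Ln v) \<le> cmod ((- a - 1) * Ln v)" by (rule complex_Re_le_cmod)
      also have "\<dots> \<le> M * (ln (B + u) + pi)"
        unfolding norm_mult
      proof (intro mult_mono Lv M0)
        show "cmod (- a - 1) \<le> M" using norm_triangle_ineq4[of "- a" 1] ca by (simp add: M_def)
      qed auto
      finally have e1: "cmod (v powr (- a - 1)) \<le> exp (M * pi) * exp (M * ln (B + u))"
        using vnz by (simp add: powr_def algebra_simps flip: exp_add)
      have Mm: "M \<le> real m" by (simp add: m_def) linarith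
      have "exp (M * ln (B + u)) \<le> exp (real m * ln (B + u))"
        using Mm B1 True by (simp add: mult_right_mono)
      also have "\<dots> = (B + u) ^ m" using B1 True by (simp add: exp_of_nat_mult)
      finally have e2: "exp (M * ln (B + u)) \<le> (B + u) ^ m" .
      have "- Re (of_real l * a) \<le> C" using la abs_Re_le_cmod[of "of_real l * a"] by linarith
      then have e3: "cmod (exp (- v)) \<le> exp C * exp (- u)"
        unfolding norm_exp_eq_Re exp_add[symmetric] exp_le_cancel_iff by (simp add: v_def)
      have "cmod (v powr (- a - 1) * exp (- v)) \<le> (exp (M * pi) * (B + u) ^ m) * (exp C * exp (- u))"
        unfolding norm_mult
      proof (intro mult_mono e3)
        have "exp (M * pi) * exp (M * ln (B + u)) \<le> exp (M * pi) * (B + u) ^ m" using e2 by (intro mult_left_mono) auto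
        then show "cmod (v powr (- a - 1)) \<le> exp (M * pi) * (B + u) ^ m" using e1 by linarith
      qed (use B1 True in auto)
      also have "\<dots> = g u"
      proof -
        have "exp (- u) = exp B * exp (- (B + u))" by (simp flip: exp_add)
        then show ?thesis using B1 True by (simp add: g_def mult_ac)
      qed
      finally show ?thesis using True by (simp add: v_def)
    qed
  qed
qed

section \<open>Stieltjes integrals off the ray and their recurrence\<close>

context saddle_setup begin

lemma w_nonzero: "w \<noteq> 0"
  using w by auto

definition off_ray :: "complex set" where
  "off_ray = {a. \<forall>t\<ge>0. a + of_real t * w \<noteq> 0}"

lemma set_integrable_stieltjes:
  assumes n: "n \<ge> 1" and a: "a \<in> off_ray"
  shows "set_integrable lborel {0<..} (\<lambda>t. of_real t ^ n * ray_kernel l (of_real t * w) / (a + of_real t * w))"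
proof -
  obtain \<delta> where \<delta>: "\<delta> > 0" "\<And>t. t \<ge> 0 \<Longrightarrow> \<delta> \<le> cmod (a + of_real t * w)"
    using ray_distance_pos[OF w_nonzero, of a] a by (auto simp: off_ray_def)
  let ?k = "\<lambda>t. of_real t ^ n * ray_kernel l (of_real t * w)"
  have k: "set_integrable lborel {0<..} ?k" by (rule set_integrable_ray_kernel[OF n])
  show ?thesis
  proof (rule set_integrable_bound[OF set_integrable_mult_right[of "of_real (1 / \<delta>)", OF k]])
    have "(\<lambda>t. indicat_real {0<..} t *\<^sub>R ?k t) \<in> borel_measurable lborel"
      using k unfolding set_integrable_def by (rule borel_measurable_integrable)
    then have "(\<lambda>t. (indicat_real {0<..} t *\<^sub>R ?k t) / (a + of_real t * w)) \<in> borel_measurable lborel"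
      by measurable
    moreover have "(indicat_real {0<..} t *\<^sub>R ?k t) / (a + of_real t * w) = indicat_real {0<..} t *\<^sub>R (?k t / (a + of_real t * w))" for t
      by (cases "t > 0") simp_all
    ultimately show "set_borel_measurable lborel {0<..} (\<lambda>t. ?k t / (a + of_real t * w))"
      unfolding set_borel_measurable_def by (simp only:)
    show "AE t in lborel. t \<in> {0<..} \<longrightarrow> norm (?k t / (a + of_real t * w)) \<le> norm (of_real (1 / \<delta>) * ?k t)"
    proof (rule AE_I2, rule impI)
      fix t :: real assume "t \<in> {0<..}"
      then have "\<delta> \<le> cmod (a + of_real t * w)" by (intro \<delta>) auto
      then have "cmod (?k t) / cmod (a + of_real t * w) \<le> cmod (?k t) / \<delta>"
        using \<delta>(1) by (intro divide_left_mono mult_pos_pos) auto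
      then show "norm (?k t / (a + of_real t * w)) \<le> norm (of_real (1 / \<delta>) * ?k t)"
        unfolding norm_divide[of "?k t"] norm_mult[of "of_real (1 / \<delta>)"] norm_of_real using \<delta>(1) by simp
    qed
  qed
qed

lemma stieltjes_holomorphic:
  assumes n: "n \<ge> 1"
  shows "stieltjes n holomorphic_on off_ray"
proof -
  let ?k = "\<lambda>t. of_real t ^ n * ray_kernel l (of_real t * w)"
  let ?f = "\<lambda>a t. indicat_real {0<..} t *\<^sub>R (?k t / (a + of_real t * w))"
  have "(\<lambda>a. \<integral>t. ?f a t \<partial>lborel) holomorphic_on off_ray"
  proof (rule holomorphic_on_lebesgue_integral)
    show "(\<lambda>a. ?f a t) holomorphic_on off_ray" for t
    proof (cases "t > 0")
      case True
      then have "(\<lambda>a. ?k t / (a + of_real t * w)) holomorphic_on off_ray"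
        by (intro holomorphic_intros) (auto simp: off_ray_def)
      then show ?thesis using True by simp
    qed simp
    show "(\<lambda>t. ?f a t) \<in> borel_measurable lborel" if "a \<in> off_ray" for a
      using set_integrable_stieltjes[OF n that] unfolding set_integrable_def by (rule borel_measurable_integrable)
    fix a assume a: "a \<in> off_ray"
    obtain \<delta> where \<delta>: "\<delta> > 0" "\<And>t. t \<ge> 0 \<Longrightarrow> \<delta> \<le> cmod (a + of_real t * w)"
      using ray_distance_pos[OF w_nonzero, of a] a by (auto simp: off_ray_def)
    have low: "\<delta> / 2 \<le> cmod (b + of_real t * w)" if "b \<in> cball a (\<delta> / 2)" "t \<ge> 0" for b t
    proof -
      have "cmod (a + of_real t * w) \<le> cmod (b + of_real t * w) + cmod (a - b)"
        using norm_triangle_ineq[of "b + of_real t * w" "a - b"] by (simp add: algebra_simps)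
      then show ?thesis using \<delta>(2)[OF that(2)] that(1) by (simp add: dist_norm)
    qed
    let ?g = "\<lambda>t. cmod (indicat_real {0<..} t *\<^sub>R ?k t) * (2 / \<delta>)"
    show "\<exists>r>0. \<exists>g. cball a r \<subseteq> off_ray \<and> integrable lborel g \<and> (\<forall>b\<in>cball a r. \<forall>t\<in>space lborel. cmod (?f b t) \<le> g t)"
    proof (intro exI[of _ "\<delta> / 2"] exI[of _ ?g] conjI ballI subsetI)
      show "b \<in> off_ray" if b: "b \<in> cball a (\<delta> / 2)" for b
        unfolding off_ray_def
      proof (intro CollectI allI impI notI)
        fix t :: real assume "t \<ge> 0" "b + of_real t * w = 0"
        then show False using low[OF b \<open>t \<ge> 0\<close>] \<delta>(1) by simp
      qed
      show "integrable lborel ?g"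
        using set_integrable_ray_kernel[OF n] unfolding set_integrable_def by (intro integrable_mult_left integrable_norm)
      fix b t assume b: "b \<in> cball a (\<delta> / 2)"
      show "cmod (?f b t) \<le> ?g t"
      proof (cases "t > 0")
        case True
        have "cmod (?k t) / cmod (b + of_real t * w) \<le> cmod (?k t) / (\<delta> / 2)"
          using low[OF b, of t] True \<delta>(1) by (intro divide_left_mono mult_pos_pos) auto
        then show ?thesis using True unfolding norm_scaleR norm_divide[of "?k t"] by simp
      qed simp
    qed (use \<delta> in auto)
  qed
  then have "(\<lambda>a. w ^ Suc n * (\<integral>t. ?f a t \<partial>lborel)) holomorphic_on off_ray"
    by (intro holomorphic_intros)
  then show ?thesis unfolding stieltjes_def[abs_def] set_lebesgue_integral_def .
qed

text \<open>\<open>x / (a + x) + a / (a + x) = 1\<close> under the integral, with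
  \<open>x = t * w\<close>. Iteration produces the expansion, the moments at \<open>u = 0\<close>
  carrying the coefficients.\<close>

lemma stieltjes_recurrence:
  assumes n: "n \<ge> 1" and a: "a \<in> off_ray"
  shows "stieltjes (Suc n) a + a * stieltjes n a = ray_moment l w n 0"
proof -
  let ?k = "\<lambda>t. of_real t ^ n * ray_kernel l (of_real t * w)"
  let ?g = "\<lambda>n t. of_real t ^ n * ray_kernel l (of_real t * w) / (a + of_real t * w)"
  have 1: "set_integrable lborel {0<..} (\<lambda>t. w * ?g (Suc n) t)"
    by (rule set_integrable_mult_right[OF set_integrable_stieltjes[OF _ a]]) simp
  have 2: "set_integrable lborel {0<..} (\<lambda>t. a * ?g n t)"
    by (rule set_integrable_mult_right[OF set_integrable_stieltjes[OF n a]])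
  have "stieltjes (Suc n) a + a * stieltjes n a = w ^ Suc n * (w * (LINT t:{0<..}|lborel. ?g (Suc n) t) + a * (LINT t:{0<..}|lborel. ?g n t))"
    unfolding stieltjes_def by (simp add: algebra_simps)
  also have "w * (LINT t:{0<..}|lborel. ?g (Suc n) t) + a * (LINT t:{0<..}|lborel. ?g n t) = (LINT t:{0<..}|lborel. w * ?g (Suc n) t + a * ?g n t)"
    using set_integral_add(2)[OF 1 2] by (simp only: set_integral_mult_right)
  also have "\<dots> = (LINT t:{0<..}|lborel. of_real t ^ n * ray_kernel l (of_real t * w) * exp (- of_real t * w * of_real 0))"
  proof (rule set_lebesgue_integral_cong)
    show "\<forall>t. t \<in> {0<..} \<longrightarrow> w * ?g (Suc n) t + a * ?g n t = of_real t ^ n * ray_kernel l (of_real t * w) * exp (- of_real t * w * of_real 0)"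
    proof (intro allI impI)
      fix t :: real assume "t \<in> {0<..}"
      then have nz: "a + of_real t * w \<noteq> 0" using a by (auto simp: off_ray_def)
      have "w * ?g (Suc n) t + a * ?g n t = ?k t * (a + of_real t * w) / (a + of_real t * w)"
        by (simp add: add_divide_distrib algebra_simps)
      then show "w * ?g (Suc n) t + a * ?g n t = of_real t ^ n * ray_kernel l (of_real t * w) * exp (- of_real t * w * of_real 0)"
        using nz by simp
    qed
  qed auto
  finally show ?thesis unfolding ray_moment_def .
qed

lemma ray_moment_0_imaginary:
  assumes n: "n \<ge> 1"
  shows "ray_moment l w n 0 - cnj (ray_moment l w n 0) = 2 * of_real pi * \<i> * ((- 1) ^ n * of_real (b_neg n l / (l + 1) ^ (2 * n + 1)))"
  using ray_moment_imaginary[OF l order_refl w n, of 0] b_neg_eq_higher_deriv[OF l(1), of n] by simp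

end

lemma b_neg_0: "b_neg 0 l = 1"
  by (simp add: b_neg_def)

locale sector_setup =
  fixes l \<omega> :: real
  assumes l: "l > 0" "l + ln l > 0" and \<omega>: "0 < \<omega>" "\<omega> < pi / 2"
begin

sublocale saddle_setup l "cis \<omega>"
  by unfold_locales (use l \<omega> in \<open>auto simp: cos_gt_zero_pi sin_ge_zero\<close>)

abbreviation S where "S \<equiv> sector (pi - \<omega>)"

lemma S_le_pi: "pi - \<omega> \<le> pi"
  using \<omega> by simp

lemma S_off_ray: "S \<subseteq> off_ray"
  using sector_avoids_ray[of \<omega>] \<omega> by (auto simp: off_ray_def)

lemma S_cnj_off_ray: "a \<in> S \<Longrightarrow> cnj a \<in> off_ray"
  using S_off_ray cnj_sector by blast

text \<open>For real \<open>a\<close> this is \<open>2 i\<close> times the imaginary part of the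
  Stieltjes integral. Reflecting \<open>a\<close> as well as the value keeps the second term
  holomorphic in \<open>a\<close>.\<close>

definition jump :: "nat \<Rightarrow> complex \<Rightarrow> complex" where
  "jump n a = stieltjes n a - cnj (stieltjes n (cnj a))"

lemma jump_holomorphic:
  assumes "n \<ge> 1"
  shows "jump n holomorphic_on S"
proof -
  have 1: "stieltjes n holomorphic_on S"
    by (rule holomorphic_on_subset[OF stieltjes_holomorphic[OF assms] S_off_ray])
  have "cnj ` S \<subseteq> S" using cnj_sector by blast
  then have "stieltjes n holomorphic_on cnj ` S" using 1 by (rule holomorphic_on_subset[rotated])
  then have "cnj \<circ> stieltjes n \<circ> cnj holomorphic_on S"
    by (rule holomorphic_on_compose_cnj_cnj[OF _ open_sector[OF S_le_pi]])
  then have "(\<lambda>a. stieltjes n a - (cnj \<circ> stieltjes n \<circ> cnj) a) holomorphic_on S"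
    using 1 by (intro holomorphic_on_diff)
  then show ?thesis by (simp add: jump_def[abs_def] o_def)
qed

lemma upper_Gamma_jump:
  assumes a: "a \<in> S"
  shows "upper_Gamma (- a) (of_real l * a) / ((of_real l * a) powr (- a) * exp (- (of_real l * a)))
    = 1 / (a * of_real (l + 1)) - jump 1 a / (2 * of_real pi * \<i> * a)"
proof -
  define d where "d = (\<lambda>a. upper_Gamma (- a) (of_real l * a) / ((of_real l * a) powr (- a) * exp (- (of_real l * a)))
    - (1 / (a * of_real (l + 1)) - jump 1 a / (2 * of_real pi * \<i> * a)))"
  have np: "a \<notin> \<real>\<^sub>\<le>\<^sub>0" if "a \<in> S" for a by (rule sector_not_nonpos_Reals[OF S_le_pi that])
  have nz: "a \<noteq> 0" if "a \<in> S" for a using that by (simp add: sector_def)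
  have lnp: "of_real l * a \<notin> \<real>\<^sub>\<le>\<^sub>0" if "a \<in> S" for a
    using np[OF that] l by (auto simp: complex_nonpos_Reals_iff mult_le_0_iff)
  have l1: "complex_of_real (l + 1) \<noteq> 0" using l by (metis add_pos_pos less_irrefl of_real_eq_0_iff zero_less_one)
  have G: "(\<lambda>a. upper_Gamma (- a) (of_real l * a)) holomorphic_on S"
    by (rule holomorphic_on_subset[OF upper_Gamma_holomorphic[OF l(1)]]) (use np in auto)
  have "(\<lambda>a. (of_real l * a) powr (- a) * exp (- (of_real l * a))) holomorphic_on S"
    using lnp by (intro holomorphic_intros) auto
  then have q: "(\<lambda>a. upper_Gamma (- a) (of_real l * a) / ((of_real l * a) powr (- a) * exp (- (of_real l * a)))) holomorphic_on S"
  proof (rule holomorphic_on_divide[OF G])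
    fix a assume "a \<in> S"
    then have "a \<noteq> 0" by (rule nz)
    then show "(of_real l * a) powr (- a) * exp (- (of_real l * a)) \<noteq> 0" using l(1) by simp
  qed
  have r: "(\<lambda>a. 1 / (a * complex_of_real (l + 1))) holomorphic_on S"
    using l1 nz by (intro holomorphic_on_divide holomorphic_on_mult holomorphic_on_const holomorphic_on_ident) (metis mult_eq_0_iff)
  have j: "(\<lambda>a. jump 1 a / (2 * of_real pi * \<i> * a)) holomorphic_on S"
  proof (rule holomorphic_on_divide[OF jump_holomorphic[OF order_refl]])
    show "(\<lambda>a. 2 * of_real pi * \<i> * a) holomorphic_on S" by (intro holomorphic_on_mult holomorphic_on_const holomorphic_on_ident)
    show "2 * of_real pi * \<i> * a \<noteq> 0" if "a \<in> S" for a using nz[OF that] by simp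
  qed
  have hol: "d holomorphic_on S"
    unfolding d_def by (rule holomorphic_on_diff[OF q holomorphic_on_diff[OF r j]])
  have "d a = 0"
  proof (rule analytic_continuation[OF hol open_sector[OF S_le_pi] connected_sector[OF S_le_pi]])
    show "complex_of_real ` {0<..} \<subseteq> S" using \<omega> by (auto simp: sector_def)
    then show "1 \<in> S" using \<omega> by (auto simp: sector_def)
    show "d z = 0" if zpos: "z \<in> of_real ` {0<..}" for z
    proof -
      obtain t where t: "t > 0" "z = of_real t" using zpos by auto
      show ?thesis using upper_Gamma_stieltjes_real[OF t(1)] by (simp add: d_def jump_def t(2))
    qed
  qed (use a one_islimpt_positive_reals in auto)
  then show ?thesis by (simp add: d_def)
qed

lemma jump_recurrence:
  assumes n: "n \<ge> 1" and a: "a \<in> S"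
  shows "jump (Suc n) a + a * jump n a = 2 * of_real pi * \<i> * ((- 1) ^ n * of_real (b_neg n l / (l + 1) ^ (2 * n + 1)))"
proof -
  have "stieltjes (Suc n) a + a * stieltjes n a = ray_moment l (cis \<omega>) n 0"
    by (rule stieltjes_recurrence[OF n]) (use a S_off_ray in auto)
  moreover have "stieltjes (Suc n) (cnj a) + cnj a * stieltjes n (cnj a) = ray_moment l (cis \<omega>) n 0"
    by (rule stieltjes_recurrence[OF n S_cnj_off_ray[OF a]])
  then have "cnj (stieltjes (Suc n) (cnj a)) + a * cnj (stieltjes n (cnj a)) = cnj (ray_moment l (cis \<omega>) n 0)"
    by (metis complex_cnj_add complex_cnj_cnj complex_cnj_mult)
  ultimately have "jump (Suc n) a + a * jump n a = ray_moment l (cis \<omega>) n 0 - cnj (ray_moment l (cis \<omega>) n 0)"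
    by (simp add: jump_def algebra_simps)
  then show ?thesis using ray_moment_0_imaginary[OF n] by simp
qed

text \<open>The case \<open>N = 1\<close> is \<open>upper_Gamma_jump\<close>, whose explicit term is
  the summand \<open>n = 0\<close>. Each use of \<open>jump_recurrence\<close> then peels off one
  more summand.\<close>

theorem remainder_eq_jump:
  assumes N: "N \<ge> 1" and a: "a \<in> S"
  shows "remainder N a l = (- 1) ^ N * jump N a / (2 * of_real pi * \<i> * a ^ N)"
  using N
proof (induction N rule: dec_induct)
  case base
  have l1: "complex_of_real (l + 1) \<noteq> 0" using l by (metis add_pos_pos less_irrefl of_real_eq_0_iff zero_less_one)
  have "of_real l * a + a = a * of_real (l + 1)" by (simp add: algebra_simps)
  then show ?case
    using upper_Gamma_jump[OF a] by (simp add: remainder_def Let_def b_neg_0 del: of_real_add)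
next
  case (step n)
  have a0: "a \<noteq> 0" using a by (simp add: sector_def)
  define P where "P = 2 * complex_of_real pi * \<i>"
  have P0: "P \<noteq> 0" by (simp add: P_def)
  define c where "c = complex_of_real (b_neg n l / (l + 1) ^ (2 * n + 1))"
  have J: "jump (Suc n) a = P * ((- 1) ^ n * c) - a * jump n a"
    using jump_recurrence[OF step(1) a] by (simp add: P_def c_def algebra_simps)
  \<comment> \<open>Because \<open>z + a = a (l + 1)\<close>, the summand has the normalisation in
    which \<open>b_neg\<close> appears in the recurrence.\<close>
  have "a ^ n * of_real (b_neg n l) / (of_real l * a + a) ^ (2 * n + 1) = c / a ^ Suc n"
  proof -
    have "of_real l * a + a = a * of_real (l + 1)" by (simp add: algebra_simps)
    then have "(of_real l * a + a) ^ (2 * n + 1) = a ^ n * (a ^ Suc n * of_real ((l + 1) ^ (2 * n + 1)))"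
      by (simp only: power_mult_distrib of_real_power) (simp add: mult_2 power_add)
    then show ?thesis using a0 by (simp add: c_def)
  qed
  then have "remainder (Suc n) a l = remainder n a l - c / a ^ Suc n"
    by (simp add: remainder_def Let_def)
  also have "\<dots> = (- 1) ^ n * jump n a / (P * a ^ n) - c / a ^ Suc n"
    using step.IH by (simp add: P_def)
  also have "\<dots> = (- 1) ^ Suc n * jump (Suc n) a / (P * a ^ Suc n)"
  proof -
    have m: "(- 1) ^ n * ((- 1) ^ n * x) = x" for x :: complex by (simp flip: mult.assoc power_mult_distrib)
    have "(- 1) ^ Suc n * jump (Suc n) a = a * ((- 1) ^ n * jump n a) - P * ((- 1) ^ n * ((- 1) ^ n * c))"
      unfolding J by (simp add: algebra_simps)
    also have "\<dots> = a * ((- 1) ^ n * jump n a) - P * c" unfolding m ..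
    finally show ?thesis using a0 P0 by (simp add: diff_divide_distrib)
  qed
  finally show ?case unfolding P_def .
qed

end

section \<open>The error bounds\<close>

text \<open>Rotating by \<open>- \<omega>\<close> puts the ray on the positive axis and gives
  \<open>a\<close> the argument \<open>\<psi> = Arg a - \<omega>\<close>. If
  \<open>cos \<psi> >= 0\<close>, adding \<open>t\<close> cannot decrease the modulus; otherwise the
  imaginary part alone contributes \<open>|a| |sin \<psi>|\<close>.\<close>

lemma cmod_le_C1_mult:
  fixes a :: complex and \<omega> t :: real
  assumes \<omega>: "0 < \<omega>" "\<omega> < pi / 2" and a: "\<bar>Arg a\<bar> < pi - \<omega>" and t: "t \<ge> 0"
  shows "cmod a \<le> C1 \<omega> (Arg a) * cmod (a + of_real t * cis \<omega>)"
proof -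
  define \<psi> where "\<psi> = Arg a - \<omega>"
  have rot: "cmod (a + of_real t * cis \<omega>) = cmod (of_real (cmod a) * cis \<psi> + of_real t)"
  proof -
    have "a = of_real (cmod a) * cis (Arg a)" using rcis_cmod_Arg[of a] by (simp add: rcis_def)
    also have "cis (Arg a) = cis \<omega> * cis \<psi>" by (simp add: \<psi>_def cis_mult)
    finally have "a + of_real t * cis \<omega> = cis \<omega> * (of_real (cmod a) * cis \<psi> + of_real t)" by (simp add: algebra_simps)
    then show ?thesis by (simp add: norm_mult)
  qed
  show ?thesis
  proof (cases "\<omega> - pi < Arg a \<and> Arg a < \<omega> - pi / 2 \<or> \<omega> + pi / 2 < Arg a \<and> Arg a < - \<omega> + pi")
    case True
    have s: "sin \<psi> \<noteq> 0"
    proof -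
      from True consider "- pi < \<psi> \<and> \<psi> < - (pi / 2)" | "pi / 2 < \<psi> \<and> \<psi> < pi"
        using \<omega> by (auto simp: \<psi>_def)
      then show ?thesis
      proof cases
        case 1
        then have "sin (- \<psi>) > 0" using pi_gt_zero by (intro sin_gt_zero) linarith+
        then show ?thesis by auto
      next
        case 2
        then have "sin \<psi> > 0" using pi_gt_zero by (intro sin_gt_zero) linarith+
        then show ?thesis by auto
      qed
    qed
    have "cmod a * \<bar>sin \<psi>\<bar> = \<bar>Im (of_real (cmod a) * cis \<psi> + of_real t)\<bar>" by (simp add: abs_mult)
    also have "\<dots> \<le> cmod (of_real (cmod a) * cis \<psi> + of_real t)" by (rule abs_Im_le_cmod)
    finally have "cmod a * \<bar>sin \<psi>\<bar> \<le> cmod (a + of_real t * cis \<omega>)" unfolding rot .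
    then have "cmod a \<le> \<bar>1 / sin \<psi>\<bar> * cmod (a + of_real t * cis \<omega>)"
      using s by (simp add: abs_divide field_simps)
    then show ?thesis using True by (simp add: C1_def \<psi>_def)
  next
    case False
    then have "\<omega> - pi / 2 \<le> Arg a \<and> Arg a \<le> \<omega> + pi / 2" using a \<omega> unfolding abs_less_iff by linarith
    then have "\<bar>\<psi>\<bar> \<le> pi / 2" unfolding \<psi>_def abs_le_iff by linarith
    then have c: "cos \<psi> \<ge> 0" by (intro cos_ge_zero) auto
    have "(cmod a)\<^sup>2 = (cmod a * cos \<psi>)\<^sup>2 + (cmod a * sin \<psi>)\<^sup>2"
      by (simp add: power_mult_distrib flip: distrib_left)
    also have "\<dots> \<le> (cmod a * cos \<psi> + t)\<^sup>2 + (cmod a * sin \<psi>)\<^sup>2"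
      using c t by (intro add_right_mono power_mono) auto
    also have "\<dots> = (cmod (a + of_real t * cis \<omega>))\<^sup>2" unfolding rot cmod_power2 by simp
    finally have "cmod a \<le> cmod (a + of_real t * cis \<omega>)" by (rule power2_le_imp_le) simp
    then show ?thesis using False by (auto simp: C1_def)
  qed
qed

lemma C1_minus: "C1 \<omega> (- \<theta>) = C2 \<omega> \<theta>"
proof -
  have "sin (- \<theta> - \<omega>) = - sin (\<theta> + \<omega>)" by (metis minus_add_distrib diff_conv_add_uminus sin_minus)
  moreover have "\<omega> - pi < - \<theta> \<and> - \<theta> < \<omega> - pi / 2 \<longleftrightarrow> - \<omega> + pi / 2 < \<theta> \<and> \<theta> < - \<omega> + pi"
    "\<omega> + pi / 2 < - \<theta> \<and> - \<theta> < - \<omega> + pi \<longleftrightarrow> \<omega> - pi < \<theta> \<and> \<theta> < - \<omega> - pi / 2"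
    by auto
  ultimately show ?thesis unfolding C1_def C2_def by (auto simp: abs_divide)
qed

text \<open>Logarithms in \<open>w * exp w = y\<close> give \<open>ln y = ln w + w\<close>, which
  increases with \<open>w\<close>. For the definite description, \<open>y > 0\<close> forces any
  solution to be positive, where \<open>w * exp w\<close> is strictly increasing.\<close>

lemma lambert_W_less_imp:
  assumes "y > 0" "lambert_W y < l"
  shows "l > 0" "ln y < l + ln l"
proof -
  have mono: "v * exp v < w * exp w" if "0 \<le> v" "v < w" for v w :: real
    using that by (intro mult_strict_mono) auto
  have "\<exists>w\<ge>0. w \<le> y \<and> w * exp w = y"
  proof (rule IVT')
    show "y \<le> y * exp y" using assms(1) by simp
    show "continuous_on {0..y} (\<lambda>w. w * exp w)" by (intro continuous_intros)
  qed (use assms in auto)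
  then obtain w where w: "w \<ge> 0" "w * exp w = y" by blast
  have w0: "w > 0" using w assms(1) by (cases "w = 0") auto
  have "lambert_W y = w"
    unfolding lambert_W_def
  proof (rule the_equality)
    fix v assume v: "- 1 \<le> v \<and> v * exp v = y"
    have "v > 0" using v assms(1) by (metis exp_gt_zero zero_less_mult_pos2)
    then show "v = w" using mono[of v w] mono[of w v] v w by (cases v w rule: linorder_cases) auto
  qed (use w in auto)
  then have wl: "w < l" using assms(2) by simp
  then show l: "l > 0" using w0 by simp
  have "ln y = ln w + w" using w w0 by (simp add: ln_mult flip: w(2))
  also have "\<dots> < l + ln l" using wl w0 ln_less_cancel_iff[OF w0 l] by linarith
  finally show "ln y < l + ln l" .
qed

text \<open>The factor \<open>x^x\<close> in Stirling's formula cancels against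
  \<open>(l x)^(- x)\<close>. What remains is \<open>x^(- 1/2)\<close> and the exponent
  \<open>- x (l + ln l + 1 - i pi)\<close>, which is how the saddle value enters.\<close>

lemma ray_kernel_eq_scaled_Gamma:
  assumes l: "l > 0" and x: "Re x > 0"
  shows "ray_kernel l x = of_real (sqrt (2 * pi)) * scaled_Gamma x * exp (- (Ln x / 2)) * exp (- (x * cnj (saddle l)))"
proof -
  have x0: "x \<noteq> 0" using x by auto
  define G where "G = scaled_Gamma x * of_real (sqrt (2 * pi))"
  have "Gamma x = G * (x powr (x - 1 / 2) * exp (- x))"
    unfolding G_def scaled_Gamma_def using x0 by simp
  moreover have "Ln (of_real l * x) = of_real (ln l) + Ln x"
    using Ln_times_of_real[OF l x0] l by (simp add: Ln_of_real)
  ultimately have "ray_kernel l x = G * (exp (- x * (of_real l - \<i> * of_real pi)) * (exp ((x - 1 / 2) * Ln x) * exp (- x) * exp (- x * (of_real (ln l) + Ln x))))"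
    unfolding ray_kernel_def using l x0 by (simp add: powr_def mult_ac)
  also have "\<dots> = G * exp (- x * (of_real l - \<i> * of_real pi) + ((x - 1 / 2) * Ln x + - x + - x * (of_real (ln l) + Ln x)))"
    by (simp only: exp_add)
  also have "- x * (of_real l - \<i> * of_real pi) + ((x - 1 / 2) * Ln x + - x + - x * (of_real (ln l) + Ln x)) = - (Ln x / 2) + - (x * cnj (saddle l))"
    by (simp add: saddle_def algebra_simps)
  finally show ?thesis unfolding exp_add by (simp add: G_def mult_ac)
qed

lemma cis_Arg_mult_cnj: "cis (Arg z) * cnj z = of_real (cmod z)"
proof -
  have "cnj z = of_real (cmod z) * cis (- Arg z)"
    by (metis cis_cnj complex_cnj_complex_of_real complex_cnj_mult rcis_cmod_Arg rcis_def)
  then show ?thesis by (simp add: cis_mult)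
qed

text \<open>In the direction \<open>omega l\<close>, the argument of \<open>saddle l\<close>, the
  product \<open>x * cnj (saddle l)\<close> is the positive number
  \<open>t * cmod (saddle l)\<close>. The factor \<open>x^(- 1/2)\<close> accounts for the exponent
  \<open>n - 1/2\<close>.\<close>

lemma cmod_ray_kernel_saddle_direction:
  assumes l: "l > 0" and re: "cos (omega l) > 0" and t: "t > 0"
  shows "cmod (of_real t ^ n * ray_kernel l (of_real t * cis (omega l)))
    = sqrt (2 * pi) * (t powr (real n - 1 / 2) * exp (- t * cmod (saddle l)) * cmod (scaled_Gamma (of_real t * cis (omega l))))"
proof -
  have "of_real t * cis (omega l) * cnj (saddle l) = of_real (t * cmod (saddle l))"
    using cis_Arg_mult_cnj[of "saddle l"] by (simp add: omega_def mult.assoc)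
  then have e: "cmod (exp (- (of_real t * cis (omega l) * cnj (saddle l)))) = exp (- t * cmod (saddle l))"
    unfolding norm_exp_eq_Re by (simp only: uminus_complex.sel Re_complex_of_real mult_minus_left)
  have "Re (Ln (of_real t * cis (omega l))) = ln t" using t by (simp add: norm_mult)
  then have "cmod (exp (- (Ln (of_real t * cis (omega l)) / 2))) = exp (- (ln t / 2))" by (simp add: norm_exp_eq_Re)
  also have "\<dots> = t powr (- (1 / 2))" using t by (simp add: powr_def)
  finally have p: "cmod (exp (- (Ln (of_real t * cis (omega l)) / 2))) = t powr (- (1 / 2))" .
  have "t ^ n * t powr (- (1 / 2)) = t powr (real n - 1 / 2)"
    using powr_add[of t "real n" "- (1 / 2)"] powr_realpow[OF t, of n] by (simp only: diff_conv_add_uminus)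
  moreover have "Re (of_real t * cis (omega l)) > 0" using t re by simp
  ultimately show ?thesis
    using ray_kernel_eq_scaled_Gamma[OF l, of "of_real t * cis (omega l)"] t e p
    by (simp add: norm_mult norm_power mult_ac)
qed

section \<open>The first inequality\<close>

context sector_setup begin

lemma cmod_stieltjes_le:
  assumes n: "n \<ge> 1" and a: "a \<in> S"
  shows "cmod (stieltjes n a) \<le> C1 \<omega> (Arg a) / cmod a * (LINT t:{0<..}|lborel. cmod (of_real t ^ n * ray_kernel l (of_real t * cis \<omega>)))"
proof -
  let ?k = "\<lambda>t. of_real t ^ n * ray_kernel l (of_real t * cis \<omega>)"
  have a0: "a \<noteq> 0" "\<bar>Arg a\<bar> < pi - \<omega>" using a by (auto simp: sector_def)
  have i: "set_integrable lborel {0<..} (\<lambda>t. ?k t / (a + of_real t * cis \<omega>))"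
    using set_integrable_stieltjes[OF n] S_off_ray a by auto
  have "cmod (stieltjes n a) = cmod (LINT t:{0<..}|lborel. ?k t / (a + of_real t * cis \<omega>))"
    unfolding stieltjes_def norm_mult norm_power norm_cis by simp
  also have "\<dots> \<le> (LINT t:{0<..}|lborel. cmod (?k t / (a + of_real t * cis \<omega>)))"
    by (rule set_integral_norm_bound[OF i])
  also have "\<dots> \<le> (LINT t:{0<..}|lborel. C1 \<omega> (Arg a) / cmod a * cmod (?k t))"
  proof (rule set_integral_mono)
    show "set_integrable lborel {0<..} (\<lambda>t. cmod (?k t / (a + of_real t * cis \<omega>)))" by (rule set_integrable_norm[OF i])
    show "set_integrable lborel {0<..} (\<lambda>t. C1 \<omega> (Arg a) / cmod a * cmod (?k t))"
      by (rule set_integrable_mult_right[OF set_integrable_norm[OF set_integrable_ray_kernel[OF n]]])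
    fix t :: real assume "t \<in> {0<..}"
    then have le: "cmod a \<le> C1 \<omega> (Arg a) * cmod (a + of_real t * cis \<omega>)"
      by (intro cmod_le_C1_mult \<omega> a0) auto
    have pos: "cmod (a + of_real t * cis \<omega>) > 0" using le a0 by (cases "a + of_real t * cis \<omega> = 0") auto
    have "1 / cmod (a + of_real t * cis \<omega>) \<le> C1 \<omega> (Arg a) / cmod a"
      using le pos a0 by (simp add: divide_le_eq mult.commute pos_le_divide_eq)
    then have "cmod (?k t) * (1 / cmod (a + of_real t * cis \<omega>)) \<le> cmod (?k t) * (C1 \<omega> (Arg a) / cmod a)"
      by (rule mult_left_mono) simp
    then show "cmod (?k t / (a + of_real t * cis \<omega>)) \<le> C1 \<omega> (Arg a) / cmod a * cmod (?k t)"
      unfolding norm_divide[of "?k t"] by (simp only: mult.commute[of _ "cmod (?k t)"] times_divide_eq_right mult_1_right)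
  qed
  also have "\<dots> = C1 \<omega> (Arg a) / cmod a * (LINT t:{0<..}|lborel. cmod (?k t))"
    by (rule set_integral_mult_right)
  finally show ?thesis .
qed

text \<open>The reflected half of \<open>jump\<close> is estimated at \<open>cnj a\<close>, whose
  argument has the opposite sign; \<open>C1_minus\<close> converts its constant into
  \<open>C2\<close>.\<close>

theorem cmod_remainder_le:
  assumes N: "N \<ge> 1" and a: "a \<in> S"
  shows "cmod (remainder N a l) \<le> (C1 \<omega> (Arg a) + C2 \<omega> (Arg a)) / (2 * pi * cmod a ^ Suc N)
    * (LINT t:{0<..}|lborel. cmod (of_real t ^ N * ray_kernel l (of_real t * cis \<omega>)))" (is "_ \<le> _ * ?K")
proof -
  have ca: "cnj a \<in> S" using a cnj_sector by blast
  have a0: "a \<noteq> 0" using a by (simp add: sector_def)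
  have "a \<notin> \<real>\<^sub>\<le>\<^sub>0" by (rule sector_not_nonpos_Reals[OF S_le_pi a])
  \<comment> \<open>\<open>Arg_cnj\<close> treats real numbers separately. In the sector a real
    \<open>a\<close> is positive, so its argument is \<open>0\<close> and the sign is
    immaterial.\<close>
  then have arg: "Arg (cnj a) = - Arg a \<or> Arg a = 0 \<and> Arg (cnj a) = 0" by (auto simp: Arg_cnj Arg_eq_0 complex_nonpos_Reals_iff complex_is_Real_iff)
  have C: "C1 \<omega> (Arg (cnj a)) = C2 \<omega> (Arg a)"
    using arg C1_minus[of \<omega> "Arg a"] by (metis minus_zero)
  have "cmod (jump N a) \<le> cmod (stieltjes N a) + cmod (stieltjes N (cnj a))"
    unfolding jump_def by (metis complex_mod_cnj norm_triangle_ineq4)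
  also have "\<dots> \<le> C1 \<omega> (Arg a) / cmod a * ?K + C2 \<omega> (Arg a) / cmod a * ?K"
    using cmod_stieltjes_le[OF N a] cmod_stieltjes_le[OF N ca] unfolding C complex_mod_cnj by (rule add_mono)
  also have "\<dots> = (C1 \<omega> (Arg a) + C2 \<omega> (Arg a)) / cmod a * ?K" by (simp add: add_divide_distrib distrib_right)
  finally have J: "cmod (jump N a) \<le> (C1 \<omega> (Arg a) + C2 \<omega> (Arg a)) / cmod a * ?K" .
  have "cmod (remainder N a l) = cmod (jump N a) / (2 * pi * cmod a ^ N)"
    unfolding remainder_eq_jump[OF N a] by (simp add: norm_mult norm_divide norm_power)
  also have "\<dots> \<le> ((C1 \<omega> (Arg a) + C2 \<omega> (Arg a)) / cmod a * ?K) / (2 * pi * cmod a ^ N)"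
    by (rule divide_right_mono[OF J]) simp
  also have "\<dots> = (C1 \<omega> (Arg a) + C2 \<omega> (Arg a)) / (2 * pi * cmod a ^ Suc N) * ?K" by (simp add: mult_ac)
  finally show ?thesis .
qed

end

section \<open>The second inequality\<close>

lemma has_bochner_integral_powr_exp:
  fixes c s :: real
  assumes c: "c > 0" and s: "s > 0"
  shows "has_bochner_integral lborel (\<lambda>t. indicat_real {0<..} t *\<^sub>R (t powr (s - 1) * exp (- t * c))) (Gamma s / c powr s)"
proof -
  let ?f = "\<lambda>t. indicator {0..} t * t powr (s - 1) / exp t :: real"
  have "has_bochner_integral lborel ?f (Gamma s)"
  proof (rule has_bochner_integral_nn_integral)
    show "(\<integral>\<^sup>+ t. ennreal (?f t) \<partial>lborel) = ennreal (Gamma s)"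
      by (rule Gamma_conv_nn_integral_real[OF s, symmetric])
  qed (use s Gamma_real_pos[of s] in \<open>auto simp: less_imp_le\<close>)
  then have "has_bochner_integral lborel (\<lambda>t. ?f (0 + c * t)) (Gamma s /\<^sub>R \<bar>c\<bar>)"
    using lborel_has_bochner_integral_real_affine_iff[of c ?f "Gamma s" 0] c by simp
  then have "has_bochner_integral lborel (\<lambda>t. c powr (1 - s) * ?f (0 + c * t)) (c powr (1 - s) * (Gamma s /\<^sub>R \<bar>c\<bar>))"
    by (rule has_bochner_integral_mult_right)
  moreover have "c powr (1 - s) * ?f (0 + c * t) = indicat_real {0<..} t *\<^sub>R (t powr (s - 1) * exp (- t * c))" for t
  proof (cases "t > 0")
    case True
    have "c powr (1 - s) * c powr (s - 1) = 1" using c by (simp flip: powr_add)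
    then have "c powr (1 - s) * (c * t) powr (s - 1) = t powr (s - 1)"
      using True c by (simp add: powr_mult flip: mult.assoc)
    then show ?thesis using True c by (simp add: exp_minus divide_inverse mult_ac)
  next
    case False
    then show ?thesis using c by (cases "t = 0") (auto simp: indicator_def zero_le_mult_iff)
  qed
  moreover have "c powr (1 - s) * (Gamma s /\<^sub>R \<bar>c\<bar>) = Gamma s / c powr s"
    using c by (simp add: powr_diff divide_inverse mult_ac)
  ultimately show ?thesis by simp
qed

lemma set_integrable_powr_exp:
  fixes c s :: real
  assumes "c > 0" "s > 0"
  shows "set_integrable lborel {0<..} (\<lambda>t. t powr (s - 1) * exp (- t * c))"
  using has_bochner_integral_powr_exp[OF assms] unfolding set_integrable_def by (rule integrable.intros)

lemma set_integral_powr_exp: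
  fixes c s :: real
  assumes "c > 0" "s > 0"
  shows "(LINT t:{0<..}|lborel. t powr (s - 1) * exp (- t * c)) = Gamma s / c powr s"
  using has_bochner_integral_powr_exp[OF assms] unfolding set_lebesgue_integral_def by (rule has_bochner_integral_integral_eq)

text \<open>The majorant \<open>1 + 1 / (12 t) + 1 / (288 t^2)\<close> is integrated term by term;
  \<open>p > 2\<close> makes the last term integrable at \<open>0\<close>, and the recursion of
  \<open>Gamma\<close> collects the three values. With \<open>p = N + 1/2\<close> this is the
  condition \<open>N >= 2\<close>.\<close>

lemma scaled_Gamma_integral_le:
  fixes c p :: real and w :: complex
  assumes c: "c > 0" and p: "p > 2" and w: "cmod w = 1" "Re w > 0" "\<bar>Im w\<bar> \<le> Re w"
    and int: "set_integrable lborel {0<..} (\<lambda>t. t powr (p - 1) * exp (- t * c) * cmod (scaled_Gamma (of_real t * w)))"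
  shows "(LINT t:{0<..}|lborel. t powr (p - 1) * exp (- t * c) * cmod (scaled_Gamma (of_real t * w)))
    \<le> Gamma p / c powr p * (1 + c / (12 * (p - 1)) + c\<^sup>2 / (288 * (p - 1) * (p - 2)))"
proof -
  let ?e = "\<lambda>s t. t powr (s - 1) * exp (- t * c)"
  have i: "set_integrable lborel {0<..} (?e p)" "set_integrable lborel {0<..} (\<lambda>t. 1 / 12 * ?e (p - 1) t)"
    "set_integrable lborel {0<..} (\<lambda>t. 1 / 288 * ?e (p - 2) t)"
    using c p by (intro set_integrable_powr_exp set_integrable_mult_right; simp)+
  note i2 = set_integral_add(1)[OF i(1,2)]
  have "(LINT t:{0<..}|lborel. ?e p t * cmod (scaled_Gamma (of_real t * w)))
    \<le> (LINT t:{0<..}|lborel. ?e p t + 1 / 12 * ?e (p - 1) t + 1 / 288 * ?e (p - 2) t)"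
  proof (rule set_integral_mono[OF int set_integral_add(1)[OF i2 i(3)]])
    fix t :: real assume "t \<in> {0<..}"
    then have t: "t > 0" by simp
    have "cmod (scaled_Gamma (of_real t * w)) \<le> 1 + 1 / (12 * cmod (of_real t * w)) + 1 / (288 * (cmod (of_real t * w))\<^sup>2)"
      by (rule cmod_scaled_Gamma_le) (use t w in \<open>auto simp: abs_mult mult_left_mono\<close>)
    then have "cmod (scaled_Gamma (of_real t * w)) \<le> 1 + 1 / (12 * t) + 1 / (288 * t\<^sup>2)"
      using t w by (simp add: norm_mult)
    then have "?e p t * cmod (scaled_Gamma (of_real t * w)) \<le> ?e p t * (1 + 1 / (12 * t) + 1 / (288 * t\<^sup>2))"
      by (rule mult_left_mono) simp
    also have "\<dots> = ?e p t + 1 / 12 * ?e (p - 1) t + 1 / 288 * ?e (p - 2) t"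
    proof -
      have "t powr (p - 1 - 1) = t powr (p - 1) / t"
        using t by (simp only: powr_diff[of t "p - 1" 1] powr_one[OF less_imp_le])
      moreover have "t powr (p - 2 - 1) = t powr (p - 1) / t\<^sup>2"
        using powr_diff[of t "p - 1" "real 2"] powr_realpow[OF t, of 2] by (simp add: algebra_simps)
      ultimately show ?thesis by (simp only:) (simp add: distrib_left)
    qed
    finally show "?e p t * cmod (scaled_Gamma (of_real t * w)) \<le> ?e p t + 1 / 12 * ?e (p - 1) t + 1 / 288 * ?e (p - 2) t" .
  qed
  also have "\<dots> = Gamma p / c powr p + 1 / 12 * (Gamma (p - 1) / c powr (p - 1)) + 1 / 288 * (Gamma (p - 2) / c powr (p - 2))"
    using c p by (simp only: set_integral_add(2)[OF i2 i(3)] set_integral_add(2)[OF i(1,2)] set_integral_mult_right)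
      (simp only: set_integral_powr_exp)
  also have "\<dots> = Gamma p / c powr p * (1 + c / (12 * (p - 1)) + c\<^sup>2 / (288 * (p - 1) * (p - 2)))"
  proof -
    have 1: "Gamma p = (p - 1) * Gamma (p - 1)" using Gamma_plus1[of "p - 1"] p by (auto simp: nonpos_Ints_def)
    have 2: "Gamma (p - 1) = (p - 2) * Gamma (p - 2)" using Gamma_plus1[of "p - 2"] p by (auto simp: nonpos_Ints_def)
    have 3: "c powr (p - 1) = c powr p / c" using c by (simp add: powr_diff)
    have 4: "c powr (p - 2) = c powr p / c\<^sup>2" using c powr_realpow[of c 2] by (simp add: powr_diff)
    define g q r P where "g = Gamma (p - 2)" and "q = p - 1" and "r = p - 2" and "P = c powr p"
    have "q > 0" "r > 0" "P > 0" using p c by (auto simp: q_def r_def P_def)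
    then show ?thesis
      unfolding 1 2 3 4
      unfolding g_def[symmetric] q_def[symmetric] r_def[symmetric] P_def[symmetric]
      using c by (simp add: field_simps power2_eq_square)
  qed
  finally show ?thesis .
qed

text \<open>The logarithm of \<open>exp (pi - 1)\<close> gives \<open>l + ln l > pi - 1\<close>,
  that is, \<open>Re (saddle l) > pi = Im (saddle l)\<close>; hence the argument is below
  \<open>pi / 4\<close>.\<close>

lemma omega_bounds:
  assumes "l > lambert_W (exp (pi - 1))"
  shows "0 < omega l" "omega l < pi / 4" "l > 0" "l + ln l > 0" "saddle l \<noteq> 0"
proof -
  show l: "l > 0" using lambert_W_less_imp(1)[OF _ assms] by simp
  have s: "pi - 1 < l + ln l" using lambert_W_less_imp(2)[OF _ assms] by simp
  show "l + ln l > 0" using s pi_gt3 by linarith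
  have re: "Re (saddle l) > pi" using s by (simp add: saddle_def)
  have im: "Im (saddle l) = pi" by (simp add: saddle_def)
  have re0: "Re (saddle l) > 0" using re pi_gt3 by linarith
  then show "saddle l \<noteq> 0" by auto
  have o: "omega l = arctan (pi / Re (saddle l))"
    unfolding omega_def arg_conv_arctan[OF re0] im ..
  show "0 < omega l" unfolding o using re0 by simp
  show "omega l < pi / 4" unfolding o using re re0 by (intro arctan_less_pi4_pos) (simp add: divide_less_eq)
qed

theorem mainTheorem6:
  fixes l \<theta> :: real and a z :: complex and N :: nat
  assumes "l > lambert_W (exp (pi - 1))"
    and "N \<ge> 1"
    and "a \<noteq> 0"
    and "z = of_real l * a"
    and "\<theta> = Arg a"
    and "\<bar>\<theta>\<bar> < - omega l + pi"
  shows "0 < omega l \<and> omega l < pi / 4 \<and>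
    cmod (remainder N a l) \<le>
      cmod (a ^ N / (z + a) ^ (2 * N + 1))
        * (2 * (l + 1) ^ (2 * N + 1) / sqrt (2 * pi))
        * (LINT t:{0<..}|lborel. t powr (real N - 1 / 2) * exp (- t * cmod (saddle l))
             * cmod (scaled_Gamma (of_real t * exp (\<i> * of_real (omega l)))))
        * (1 / 2 * (C1 (omega l) \<theta> + C2 (omega l) \<theta>)) \<and>
    (N \<ge> 2 \<longrightarrow>
      cmod (a ^ N / (z + a) ^ (2 * N + 1))
        * (2 * (l + 1) ^ (2 * N + 1) / sqrt (2 * pi))
        * (LINT t:{0<..}|lborel. t powr (real N - 1 / 2) * exp (- t * cmod (saddle l))
             * cmod (scaled_Gamma (of_real t * exp (\<i> * of_real (omega l)))))
      \<le> cmod (a ^ N / (z + a) ^ (2 * N + 1))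
          * (Gamma (real N + 1 / 2) * (l + 1) ^ (2 * N + 1)
              / ((1 / 2 * pi * cmod (saddle l)) powr (1 / 2) * cmod (saddle l) ^ N))
          * (1 + cmod (saddle l) / (12 * (real N - 1 / 2))
               + cmod (saddle l) ^ 2 / (288 * (real N - 1 / 2) * (real N - 3 / 2))))"
proof -
  note om = omega_bounds[OF assms(1)]
  have cis_exp: "exp (\<i> * of_real (omega l)) = cis (omega l)" by (simp add: cis_conv_exp)
  define c where "c = cmod (saddle l)"
  have c: "c > 0" using om(5) by (simp add: c_def)
  define f where "f = (\<lambda>t. t powr (real N - 1 / 2) * exp (- t * c) * cmod (scaled_Gamma (of_real t * cis (omega l))))"
  define I where "I = (LINT t:{0<..}|lborel. f t)"
  define A where "A = cmod (a ^ N / (z + a) ^ (2 * N + 1))"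
  define L where "L = (l + 1) ^ (2 * N + 1)"
  have cos_pos: "cos (omega l) > 0" using om by (intro cos_gt_zero_pi) auto
  have l1: "l + 1 > 0" using om(3) by simp
  have L: "L > 0" using l1 by (simp add: L_def)
  \<comment> \<open>By \<open>z + a = a (l + 1)\<close> the powers of \<open>l + 1\<close> cancel,
    leaving the power of \<open>|a|\<close> that occurs in \<open>cmod_remainder_le\<close>.\<close>
  have AL: "A * L = 1 / cmod a ^ Suc N"
  proof -
    have "z + a = a * of_real (l + 1)" using assms(4) by (simp add: algebra_simps)
    then have "A = cmod a ^ N / (cmod a ^ (2 * N + 1) * L)"
      unfolding A_def L_def using l1 by (simp only: norm_divide norm_power norm_mult norm_of_real power_mult_distrib abs_of_pos)
    also have "cmod a ^ (2 * N + 1) = cmod a ^ N * cmod a ^ Suc N" by (simp add: mult_2 power_add)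
    finally show ?thesis using assms(3) L by simp
  qed
  interpret sector_setup l "omega l"
    by unfold_locales (use om in auto)
  have a: "a \<in> S" using assms by (simp add: sector_def)
  have k: "cmod (of_real t ^ N * ray_kernel l (of_real t * cis (omega l))) = sqrt (2 * pi) * f t" if "t > 0" for t
    unfolding f_def c_def by (rule cmod_ray_kernel_saddle_direction[OF om(3) cos_pos that])
  \<comment> \<open>Integrability of \<open>f\<close> is inherited from the ray kernel through the
    pointwise identity \<open>k\<close>.\<close>
  have "set_integrable lborel {0<..} (\<lambda>t. cmod (of_real t ^ N * ray_kernel l (of_real t * cis (omega l))))"
    by (rule set_integrable_norm[OF set_integrable_ray_kernel[OF assms(2)]])
  moreover have "set_integrable lborel {0<..} (\<lambda>t. cmod (of_real t ^ N * ray_kernel l (of_real t * cis (omega l))))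
      = set_integrable lborel {0<..} (\<lambda>t. sqrt (2 * pi) * f t)"
    by (rule set_integrable_cong) (use k in auto)
  ultimately have "set_integrable lborel {0<..} (\<lambda>t. sqrt (2 * pi) * f t)" by simp
  then have int: "set_integrable lborel {0<..} f" by (subst (asm) set_integrable_mult_right_iff) auto
  have "(LINT t:{0<..}|lborel. cmod (of_real t ^ N * ray_kernel l (of_real t * cis (omega l)))) = (LINT t:{0<..}|lborel. sqrt (2 * pi) * f t)"
    by (rule set_lebesgue_integral_cong) (use k in auto)
  also have "\<dots> = sqrt (2 * pi) * I" unfolding I_def by (rule set_integral_mult_right)
  finally have K: "(LINT t:{0<..}|lborel. cmod (of_real t ^ N * ray_kernel l (of_real t * cis (omega l)))) = sqrt (2 * pi) * I" .
  have "cmod (remainder N a l) \<le> (C1 (omega l) \<theta> + C2 (omega l) \<theta>) / (2 * pi * cmod a ^ Suc N) * (sqrt (2 * pi) * I)"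
    using cmod_remainder_le[OF assms(2) a] unfolding K assms(5) .
  also have "\<dots> = A * L * (sqrt (2 * pi) / (2 * pi)) * I * (C1 (omega l) \<theta> + C2 (omega l) \<theta>)"
    unfolding AL by (simp add: mult_ac)
  also have "sqrt (2 * pi) / (2 * pi) = 1 / sqrt (2 * pi)"
    unfolding inverse_eq_divide[symmetric] by (rule sqrt_divide_self_eq) simp
  also have "A * L * (1 / sqrt (2 * pi)) * I * (C1 (omega l) \<theta> + C2 (omega l) \<theta>)
      = A * (2 * L / sqrt (2 * pi)) * I * (1 / 2 * (C1 (omega l) \<theta> + C2 (omega l) \<theta>))"
  proof -
    have "A * L * (1 / s) * J * D = A * (2 * L / s) * J * (1 / 2 * D)" for s J D :: real by simp
    then show ?thesis .
  qed
  finally have first: "cmod (remainder N a l) \<le> A * (2 * L / sqrt (2 * pi)) * I * (1 / 2 * (C1 (omega l) \<theta> + C2 (omega l) \<theta>))" .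
  have second: "A * (2 * L / sqrt (2 * pi)) * I \<le> A * (Gamma (real N + 1 / 2) * L / ((1 / 2 * pi * c) powr (1 / 2) * c ^ N))
      * (1 + c / (12 * (real N - 1 / 2)) + c ^ 2 / (288 * (real N - 1 / 2) * (real N - 3 / 2)))" (is "_ \<le> _ * ?B") if N: "N \<ge> 2"
  proof -
    define p where "p = real N + 1 / 2"
    have pN: "real N - 1 / 2 = p - 1" "real N - 3 / 2 = p - 2" by (simp_all add: p_def)
    \<comment> \<open>\<open>omega l < pi / 4\<close> places the ray in the cone
      \<open>|Im| <= Re\<close> of \<open>cmod_scaled_Gamma_le\<close>.\<close>
    have "sin (omega l) \<le> cos (omega l)"
    proof -
      have "sin (omega l) \<le> sin (pi / 2 - omega l)" using om by (intro sin_monotone_2pi_le) auto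
      then show ?thesis by (simp add: sin_diff)
    qed
    moreover have "sin (omega l) \<ge> 0" using om by (intro sin_ge_zero) auto
    ultimately have "I \<le> Gamma p / c powr p * ?B"
      unfolding I_def f_def pN
      by (intro scaled_Gamma_integral_le c) (use N int cos_pos in \<open>auto simp: p_def f_def\<close>)
    then have "A * (2 * L / sqrt (2 * pi)) * I \<le> A * (2 * L / sqrt (2 * pi)) * (Gamma p / c powr p * ?B)"
      using L by (intro mult_left_mono) (auto simp: A_def)
    also have "\<dots> = A * (Gamma p * L / (sqrt (2 * pi) / 2 * c powr p)) * ?B"
    proof -
      have "A * (2 * L / s) * (g / q * b) = A * (g * L / (s / 2 * q)) * b" for s g q b :: real by simp
      then show ?thesis .
    qed
    \<comment> \<open>Here \<open>sqrt (2 pi) / 2 = sqrt (pi / 2)\<close>, and the half power of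
      \<open>c\<close> in \<open>c powr (N + 1/2)\<close> goes under that root.\<close>
    also have "sqrt (2 * pi) / 2 * c powr p = (1 / 2 * pi * c) powr (1 / 2) * c ^ N"
    proof -
      have "2 * pi = 2\<^sup>2 * (1 / 2 * pi)" by simp
      then have "sqrt (2 * pi) = 2 * sqrt (1 / 2 * pi)" by (metis real_sqrt_mult real_sqrt_abs abs_numeral)
      moreover have "c powr p = c ^ N * sqrt c" using c by (simp add: p_def powr_add powr_realpow powr_half_sqrt)
      moreover have "(1 / 2 * pi * c) powr (1 / 2) = sqrt (1 / 2 * pi) * sqrt c"
        using c by (simp add: powr_half_sqrt flip: real_sqrt_mult)
      ultimately show ?thesis by simp
    qed
    finally show ?thesis unfolding p_def .
  qed
  show ?thesis
    unfolding cis_exp A_def[symmetric] L_def[symmetric] c_def[symmetric]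
    using om(1,2) first second unfolding I_def f_def by blast
qed

end
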